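(* Let $\boldsymbol\lambda=(\lambda_1,\lambda_2,\lambda_{12},0,0)$ and let $\mathcal{E}_{\boldsymbol\lambda}$ be the associated cleft object of $\mathfrak{B}_{\mathfrak{q}}$ (see context). The linear map $\gamma_{\boldsymbol\lambda}\colon\mathfrak{B}_{\mathfrak{q}}\to\mathcal{E}_{\boldsymbol\lambda}$ given on the PBW basis ($0\le n_2,n_{12},n_1\le N-1$) by $$\gamma_{\boldsymbol\lambda}(x_2^{n_2}x_{12}^{n_{12}}x_1^{n_1})=y_2^{n_2}y_{12}^{n_{12}}y_1^{n_1}\quad\text{if } n_{12}+n_1<N,$$ $$\gamma_{\boldsymbol\lambda}(x_2^{n_2}x_{12}^{n_{12}}x_1^{n_1})=y_2^{n_2}y_{12}^{n_{12}}y_1^{n_1}-\lambda_1\sum_{\substack{0\le k\le n_{12},\ 0\le m\le n_1\\ k+m=N,\ n_2+k<N}}C_{(k,m)}\,y_2^{n_2+k}y_{12}^{n_{12}-k}y_1^{n_1-m}\quad\text{if } n_{12}+n_1\ge N,$$ where $$C_{(k,m)}=\binom{n_{12}}{k}_q\binom{n_1}{m}_q(1-q^{-1})^{k}\,q_{21}^{\,n_2(k+m)+m\,n_{12}+\frac{k(k-1)}{2}}\,q^{\,m(n_{12}-k)},$$ is a section in $H$-mod (i.e. an $H$-linear, convolution-invertible isomorphism of right $\mathfrak{B}_{\mathfrak{q}}$-comodules with $\gamma_{\boldsymbol\lambda}(1)=1$) such that $\epsilon_0\gamma_{\boldsymbol\lambda}=\epsilon_{\mathfrak{B}_{\mathf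rak{q}}}$.
   Context: $\Bbbk$ is an algebraically closed field of characteristic zero; $N\ge3$; $q\in\Bbbk$ is a primitive $N$-th root of unity; $\mathfrak{q}=\left(\begin{smallmatrix} q & q_{12} \\ q_{21} & q \end{smallmatrix}\right)$ with $q_{12}q_{21}=q^{-1}$ (Cartan type $A_2$). $H$ is a semisimple Hopf algebra with a principal YD-realization of $\mathfrak{q}$: pairs $(g_i,\chi_i)$, $i=1,2$, of a group-like $g_i\in H$ and an algebra map $\chi_i\colon H\to\Bbbk$ with $\chi_i(h)g_i=\chi_i(h_{(2)})h_{(1)}g_i\mathcal{S}(h_{(3)})$ for $h\in H$ and $\chi_j(g_i)=q_{ij}$ ($q_{ii}=q$). $V$ has basis $x_1,x_2$ and is a Yetter–Drinfeld module via $h\cdot x_i=\chi_i(h)x_i$, $x_i\mapsto g_i\otimes x_i$. Its Nichols algebra $\mathfrak{B}_{\mathfrak{q}}$ is generated by $x_1,x_2$ with relations $x_1^N=x_2^N=x_{12}^N=0$, $x_{112}=x_{122}=0$, where $x_{12}=x_1x_2-q_{12}x_2x_1$, $x_{112}=x_1x_{12}-qq_{12}x_{12}x_1$, $x_{122}=x_{12}x_2-qq_{12}x_2x_{12}$; it has PBW basis $\{x_2^{n_2}x_{12}^{n_{12}}x_1^{n_1}:0\le n_2,n_{12},n_1\le N-1\}$, and $x_1,x_2$ are primitive. $\mathcal{E}_{\boldsymbol\lambda}$, for $\boldsymbol\lambda=(\lambda_1,\lambda_2,\lambda_{12},\lambda_{112},\lambda_{122})\in\Bbbk^5$, is the algebra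 generated by $y_1,y_2$ with relations $y_1^N=\lambda_1$, $y_2^N=\lambda_2$, $y_{12}^N=\lambda_{12}$, $y_{112}=\lambda_{112}$, $y_{122}=\lambda_{122}$, where $y_{12}=y_1y_2-q_{12}y_2y_1$, $y_{112}=y_1y_{12}-qq_{12}y_{12}y_1$, $y_{122}=y_{12}y_2-qq_{12}y_2y_{12}$; the parameters satisfy: $\lambda_i\ne0$ only if $\chi_i^N=\epsilon$; $\lambda_{12}\neq0$ only if $(\chi_1\chi_2)^N=\epsilon$; $\lambda_{112}\ne0$ only if $\chi_1^2\chi_2=\epsilon$; $\lambda_{122}\neq0$ only if $\chi_1\chi_2^2=\epsilon$. It is an $H$-module algebra via $h\cdot y_i=\chi_i(h)y_i$, and a right $\mathfrak{B}_{\mathfrak{q}}$-comodule algebra with coaction $\rho$ the algebra map with $\rho(y_i)=y_i\otimes1+1\otimes x_i$ (braided tensor product algebra: $(e\otimes b)(e'\otimes b')=e(b_{(-1)}\cdot e')\otimes b_{(0)}b'$). It is known that $\mathcal{E}_{\boldsymbol\lambda}$ is a cleft object for $\mathfrak{B}_{\mathfrak{q}}$ in $H$-mod with basis $\{y_2^{n_2}y_{12}^{n_{12}}y_1^{n_1}:0\le n_2,n_{12},n_1\le N-1\}$. The linear map $\epsilon_0\colon\mathcal{E}_{\boldsymbol\lambda}\to\Bbbk$ sends $1\mapsto1$ and every other element of this basis to $0$. Here (generic case) $\lambda_{112}=\lambda_{122}=0$. $\binom{n}{k}_q$ is the Gaussian binomial coefficient polynomial specialized at $q$. *)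

theory Defs
  imports
    "HOL-Algebra.QuotRing"
    "HOL-Algebra.Module"
    "HOL-Library.Poly_Mapping"
    "HOL-Computational_Algebra.Polynomial"
begin

section \<open>Algebras over a field\<close>

text \<open>
  The ground field is a type of class \<^class>\<open>field\<close>. Vector spaces and algebras over it are carried
  by the record \<^typ>\<open>('k, 'a) module\<close>; for a mere vector space the ring multiplication and unit of
  that record are irrelevant.
\<close>

definition ground :: "('k::field, 'k) module" where
  "ground = \<lparr>carrier = UNIV, monoid.mult = (*), one = 1, zero = 0, add = (+), module.smult = (*)\<rparr>"

definition k_algebra :: "('k::field, 'a, 'm) module_scheme \<Rightarrow> bool" where
  "k_algebra A \<longleftrightarrow> ring A \<and> Module.module ground A \<and>
     (\<forall>c. \<forall>a\<in>carrier A. \<forall>b\<in>carrier A.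
        (c \<odot>\<^bsub>A\<^esub> a) \<otimes>\<^bsub>A\<^esub> b = c \<odot>\<^bsub>A\<^esub> (a \<otimes>\<^bsub>A\<^esub> b) \<and>
        a \<otimes>\<^bsub>A\<^esub> (c \<odot>\<^bsub>A\<^esub> b) = c \<odot>\<^bsub>A\<^esub> (a \<otimes>\<^bsub>A\<^esub> b))"

definition lin_map ::
  "('k::field, 'a, 'm) module_scheme \<Rightarrow> ('k, 'b, 'n) module_scheme \<Rightarrow> ('a \<Rightarrow> 'b) \<Rightarrow> bool" where
  "lin_map V W f \<longleftrightarrow> f \<in> carrier V \<rightarrow> carrier W \<and>
     (\<forall>u\<in>carrier V. \<forall>v\<in>carrier V. f (u \<oplus>\<^bsub>V\<^esub> v) = f u \<oplus>\<^bsub>W\<^esub> f v) \<and>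
     (\<forall>c. \<forall>v\<in>carrier V. f (c \<odot>\<^bsub>V\<^esub> v) = c \<odot>\<^bsub>W\<^esub> f v)"

definition alg_map ::
  "('k::field, 'a, 'm) module_scheme \<Rightarrow> ('k, 'b, 'n) module_scheme \<Rightarrow> ('a \<Rightarrow> 'b) \<Rightarrow> bool" where
  "alg_map A B f \<longleftrightarrow> lin_map A B f \<and> f \<in> ring_hom A B"

definition left_ideal :: "('a, 'm) ring_scheme \<Rightarrow> 'a set \<Rightarrow> bool" where
  "left_ideal A L \<longleftrightarrow> additive_subgroup L A \<and> (\<forall>a\<in>carrier A. \<forall>l\<in>L. a \<otimes>\<^bsub>A\<^esub> l \<in> L)"

text \<open>Semisimplicity of the left regular module: every submodule is a direct summand.\<close>

definition semisimple_ring :: "('a, 'm) ring_scheme \<Rightarrow> bool" where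
  "semisimple_ring A \<longleftrightarrow>
     (\<forall>L. left_ideal A L \<longrightarrow>
        (\<exists>M. left_ideal A M \<and> L \<inter> M = {\<zero>\<^bsub>A\<^esub>} \<and> L <+>\<^bsub>A\<^esub> M = carrier A))"


section \<open>Tensor products\<close>

text \<open>
  The tensor product is the free vector space on \<open>carrier V \<times> carrier W\<close> modulo the subspace
  \<open>tensor_null\<close> spanned by the bilinearity relations; its elements are cosets. The coefficient
  \<open>c\<close> in the rules makes the set closed under scalar multiplication.
\<close>

inductive_set tensor_null ::
  "('k::field, 'a, 'm) module_scheme \<Rightarrow> ('k, 'b, 'n) module_scheme \<Rightarrow> ('a \<times> 'b \<Rightarrow>\<^sub>0 'k) set"
  for V :: "('k::field, 'a, 'm) module_scheme" and W :: "('k, 'b, 'n) module_scheme"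
where
  zero: "0 \<in> tensor_null V W"
| plus: "p \<in> tensor_null V W \<Longrightarrow> r \<in> tensor_null V W \<Longrightarrow> p + r \<in> tensor_null V W"
| add_left: "v \<in> carrier V \<Longrightarrow> v' \<in> carrier V \<Longrightarrow> w \<in> carrier W \<Longrightarrow>
    Poly_Mapping.single (v \<oplus>\<^bsub>V\<^esub> v', w) c - Poly_Mapping.single (v, w) c
      - Poly_Mapping.single (v', w) c \<in> tensor_null V W"
| add_right: "v \<in> carrier V \<Longrightarrow> w \<in> carrier W \<Longrightarrow> w' \<in> carrier W \<Longrightarrow>
    Poly_Mapping.single (v, w \<oplus>\<^bsub>W\<^esub> w') c - Poly_Mapping.single (v, w) c
      - Poly_Mapping.single (v, w') c \<in> tensor_null V W"
| smult_left: "v \<in> carrier V \<Longrightarrow> w \<in> carrier W \<Longrightarrow>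
    Poly_Mapping.single (a \<odot>\<^bsub>V\<^esub> v, w) c - Poly_Mapping.single (v, w) (a * c) \<in> tensor_null V W"
| smult_right: "v \<in> carrier V \<Longrightarrow> w \<in> carrier W \<Longrightarrow>
    Poly_Mapping.single (v, a \<odot>\<^bsub>W\<^esub> w) c - Poly_Mapping.single (v, w) (a * c) \<in> tensor_null V W"

definition tensor_class ::
  "('k::field, 'a, 'm) module_scheme \<Rightarrow> ('k, 'b, 'n) module_scheme \<Rightarrow>
   ('a \<times> 'b \<Rightarrow>\<^sub>0 'k) \<Rightarrow> ('a \<times> 'b \<Rightarrow>\<^sub>0 'k) set" where
  "tensor_class V W p = {r. r - p \<in> tensor_null V W}"

definition tensor ::
  "('k::field, 'a, 'm) module_scheme \<Rightarrow> ('k, 'b, 'n) module_scheme \<Rightarrow>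
   ('k, ('a \<times> 'b \<Rightarrow>\<^sub>0 'k) set) module" where
  "tensor V W =
     \<lparr>carrier = tensor_class V W ` {p. Poly_Mapping.keys p \<subseteq> carrier V \<times> carrier W},
      monoid.mult = undefined, one = undefined,
      zero = tensor_class V W 0,
      add = (\<lambda>s t. \<Union>p\<in>s. \<Union>r\<in>t. tensor_class V W (p + r)),
      module.smult = (\<lambda>c t. \<Union>p\<in>t. tensor_class V W (Poly_Mapping.map ((*) c) p))\<rparr>"

definition tens ::
  "('k::field, 'a, 'm) module_scheme \<Rightarrow> ('k, 'b, 'n) module_scheme \<Rightarrow> 'a \<Rightarrow> 'b \<Rightarrow>
   ('a \<times> 'b \<Rightarrow>\<^sub>0 'k) set" where
  "tens V W v w = tensor_class V W (Poly_Mapping.single (v, w) 1)"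

text \<open>
  \<open>tsum X f t\<close> is the value at the tensor \<open>t\<close> of the linear map into \<open>X\<close> induced by the bilinear map
  \<open>f\<close>: for \<open>t = \<Sum> v\<^sub>i \<otimes> w\<^sub>i\<close> it is \<open>\<Sum> f v\<^sub>i w\<^sub>i\<close>, independently of the representative. It renders
  Sweedler notation: \<open>f(h\<^sub>(\<^sub>1\<^sub>), h\<^sub>(\<^sub>2\<^sub>))\<close> is \<open>tsum X f (\<Delta> h)\<close>.
\<close>

definition tsum ::
  "('k::field, 'c, 'm) module_scheme \<Rightarrow> ('a \<Rightarrow> 'b \<Rightarrow> 'c) \<Rightarrow> ('a \<times> 'b \<Rightarrow>\<^sub>0 'k) set \<Rightarrow> 'c" where
  "tsum X f t = (let r = (SOME r. r \<in> t) in
     finsum X (\<lambda>z. Poly_Mapping.lookup r z \<odot>\<^bsub>X\<^esub> f (fst z) (snd z)) (Poly_Mapping.keys r))"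

definition tensor_alg ::
  "('k::field, 'a, 'm) module_scheme \<Rightarrow> ('k, 'b, 'n) module_scheme \<Rightarrow>
   ('k, ('a \<times> 'b \<Rightarrow>\<^sub>0 'k) set) module" where
  "tensor_alg A B = (tensor A B)
     \<lparr>monoid.mult := (\<lambda>s t. tsum (tensor A B) (\<lambda>a b. tsum (tensor A B) (\<lambda>a' b'.
          tens A B (a \<otimes>\<^bsub>A\<^esub> a') (b \<otimes>\<^bsub>B\<^esub> b')) t) s),
      one := tens A B \<one>\<^bsub>A\<^esub> \<one>\<^bsub>B\<^esub>\<rparr>"

text \<open>Here \<open>act\<close> is an action of a Hopf algebra on \<open>A\<close> and \<open>coact\<close> a left coaction of it on \<open>B\<close>:
  \<open>(a \<otimes> b)(a' \<otimes> b') = a (b\<^sub>(\<^sub>-\<^sub>1\<^sub>) \<cdot> a') \<otimes> b\<^sub>(\<^sub>0\<^sub>) b'\<close>.\<close>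

definition braided_tensor_alg ::
  "('h \<Rightarrow> 'a \<Rightarrow> 'a) \<Rightarrow> ('b \<Rightarrow> ('h \<times> 'b \<Rightarrow>\<^sub>0 'k) set) \<Rightarrow>
   ('k::field, 'a, 'm) module_scheme \<Rightarrow> ('k, 'b, 'n) module_scheme \<Rightarrow>
   ('k, ('a \<times> 'b \<Rightarrow>\<^sub>0 'k) set) module" where
  "braided_tensor_alg act coact A B = (tensor A B)
     \<lparr>monoid.mult := (\<lambda>s t. tsum (tensor A B) (\<lambda>a b. tsum (tensor A B) (\<lambda>a' b'.
          tsum (tensor A B) (\<lambda>h b0. tens A B (a \<otimes>\<^bsub>A\<^esub> act h a') (b0 \<otimes>\<^bsub>B\<^esub> b')) (coact b)) t) s),
      one := tens A B \<one>\<^bsub>A\<^esub> \<one>\<^bsub>B\<^esub>\<rparr>"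

definition convol ::
  "('c \<Rightarrow> ('c \<times> 'c \<Rightarrow>\<^sub>0 'k) set) \<Rightarrow> ('k::field, 'a, 'm) module_scheme \<Rightarrow>
   ('c \<Rightarrow> 'a) \<Rightarrow> ('c \<Rightarrow> 'a) \<Rightarrow> 'c \<Rightarrow> 'a" where
  "convol \<Delta> A f f' c = tsum A (\<lambda>u v. f u \<otimes>\<^bsub>A\<^esub> f' v) (\<Delta> c)"


section \<open>Hopf algebras\<close>

record (overloaded) ('k::zero, 'h) hopf = "('k, 'h) module" +
  comult :: "'h \<Rightarrow> ('h \<times> 'h \<Rightarrow>\<^sub>0 'k) set"
  counit :: "'h \<Rightarrow> 'k"
  antipode :: "'h \<Rightarrow> 'h"

definition hopf_algebra :: "('k::field, 'h, 'm) hopf_scheme \<Rightarrow> bool" where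
  "hopf_algebra H \<longleftrightarrow> k_algebra H \<and>
     alg_map H (tensor_alg H H) (comult H) \<and>
     alg_map H ground (counit H) \<and>
     lin_map H H (antipode H) \<and>
     (\<forall>h\<in>carrier H.
        tsum (tensor H (tensor H H)) (\<lambda>a b. tsum (tensor H (tensor H H))
            (\<lambda>a1 a2. tens H (tensor H H) a1 (tens H H a2 b)) (comult H a)) (comult H h)
        = tsum (tensor H (tensor H H)) (\<lambda>a b. tens H (tensor H H) a (comult H b)) (comult H h)) \<and>
     (\<forall>h\<in>carrier H.
        tsum H (\<lambda>a b. counit H a \<odot>\<^bsub>H\<^esub> b) (comult H h) = h \<and>
        tsum H (\<lambda>a b. counit H b \<odot>\<^bsub>H\<^esub> a) (comult H h) = h) \<and>
     (\<forall>h\<in>carrier H.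
        tsum H (\<lambda>a b. antipode H a \<otimes>\<^bsub>H\<^esub> b) (comult H h) = counit H h \<odot>\<^bsub>H\<^esub> \<one>\<^bsub>H\<^esub> \<and>
        tsum H (\<lambda>a b. a \<otimes>\<^bsub>H\<^esub> antipode H b) (comult H h) = counit H h \<odot>\<^bsub>H\<^esub> \<one>\<^bsub>H\<^esub>)"

definition group_like :: "('k::field, 'h, 'm) hopf_scheme \<Rightarrow> 'h \<Rightarrow> bool" where
  "group_like H g \<longleftrightarrow> g \<in> carrier H \<and> comult H g = tens H H g g \<and> counit H g = 1"

text \<open>The last clause is \<open>\<chi>(h) g = \<chi>(h\<^sub>(\<^sub>2\<^sub>)) h\<^sub>(\<^sub>1\<^sub>) g S(h\<^sub>(\<^sub>3\<^sub>))\<close>.\<close>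

definition yd_pair :: "('k::field, 'h, 'm) hopf_scheme \<Rightarrow> 'h \<Rightarrow> ('h \<Rightarrow> 'k) \<Rightarrow> bool" where
  "yd_pair H g \<chi> \<longleftrightarrow> group_like H g \<and> alg_map H ground \<chi> \<and>
     (\<forall>h\<in>carrier H. \<chi> h \<odot>\<^bsub>H\<^esub> g =
        tsum H (\<lambda>h1 b. tsum H (\<lambda>h2 h3.
          \<chi> h2 \<odot>\<^bsub>H\<^esub> (h1 \<otimes>\<^bsub>H\<^esub> g \<otimes>\<^bsub>H\<^esub> antipode H h3)) (comult H b)) (comult H h))"

abbreviation char_mult ::
  "('k::field, 'h, 'm) hopf_scheme \<Rightarrow> ('h \<Rightarrow> 'k) \<Rightarrow> ('h \<Rightarrow> 'k) \<Rightarrow> 'h \<Rightarrow> 'k" where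
  "char_mult H \<equiv> convol (comult H) ground"

primrec char_pow ::
  "('k::field, 'h, 'm) hopf_scheme \<Rightarrow> ('h \<Rightarrow> 'k) \<Rightarrow> nat \<Rightarrow> 'h \<Rightarrow> 'k" where
  "char_pow H \<chi> 0 = counit H"
| "char_pow H \<chi> (Suc n) = char_mult H \<chi> (char_pow H \<chi> n)"

definition trivial_char :: "('k::field, 'h, 'm) hopf_scheme \<Rightarrow> ('h \<Rightarrow> 'k) \<Rightarrow> bool" where
  "trivial_char H \<chi> \<longleftrightarrow> (\<forall>h\<in>carrier H. \<chi> h = counit H h)"

definition module_algebra ::
  "('k::field, 'h, 'm) hopf_scheme \<Rightarrow> ('k, 'a, 'n) module_scheme \<Rightarrow> ('h \<Rightarrow> 'a \<Rightarrow> 'a) \<Rightarrow> bool" where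
  "module_algebra H A act \<longleftrightarrow>
     (\<forall>h\<in>carrier H. lin_map A A (act h)) \<and>
     (\<forall>a\<in>carrier A. lin_map H A (\<lambda>h. act h a)) \<and>
     (\<forall>a\<in>carrier A. act \<one>\<^bsub>H\<^esub> a = a) \<and>
     (\<forall>h\<in>carrier H. \<forall>h'\<in>carrier H. \<forall>a\<in>carrier A. act (h \<otimes>\<^bsub>H\<^esub> h') a = act h (act h' a)) \<and>
     (\<forall>h\<in>carrier H. \<forall>a\<in>carrier A. \<forall>b\<in>carrier A.
        act h (a \<otimes>\<^bsub>A\<^esub> b) = tsum A (\<lambda>h1 h2. act h1 a \<otimes>\<^bsub>A\<^esub> act h2 b) (comult H h)) \<and>
     (\<forall>h\<in>carrier H. act h \<one>\<^bsub>A\<^esub> = counit H h \<odot>\<^bsub>A\<^esub> \<one>\<^bsub>A\<^esub>)"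


section \<open>Algebras given by two generators and relations\<close>

datatype gen = G1 | G2

datatype 'a free_word = Word "'a list"

instantiation free_word :: (type) monoid_add
begin

definition zero_free_word :: "'a free_word" where
  "0 = Word []"

fun plus_free_word :: "'a free_word \<Rightarrow> 'a free_word \<Rightarrow> 'a free_word" where
  "Word u + Word v = Word (u @ v)"

instance
proof
  fix a b c :: "'a free_word"
  show "a + b + c = a + (b + c)" by (cases a; cases b; cases c) simp
  show "0 + a = a" "a + 0 = a" by (cases a; simp add: zero_free_word_def)+
qed

end

text \<open>Words form a monoid under concatenation, so the convolution product on finitely supported
  functions makes this type the free associative unital algebra on two generators.\<close>

type_synonym 'k free_alg = "gen free_word \<Rightarrow>\<^sub>0 'k"

definition scal :: "'k::field \<Rightarrow> 'k free_alg" where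
  "scal c = Poly_Mapping.single 0 c"

definition var :: "gen \<Rightarrow> 'k::field free_alg" where
  "var i = Poly_Mapping.single (Word [i]) 1"

definition free_ring :: "'k::field free_alg ring" where
  "free_ring = \<lparr>carrier = UNIV, monoid.mult = (*), one = 1, zero = 0, add = (+)\<rparr>"

definition presented_alg :: "'k::field free_alg set \<Rightarrow> ('k, 'k free_alg set) module" where
  "presented_alg R = (let I = genideal free_ring R in
     ring.extend (free_ring Quot I)
       (module.fields (\<lambda>c X. \<Union>p\<in>X. I +>\<^bsub>free_ring\<^esub> (scal c * p))))"

definition presented_gen :: "'k::field free_alg set \<Rightarrow> gen \<Rightarrow> 'k free_alg set" where
  "presented_gen R i = genideal free_ring R +>\<^bsub>free_ring\<^esub> var i"

definition var12 :: "'k::field \<Rightarrow> 'k free_alg" where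
  "var12 q12 = var G1 * var G2 - scal q12 * var G2 * var G1"

definition var112 :: "'k::field \<Rightarrow> 'k \<Rightarrow> 'k free_alg" where
  "var112 q q12 = var G1 * var12 q12 - scal (q * q12) * var12 q12 * var G1"

definition var122 :: "'k::field \<Rightarrow> 'k \<Rightarrow> 'k free_alg" where
  "var122 q q12 = var12 q12 * var G2 - scal (q * q12) * var G2 * var12 q12"

definition nichols_rels :: "nat \<Rightarrow> 'k::field \<Rightarrow> 'k \<Rightarrow> 'k free_alg set" where
  "nichols_rels N q q12 =
     {var G1 ^ N, var G2 ^ N, var12 q12 ^ N, var112 q q12, var122 q q12}"

text \<open>The parameters are \<open>(\<lambda>\<^sub>1, \<lambda>\<^sub>2, \<lambda>\<^sub>1\<^sub>2, \<lambda>\<^sub>1\<^sub>1\<^sub>2, \<lambda>\<^sub>1\<^sub>2\<^sub>2)\<close>.\<close>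

type_synonym 'k cleft_params = "'k \<times> 'k \<times> 'k \<times> 'k \<times> 'k"

fun cleft_rels :: "nat \<Rightarrow> 'k::field \<Rightarrow> 'k \<Rightarrow> 'k cleft_params \<Rightarrow> 'k free_alg set" where
  "cleft_rels N q q12 (l1, l2, l12, l112, l122) =
     {var G1 ^ N - scal l1, var G2 ^ N - scal l2, var12 q12 ^ N - scal l12,
      var112 q q12 - scal l112, var122 q q12 - scal l122}"

fun admissible ::
  "('k::field, 'h, 'm) hopf_scheme \<Rightarrow> (gen \<Rightarrow> 'h \<Rightarrow> 'k) \<Rightarrow> nat \<Rightarrow> 'k cleft_params \<Rightarrow> bool" where
  "admissible H \<chi> N (l1, l2, l12, l112, l122) \<longleftrightarrow>
     (l1 \<noteq> 0 \<longrightarrow> trivial_char H (char_pow H (\<chi> G1) N)) \<and>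
     (l2 \<noteq> 0 \<longrightarrow> trivial_char H (char_pow H (\<chi> G2) N)) \<and>
     (l12 \<noteq> 0 \<longrightarrow> trivial_char H (char_pow H (char_mult H (\<chi> G1) (\<chi> G2)) N)) \<and>
     (l112 \<noteq> 0 \<longrightarrow> trivial_char H (char_mult H (char_pow H (\<chi> G1) 2) (\<chi> G2))) \<and>
     (l122 \<noteq> 0 \<longrightarrow> trivial_char H (char_mult H (\<chi> G1) (char_pow H (\<chi> G2) 2)))"

text \<open>The element \<open>a\<^sub>2\<^bsup>n2\<^esup> a\<^sub>1\<^sub>2\<^bsup>n12\<^esup> a\<^sub>1\<^bsup>n1\<^esup>\<close> with \<open>a\<^sub>1\<^sub>2 = a\<^sub>1 a\<^sub>2 - q\<^sub>1\<^sub>2 a\<^sub>2 a\<^sub>1\<close>.\<close>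

definition pbw ::
  "('k::field, 'a, 'm) module_scheme \<Rightarrow> 'k \<Rightarrow> (gen \<Rightarrow> 'a) \<Rightarrow> nat \<Rightarrow> nat \<Rightarrow> nat \<Rightarrow> 'a" where
  "pbw A q12 a n2 n12 n1 =
     (a G2 [^]\<^bsub>A\<^esub> n2)
     \<otimes>\<^bsub>A\<^esub> ((a G1 \<otimes>\<^bsub>A\<^esub> a G2 \<ominus>\<^bsub>A\<^esub> q12 \<odot>\<^bsub>A\<^esub> (a G2 \<otimes>\<^bsub>A\<^esub> a G1)) [^]\<^bsub>A\<^esub> n12)
     \<otimes>\<^bsub>A\<^esub> (a G1 [^]\<^bsub>A\<^esub> n1)"


section \<open>Gaussian binomials, roots of unity, sections\<close>

definition q_fact_poly :: "nat \<Rightarrow> 'k::field poly" where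
  "q_fact_poly n = (\<Prod>i=1..n. \<Sum>j<i. monom 1 j)"

definition gauss_binomial :: "'k::field \<Rightarrow> nat \<Rightarrow> nat \<Rightarrow> 'k" where
  "gauss_binomial q n k =
     (if k \<le> n then poly (q_fact_poly n div (q_fact_poly k * q_fact_poly (n - k))) q else 0)"

definition primitive_root_of_unity :: "nat \<Rightarrow> 'k::field \<Rightarrow> bool" where
  "primitive_root_of_unity N q \<longleftrightarrow> q ^ N = 1 \<and> (\<forall>m. 0 < m \<and> m < N \<longrightarrow> q ^ m \<noteq> 1)"

definition convol_invertible ::
  "('k::field, 'b, 'm) module_scheme \<Rightarrow> ('b \<Rightarrow> ('b \<times> 'b \<Rightarrow>\<^sub>0 'k) set) \<Rightarrow> ('b \<Rightarrow> 'k) \<Rightarrow>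
   ('k, 'e, 'n) module_scheme \<Rightarrow> ('b \<Rightarrow> 'e) \<Rightarrow> bool" where
  "convol_invertible B \<Delta> \<epsilon> E f \<longleftrightarrow>
     (\<exists>f'. lin_map B E f' \<and>
        (\<forall>b\<in>carrier B. convol \<Delta> E f f' b = \<epsilon> b \<odot>\<^bsub>E\<^esub> \<one>\<^bsub>E\<^esub> \<and>
                        convol \<Delta> E f' f b = \<epsilon> b \<odot>\<^bsub>E\<^esub> \<one>\<^bsub>E\<^esub>))"

text \<open>A section \<open>\<gamma>: B \<rightarrow> E\<close> in \<open>H\<close>-mod, for a right \<open>B\<close>-comodule algebra \<open>E\<close> with coaction \<open>\<rho>\<close>;
  the fourth clause is \<open>\<rho> \<gamma> = (\<gamma> \<otimes> id) \<Delta>\<close>.\<close>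

definition is_section ::
  "('k::field, 'h, 'l) hopf_scheme \<Rightarrow>
   ('k, 'b, 'm) module_scheme \<Rightarrow> ('h \<Rightarrow> 'b \<Rightarrow> 'b) \<Rightarrow> ('b \<Rightarrow> ('b \<times> 'b \<Rightarrow>\<^sub>0 'k) set) \<Rightarrow> ('b \<Rightarrow> 'k) \<Rightarrow>
   ('k, 'e, 'n) module_scheme \<Rightarrow> ('h \<Rightarrow> 'e \<Rightarrow> 'e) \<Rightarrow> ('e \<Rightarrow> ('e \<times> 'b \<Rightarrow>\<^sub>0 'k) set) \<Rightarrow>
   ('b \<Rightarrow> 'e) \<Rightarrow> bool" where
  "is_section H B actB \<Delta> \<epsilon> E actE \<rho> \<gamma> \<longleftrightarrow>
     lin_map B E \<gamma> \<and>
     bij_betw \<gamma> (carrier B) (carrier E) \<and>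
     (\<forall>h\<in>carrier H. \<forall>b\<in>carrier B. \<gamma> (actB h b) = actE h (\<gamma> b)) \<and>
     (\<forall>b\<in>carrier B. \<rho> (\<gamma> b) = tsum (tensor E B) (\<lambda>u v. tens E B (\<gamma> u) v) (\<Delta> b)) \<and>
     convol_invertible B \<Delta> \<epsilon> E \<gamma> \<and>
     \<gamma> \<one>\<^bsub>B\<^esub> = \<one>\<^bsub>E\<^esub>"

end

theory Submission
  imports Defs
begin

text \<open>
  Put \<open>\<Phi> = (\<epsilon>\<^sub>0 \<otimes> id) \<rho>\<close>, a linear map from the cleft object \<open>E\<close> to \<open>B\<close>. Coassociativity makes \<open>\<Phi>\<close> colinear, so
  it suffices to show that \<open>\<gamma>\<close> inverts \<open>\<Phi>\<close>. In the braided product, \<open>\<rho>(y\<^sub>1\<^sub>2)\<close> is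
  \<open>y\<^sub>1\<^sub>2 \<otimes> 1 + (1 - q\<^sup>-\<^sup>1) y\<^sub>1 \<otimes> x\<^sub>2 + 1 \<otimes> x\<^sub>1\<^sub>2\<close> with \<open>q\<close>-commuting summands, so the \<open>q\<close>-binomial theorem
  expands \<open>\<rho>\<close> of a PBW monomial. Applying \<open>\<epsilon>\<^sub>0\<close> only keeps the terms whose left factor is \<open>1\<close> or
  \<open>y\<^sub>1\<^sup>N = \<lambda>\<^sub>1\<close>, and the latter carry exactly the coefficients \<open>C\<close>. A second correction cannot occur
  because \<open>n\<^sub>1\<^sub>2 + n\<^sub>1 < 2N\<close>, whence \<open>\<Phi> \<gamma> = id\<close>. Surjectivity of \<open>\<gamma>\<close> is triangularity on the
  spanning PBW monomials; their linear independence is never needed.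
  Coassociativity itself is checked on words in the generators, where the
  coproduct is a quantum shuffle, which avoids iterated braided tensor products.
\<close>

section \<open>Vector spaces and linear maps\<close>

text \<open>The ingredients of the coefficients \<open>C\<close> have separate sources. The factor
  \<open>1 - inverse q\<close> is \<open>1 - q12 * q21\<close>: both products y1 y2 and y2 y1
  contribute to y1 \<otimes> x2, while their contributions to y2 \<otimes> x1 cancel. The powers of
  \<open>q21\<close> and \<open>q\<close> count crossings. The condition \<open>n2 + k < N\<close>
  reflects x2^N = 0 in the Nichols algebra, since a correction term carries x2^(n2+k). Terms with y2
  or y12 on the left are killed by \<epsilon>0 because these two exponents stay below N, so that the
  relations for y2^N and y12^N cannot turn them into scalars.

  H-linearity is a comparison of weights. A correction monomial has degree in y1 lowered by N and
  unchanged degree in y2, so its weight changes by the N-th power of \<chi>1, which is trivial as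
  soon as \<lambda>1 is nonzero. Weights depend on degrees alone only if \<chi>1 and \<chi>2
  commute; this is derived from the Yetter-Drinfeld condition.

  Convolution invertibility uses that the Nichols algebra is spanned by words of bounded length,
  which makes \<epsilon> - \<gamma> nilpotent under convolution.\<close>

locale kspace = abelian_group V for V :: "('k::field, 'a, 'm) module_scheme" (structure) +
  assumes smult_closed [simp, intro]: "v \<in> carrier V \<Longrightarrow> c \<odot> v \<in> carrier V"
    and smult_l_distr: "v \<in> carrier V \<Longrightarrow> (a + b) \<odot> v = a \<odot> v \<oplus> b \<odot> v"
    and smult_r_distr: "v \<in> carrier V \<Longrightarrow> w \<in> carrier V \<Longrightarrow> c \<odot> (v \<oplus> w) = c \<odot> v \<oplus> c \<odot> w"
    and smult_smult: "v \<in> carrier V \<Longrightarrow> a \<odot> (b \<odot> v) = (a * b) \<odot> v"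
    and smult_1 [simp]: "v \<in> carrier V \<Longrightarrow> 1 \<odot> v = v"

lemma ground_simps [simp]:
  "carrier ground = UNIV" "monoid.mult ground = (*)" "one ground = 1" "zero ground = 0"
  "add ground = (+)" "module.smult ground = (*)"
  by (simp_all add: ground_def)

lemma cring_ground: "cring (ground :: ('k::field, 'k) module)"
proof (rule cringI)
  show "abelian_group (ground :: ('k::field, 'k) module)"
  proof (rule abelian_groupI)
    fix x :: 'k
    show "\<exists>y\<in>carrier ground. y \<oplus>\<^bsub>ground\<^esub> x = \<zero>\<^bsub>ground\<^esub>"
      by (auto intro: exI[of _ "- x"])
  qed (auto simp: algebra_simps)
  show "comm_monoid (ground :: ('k::field, 'k) module)"
    by (rule comm_monoidI) (auto simp: algebra_simps)
qed (auto simp: algebra_simps)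

lemma kspace_iff_module: "kspace V \<longleftrightarrow> Module.module ground V"
proof
  assume "kspace V"
  then interpret kspace V .
  show "Module.module ground V"
    by (rule moduleI) (auto simp: cring_ground abelian_group_axioms smult_l_distr smult_r_distr smult_smult)
next
  assume "Module.module ground V"
  then interpret V: Module.module ground V .
  show "kspace V"
    using V.smult_l_distr V.smult_r_distr V.smult_assoc1 V.smult_one V.smult_closed
    by unfold_locales auto
qed

context kspace
begin

lemma smult_0 [simp]: "v \<in> carrier V \<Longrightarrow> 0 \<odot> v = \<zero>"
  by (metis add.l_cancel_one' smult_closed smult_l_distr add_0)

lemma smult_zero [simp]: "c \<odot> \<zero> = \<zero>"
  by (metis smult_0 smult_smult mult_zero_right zero_closed)

lemma smult_minus1: "v \<in> carrier V \<Longrightarrow> (- 1) \<odot> v = \<ominus> v"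
  by (metis add.inv_equality smult_0 smult_1 smult_closed smult_l_distr add.left_inverse)

lemma minus_eq_smult: "v \<in> carrier V \<Longrightarrow> w \<in> carrier V \<Longrightarrow> v \<ominus> w = v \<oplus> (- 1) \<odot> w"
  by (simp add: smult_minus1 a_minus_def)

lemma smult_finsum:
  "f \<in> A \<rightarrow> carrier V \<Longrightarrow> c \<odot> finsum V f A = finsum V (\<lambda>i. c \<odot> f i) A"
proof (induction A rule: infinite_finite_induct)
  case (insert x F)
  then show ?case
    by (subst (1 2) finsum_insert) (auto simp: smult_r_distr finsum_closed)
qed auto

end

lemma kspace_ground [simp, intro]: "kspace (ground :: ('k::field, 'k) module)"
proof -
  interpret cring "ground :: ('k, 'k) module" by (rule cring_ground)
  show ?thesis by unfold_locales (auto simp: algebra_simps)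
qed

lemma a_inv_ground: "a_inv ground (c :: 'k::field) = - c"
proof -
  interpret kspace "ground :: ('k, 'k) module" ..
  show ?thesis using smult_minus1[of c] by simp
qed

lemma lin_mapI:
  assumes "\<And>v. v \<in> carrier V \<Longrightarrow> f v \<in> carrier W"
    "\<And>u v. u \<in> carrier V \<Longrightarrow> v \<in> carrier V \<Longrightarrow> f (u \<oplus>\<^bsub>V\<^esub> v) = f u \<oplus>\<^bsub>W\<^esub> f v"
    "\<And>c v. v \<in> carrier V \<Longrightarrow> f (c \<odot>\<^bsub>V\<^esub> v) = c \<odot>\<^bsub>W\<^esub> f v"
  shows "lin_map V W f"
  using assms by (auto simp: lin_map_def)

lemma lin_map_closed: "lin_map V W f \<Longrightarrow> v \<in> carrier V \<Longrightarrow> f v \<in> carrier W"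
  and lin_map_add: "lin_map V W f \<Longrightarrow> u \<in> carrier V \<Longrightarrow> v \<in> carrier V \<Longrightarrow>
    f (u \<oplus>\<^bsub>V\<^esub> v) = f u \<oplus>\<^bsub>W\<^esub> f v"
  and lin_map_smult: "lin_map V W f \<Longrightarrow> v \<in> carrier V \<Longrightarrow> f (c \<odot>\<^bsub>V\<^esub> v) = c \<odot>\<^bsub>W\<^esub> f v"
  by (auto simp: lin_map_def)

lemma lin_map_comp: "lin_map V W f \<Longrightarrow> lin_map W X g \<Longrightarrow> lin_map V X (\<lambda>v. g (f v))"
  by (auto simp: lin_map_def Pi_iff)

lemma lin_map_id: "lin_map V V (\<lambda>v. v)"
  by (auto simp: lin_map_def)

lemma lin_map_plus:
  assumes "kspace W" "lin_map V W f" "lin_map V W g"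
  shows "lin_map V W (\<lambda>v. f v \<oplus>\<^bsub>W\<^esub> g v)"
proof -
  interpret kspace W by fact
  show ?thesis using assms(2,3)
    by (intro lin_mapI)
       (auto simp: lin_map_closed lin_map_add lin_map_smult smult_r_distr a_ac)
qed

lemma lin_map_scale:
  assumes "kspace W" "lin_map V W f"
  shows "lin_map V W (\<lambda>v. c \<odot>\<^bsub>W\<^esub> f v)"
proof -
  interpret kspace W by fact
  show ?thesis using assms(2)
    by (intro lin_mapI)
       (auto simp: lin_map_closed lin_map_add lin_map_smult smult_r_distr smult_smult mult.commute)
qed

lemma lin_map_zero:
  assumes "kspace V" "kspace W" "lin_map V W f"
  shows "f \<zero>\<^bsub>V\<^esub> = \<zero>\<^bsub>W\<^esub>"
proof -
  interpret V: kspace V by fact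
  interpret W: kspace W by fact
  have "f (0 \<odot>\<^bsub>V\<^esub> \<zero>\<^bsub>V\<^esub>) = 0 \<odot>\<^bsub>W\<^esub> f \<zero>\<^bsub>V\<^esub>"
    by (rule lin_map_smult[OF assms(3)]) simp
  then show ?thesis using lin_map_closed[OF assms(3), of "\<zero>\<^bsub>V\<^esub>"] by simp
qed

lemma lin_map_diff:
  assumes "kspace V" "kspace W" "lin_map V W f" "u \<in> carrier V" "v \<in> carrier V"
  shows "f (u \<ominus>\<^bsub>V\<^esub> v) = f u \<ominus>\<^bsub>W\<^esub> f v"
proof -
  interpret V: kspace V by fact
  interpret W: kspace W by fact
  show ?thesis using assms(3-5)
    by (simp add: V.minus_eq_smult W.minus_eq_smult lin_map_add lin_map_smult lin_map_closed)
qed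

lemma lin_map_finsum:
  assumes "kspace V" "kspace W" "lin_map V W f" "g \<in> A \<rightarrow> carrier V"
  shows "f (finsum V g A) = finsum W (\<lambda>i. f (g i)) A"
proof -
  interpret V: kspace V by fact
  interpret W: kspace W by fact
  show ?thesis using assms(4)
  proof (induction A rule: infinite_finite_induct)
    case (insert x F)
    have "f (finsum V g (insert x F)) = f (g x \<oplus>\<^bsub>V\<^esub> finsum V g F)"
      using insert by (subst V.finsum_insert) auto
    also have "\<dots> = f (g x) \<oplus>\<^bsub>W\<^esub> finsum W (\<lambda>i. f (g i)) F"
      using insert by (subst lin_map_add[OF assms(3)]) (auto simp: V.finsum_closed)
    also have "\<dots> = finsum W (\<lambda>i. f (g i)) (insert x F)"
      using insert lin_map_closed[OF assms(3)] by (subst W.finsum_insert) auto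
    finally show ?case .
  qed (simp_all add: lin_map_zero[OF assms(1-3)])
qed

subsection \<open>Subspaces and spans\<close>

definition subsp :: "('k::field, 'a, 'm) module_scheme \<Rightarrow> 'a set \<Rightarrow> bool" where
  "subsp V S \<longleftrightarrow> S \<subseteq> carrier V \<and> \<zero>\<^bsub>V\<^esub> \<in> S \<and> (\<forall>u\<in>S. \<forall>v\<in>S. u \<oplus>\<^bsub>V\<^esub> v \<in> S)
     \<and> (\<forall>c. \<forall>v\<in>S. c \<odot>\<^bsub>V\<^esub> v \<in> S)"

text \<open>Defined from above, so that inclusion in a subspace is immediate. Arguments by linearity
  then apply this to preimages and equalizers of linear maps.\<close>

definition vspan :: "('k::field, 'a, 'm) module_scheme \<Rightarrow> 'a set \<Rightarrow> 'a set" where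
  "vspan V P = \<Inter>{S. subsp V S \<and> P \<subseteq> S}"

lemma subsp_zero: "subsp V S \<Longrightarrow> \<zero>\<^bsub>V\<^esub> \<in> S"
  and subsp_add: "subsp V S \<Longrightarrow> u \<in> S \<Longrightarrow> v \<in> S \<Longrightarrow> u \<oplus>\<^bsub>V\<^esub> v \<in> S"
  and subsp_smult: "subsp V S \<Longrightarrow> v \<in> S \<Longrightarrow> c \<odot>\<^bsub>V\<^esub> v \<in> S"
  and subsp_carrier: "subsp V S \<Longrightarrow> v \<in> S \<Longrightarrow> v \<in> carrier V"
  by (auto simp: subsp_def)

lemma subsp_UNIV: "kspace V \<Longrightarrow> subsp V (carrier V)"
proof -
  assume "kspace V"
  then interpret kspace V .
  show ?thesis by (auto simp: subsp_def)
qed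

lemma subsp_vspan:
  assumes "kspace V" "P \<subseteq> carrier V"
  shows "subsp V (vspan V P)"
  using assms subsp_UNIV[of V] unfolding vspan_def subsp_def by blast

lemma vspan_base: "v \<in> P \<Longrightarrow> v \<in> vspan V P"
  by (auto simp: vspan_def)

lemma vspan_minimal: "subsp V S \<Longrightarrow> P \<subseteq> S \<Longrightarrow> vspan V P \<subseteq> S"
  by (auto simp: vspan_def)

lemma subsp_preimage:
  assumes "kspace V" "kspace W" "lin_map V W f" "subsp W S"
  shows "subsp V {v \<in> carrier V. f v \<in> S}"
proof -
  interpret V: kspace V by fact
  show ?thesis
    using assms lin_map_zero[OF assms(1-3)]
    by (auto simp: subsp_def lin_map_add lin_map_smult)
qed

lemma subsp_image:
  assumes "kspace V" "kspace W" "lin_map V W f" "subsp V S"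
  shows "subsp W (f ` S)"
proof -
  note c = subsp_carrier[OF assms(4)]
  have "f u \<oplus>\<^bsub>W\<^esub> f v \<in> f ` S" if "u \<in> S" "v \<in> S" for u v
    unfolding lin_map_add[OF assms(3) c[OF that(1)] c[OF that(2)], symmetric]
    using that by (intro imageI subsp_add[OF assms(4)])
  moreover have "a \<odot>\<^bsub>W\<^esub> f v \<in> f ` S" if "v \<in> S" for v a
    unfolding lin_map_smult[OF assms(3) c[OF that], symmetric]
    using that by (intro imageI subsp_smult[OF assms(4)])
  moreover have "\<zero>\<^bsub>W\<^esub> \<in> f ` S"
    using lin_map_zero[OF assms(1-3)] subsp_zero[OF assms(4)] by force
  ultimately show ?thesis
    using assms(3,4) by (auto simp: subsp_def lin_map_def)
qed

lemma vspan_image: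
  assumes "kspace V" "kspace W" "lin_map V W f" "P \<subseteq> carrier V" "Q \<subseteq> carrier W"
    "\<And>v. v \<in> P \<Longrightarrow> f v \<in> vspan W Q" "v \<in> vspan V P"
  shows "f v \<in> vspan W Q"
proof -
  have "vspan V P \<subseteq> {v \<in> carrier V. f v \<in> vspan W Q}"
    using assms(4,6)
    by (intro vspan_minimal subsp_preimage[OF assms(1-3)] subsp_vspan[OF assms(2,5)]) auto
  then show ?thesis using assms(7) by blast
qed

lemma subsp_equalizer:
  assumes "kspace V" "kspace W" "lin_map V W f" "lin_map V W g"
  shows "subsp V {v \<in> carrier V. f v = g v}"
proof -
  interpret V: kspace V by fact
  show ?thesis
    using assms lin_map_zero[OF assms(1-3)] lin_map_zero[OF assms(1,2,4)]
    by (auto simp: subsp_def lin_map_add lin_map_smult)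
qed

lemma lin_map_eq_on_vspan:
  assumes "kspace V" "kspace W" "lin_map V W f" "lin_map V W g" "P \<subseteq> carrier V"
    "\<And>v. v \<in> P \<Longrightarrow> f v = g v" "v \<in> vspan V P"
  shows "f v = g v"
proof -
  have "vspan V P \<subseteq> {v \<in> carrier V. f v = g v}"
    using assms(5,6) by (intro vspan_minimal subsp_equalizer[OF assms(1-4)]) auto
  then show ?thesis using assms(7) by blast
qed

lemma subsp_finsum:
  assumes "kspace V" "subsp V S" "\<And>i. i \<in> A \<Longrightarrow> f i \<in> S"
  shows "finsum V f A \<in> S"
proof -
  interpret V: kspace V by fact
  show ?thesis using assms(3)
  proof (induction A rule: infinite_finite_induct)
    case (insert x F)
    then show ?case using subsp_carrier[OF assms(2)]
      by (subst V.finsum_insert) (auto intro: subsp_add[OF assms(2)])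
  qed (auto simp: subsp_zero[OF assms(2)])
qed

lemma subsp_diff:
  assumes "kspace V" "subsp V S" "u \<in> S" "v \<in> S"
  shows "u \<ominus>\<^bsub>V\<^esub> v \<in> S"
proof -
  interpret V: kspace V by fact
  show ?thesis using assms subsp_carrier[OF assms(2)]
    by (auto simp: V.minus_eq_smult intro: subsp_add subsp_smult)
qed

subsection \<open>Bilinear maps\<close>

definition bilin where
  "bilin V W X f \<longleftrightarrow> (\<forall>v\<in>carrier V. lin_map W X (f v)) \<and>
     (\<forall>w\<in>carrier W. lin_map V X (\<lambda>v. f v w))"

lemma bilinI:
  assumes "\<And>v. v \<in> carrier V \<Longrightarrow> lin_map W X (f v)"
    and "\<And>w. w \<in> carrier W \<Longrightarrow> lin_map V X (\<lambda>v. f v w)"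
  shows "bilin V W X f"
  using assms by (auto simp: bilin_def)

lemma bilin_left: "bilin V W X f \<Longrightarrow> w \<in> carrier W \<Longrightarrow> lin_map V X (\<lambda>v. f v w)"
  and bilin_right: "bilin V W X f \<Longrightarrow> v \<in> carrier V \<Longrightarrow> lin_map W X (f v)"
  by (auto simp: bilin_def)

lemma bilin_closed: "bilin V W X f \<Longrightarrow> v \<in> carrier V \<Longrightarrow> w \<in> carrier W \<Longrightarrow> f v w \<in> carrier X"
  by (auto simp: bilin_def lin_map_def)

lemma bilin_comp:
  assumes "bilin V W X f" "lin_map V' V g" "lin_map W' W h" "lin_map X X' k"
  shows "bilin V' W' X' (\<lambda>v w. k (f (g v) (h w)))"
proof (rule bilinI)
  fix v assume "v \<in> carrier V'"
  then have "lin_map W X (f (g v))" using assms by (auto simp: lin_map_closed intro: bilin_right)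
  then show "lin_map W' X' (\<lambda>w. k (f (g v) (h w)))"
    using assms(3,4) by (intro lin_map_comp[OF _ assms(4)]) (rule lin_map_comp)
next
  fix w assume "w \<in> carrier W'"
  then have "lin_map V X (\<lambda>v. f v (h w))" using assms by (auto simp: lin_map_closed intro: bilin_left)
  then show "lin_map V' X' (\<lambda>v. k (f (g v) (h w)))"
    using assms(2,4) by (intro lin_map_comp[OF _ assms(4)]) (rule lin_map_comp[OF assms(2)])
qed

lemma bilin_plus:
  "kspace X \<Longrightarrow> bilin V W X f \<Longrightarrow> bilin V W X g \<Longrightarrow> bilin V W X (\<lambda>v w. f v w \<oplus>\<^bsub>X\<^esub> g v w)"
  by (auto simp: bilin_def intro: lin_map_plus)

lemma bilin_scale:
  "kspace X \<Longrightarrow> bilin V W X f \<Longrightarrow> bilin V W X (\<lambda>v w. c \<odot>\<^bsub>X\<^esub> f v w)"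
  by (auto simp: bilin_def intro: lin_map_scale)

lemma bilin_smult_fun:
  assumes "kspace X" "lin_map V ground f" "lin_map W X g"
  shows "bilin V W X (\<lambda>v w. f v \<odot>\<^bsub>X\<^esub> g w)"
proof -
  interpret X: kspace X by fact
  show ?thesis using assms(2,3)
    by (auto intro!: bilinI lin_mapI simp: lin_map_closed lin_map_add lin_map_smult
        X.smult_r_distr X.smult_l_distr X.smult_smult mult_ac)
qed

section \<open>The tensor product\<close>

lemma keys_add_sub: "Poly_Mapping.keys p \<subseteq> A \<Longrightarrow> Poly_Mapping.keys r \<subseteq> A \<Longrightarrow>
    Poly_Mapping.keys (p + r) \<subseteq> A"
  using Poly_Mapping.keys_add[of p r] by blast

lemma keys_minus_sub: "Poly_Mapping.keys p \<subseteq> A \<Longrightarrow> Poly_Mapping.keys r \<subseteq> A \<Longrightarrow>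
    Poly_Mapping.keys (p - r :: _ \<Rightarrow>\<^sub>0 'k::ab_group_add) \<subseteq> A"
  using Poly_Mapping.keys_diff[of p r] by blast

lemma update_eq_plus_single:
  "a \<notin> Poly_Mapping.keys f \<Longrightarrow> Poly_Mapping.update a b f = f + Poly_Mapping.single a b"
  by (intro poly_mapping_eqI)
     (auto simp: lookup_update lookup_add lookup_single when_def in_keys_iff)

abbreviation pm_scale :: "'k \<Rightarrow> ('z \<Rightarrow>\<^sub>0 'k) \<Rightarrow> ('z \<Rightarrow>\<^sub>0 'k::field)" where
  "pm_scale c \<equiv> Poly_Mapping.map ((*) c)"

lemma lookup_pm_scale: "Poly_Mapping.lookup (pm_scale c p) z = c * Poly_Mapping.lookup p z"
  by (simp add: Poly_Mapping.map.rep_eq when_def)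

lemma pm_scale_simps:
  "pm_scale c (p + r) = pm_scale c p + pm_scale c r"
  "pm_scale c (p - r) = pm_scale c p - pm_scale c r"
  "pm_scale c (Poly_Mapping.single z d) = Poly_Mapping.single z (c * d)"
  "pm_scale (a + b) p = pm_scale a p + pm_scale b p"
  "pm_scale a (pm_scale b p) = pm_scale (a * b) p"
  "pm_scale 1 p = p" "pm_scale c 0 = 0"
  by (auto intro!: poly_mapping_eqI
      simp: lookup_pm_scale lookup_add lookup_minus algebra_simps lookup_single when_def)

lemma keys_pm_scale: "Poly_Mapping.keys (pm_scale c p) \<subseteq> Poly_Mapping.keys p"
  by (auto simp: in_keys_iff lookup_pm_scale)

lemma tensor_null_keys:
  assumes "kspace V" "kspace W" "p \<in> tensor_null V W"
  shows "Poly_Mapping.keys p \<subseteq> carrier V \<times> carrier W"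
proof -
  interpret V: kspace V by fact
  interpret W: kspace W by fact
  show ?thesis using assms(3)
  proof induction
    case zero
    then show ?case by simp
  next
    case (plus p r)
    then show ?case by (simp add: keys_add_sub)
  qed (intro keys_minus_sub; simp)+
qed

lemma tensor_null_scale: "p \<in> tensor_null V W \<Longrightarrow> pm_scale c p \<in> tensor_null V W"
proof (induction rule: tensor_null.induct)
  case (smult_left v w a d)
  then show ?case
    using tensor_null.smult_left[of v V w W a "c * d"] by (simp add: pm_scale_simps mult.left_commute)
next
  case (smult_right v w a d)
  then show ?case
    using tensor_null.smult_right[of v V w W a "c * d"] by (simp add: pm_scale_simps mult.left_commute)
qed (auto simp: pm_scale_simps intro: tensor_null.intros)

lemma tensor_null_uminus: "p \<in> tensor_null V W \<Longrightarrow> - p \<in> tensor_null V W"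
proof -
  have "pm_scale (- 1) p = - p" by (rule poly_mapping_eqI) (simp add: lookup_pm_scale)
  then show "p \<in> tensor_null V W \<Longrightarrow> - p \<in> tensor_null V W"
    using tensor_null_scale[of p V W "- 1"] by simp
qed

lemma tensor_null_minus: "p \<in> tensor_null V W \<Longrightarrow> r \<in> tensor_null V W \<Longrightarrow> p - r \<in> tensor_null V W"
  using tensor_null.plus[OF _ tensor_null_uminus, of p V W r] by simp

lemma mem_tensor_class: "r \<in> tensor_class V W p \<longleftrightarrow> r - p \<in> tensor_null V W"
  by (simp add: tensor_class_def)

lemma self_in_tensor_class: "p \<in> tensor_class V W p"
  by (simp add: mem_tensor_class tensor_null.zero)

lemma tensor_class_eq_iff: "tensor_class V W p = tensor_class V W r \<longleftrightarrow> p - r \<in> tensor_null V W"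
proof
  assume "tensor_class V W p = tensor_class V W r"
  then show "p - r \<in> tensor_null V W"
    using self_in_tensor_class[of p V W] by (simp add: mem_tensor_class)
next
  assume *: "p - r \<in> tensor_null V W"
  have "s - r \<in> tensor_null V W" if "s - p \<in> tensor_null V W" for s
    using tensor_null.plus[OF that *] by simp
  moreover have "s - p \<in> tensor_null V W" if "s - r \<in> tensor_null V W" for s
    using tensor_null_minus[OF that *] by simp
  ultimately show "tensor_class V W p = tensor_class V W r"
    by (auto simp: tensor_class_def)
qed

lemma tensor_add_class:
  "tensor_class V W p \<oplus>\<^bsub>tensor V W\<^esub> tensor_class V W r = tensor_class V W (p + r)"
proof -
  have "tensor_class V W (p' + r') = tensor_class V W (p + r)"
    if "p' \<in> tensor_class V W p" "r' \<in> tensor_class V W r" for p' r'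
    using tensor_null.plus[of "p' - p" V W "r' - r"] that
    by (simp add: mem_tensor_class tensor_class_eq_iff algebra_simps)
  then have "(\<Union>p'\<in>tensor_class V W p. \<Union>r'\<in>tensor_class V W r. tensor_class V W (p' + r')) =
      (\<Union>p'\<in>tensor_class V W p. \<Union>r'\<in>tensor_class V W r. tensor_class V W (p + r))"
    by (intro SUP_cong refl)
  moreover have "tensor_class V W p \<noteq> {}" "tensor_class V W r \<noteq> {}"
    using self_in_tensor_class by blast+
  ultimately show ?thesis by (simp add: tensor_def)
qed

lemma tensor_smult_class:
  "c \<odot>\<^bsub>tensor V W\<^esub> tensor_class V W p = tensor_class V W (pm_scale c p)"
proof -
  have "tensor_class V W (pm_scale c p') = tensor_class V W (pm_scale c p)"
    if "p' \<in> tensor_class V W p" for p'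
    using tensor_null_scale[of "p' - p" V W c] that
    by (simp add: mem_tensor_class tensor_class_eq_iff pm_scale_simps)
  then have "(\<Union>p'\<in>tensor_class V W p. tensor_class V W (pm_scale c p')) =
      (\<Union>p'\<in>tensor_class V W p. tensor_class V W (pm_scale c p))"
    by (intro SUP_cong refl)
  moreover have "tensor_class V W p \<noteq> {}"
    using self_in_tensor_class by blast
  ultimately show ?thesis by (simp add: tensor_def)
qed

lemma tensor_zero_class: "\<zero>\<^bsub>tensor V W\<^esub> = tensor_class V W 0"
  by (simp add: tensor_def)

lemma tensor_carrier:
  "carrier (tensor V W) = tensor_class V W ` {p. Poly_Mapping.keys p \<subseteq> carrier V \<times> carrier W}"
  by (simp add: tensor_def)

lemma tensor_class_closed:
  "Poly_Mapping.keys p \<subseteq> carrier V \<times> carrier W \<Longrightarrow> tensor_class V W p \<in> carrier (tensor V W)"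
  by (auto simp: tensor_carrier)

lemma tensor_carrierE:
  assumes "t \<in> carrier (tensor V W)"
  obtains p where "t = tensor_class V W p" "Poly_Mapping.keys p \<subseteq> carrier V \<times> carrier W"
  using assms by (auto simp: tensor_carrier)

lemma kspace_tensor [intro]: "kspace (tensor V W)"
proof -
  have "abelian_group (tensor V W)"
  proof (rule abelian_groupI)
    fix x assume "x \<in> carrier (tensor V W)"
    then obtain p where p: "x = tensor_class V W p" "Poly_Mapping.keys p \<subseteq> carrier V \<times> carrier W"
      by (rule tensor_carrierE)
    have "tensor_class V W (- p) \<in> carrier (tensor V W)"
      using p by (intro tensor_class_closed) (auto simp: in_keys_iff)
    moreover have "tensor_class V W (- p) \<oplus>\<^bsub>tensor V W\<^esub> x = \<zero>\<^bsub>tensor V W\<^esub>"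
      by (simp add: p tensor_add_class tensor_zero_class)
    ultimately show "\<exists>y\<in>carrier (tensor V W). y \<oplus>\<^bsub>tensor V W\<^esub> x = \<zero>\<^bsub>tensor V W\<^esub>" by blast
  next
    fix x y assume "x \<in> carrier (tensor V W)" "y \<in> carrier (tensor V W)"
    then show "x \<oplus>\<^bsub>tensor V W\<^esub> y \<in> carrier (tensor V W)"
      by (elim tensor_carrierE) (simp add: tensor_add_class tensor_class_closed keys_add_sub)
  next
    show "\<zero>\<^bsub>tensor V W\<^esub> \<in> carrier (tensor V W)"
      by (simp add: tensor_zero_class tensor_class_closed)
  qed (auto elim!: tensor_carrierE simp: tensor_add_class tensor_zero_class ac_simps)
  then interpret abelian_group "tensor V W" .
  show ?thesis
  proof
    fix c v assume "v \<in> carrier (tensor V W)"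
    then show "c \<odot>\<^bsub>tensor V W\<^esub> v \<in> carrier (tensor V W)"
      by (elim tensor_carrierE)
         (simp add: tensor_smult_class tensor_class_closed subset_trans[OF keys_pm_scale])
  qed (auto elim!: tensor_carrierE simp: tensor_add_class tensor_smult_class pm_scale_simps)
qed

lemma tens_closed [simp]: "v \<in> carrier V \<Longrightarrow> w \<in> carrier W \<Longrightarrow> tens V W v w \<in> carrier (tensor V W)"
  unfolding tens_def by (rule tensor_class_closed) simp

lemma bilin_tens: "bilin V W (tensor V W) (tens V W)"
proof (rule bilinI; rule lin_mapI)
  fix v w w' assume "v \<in> carrier V" "w \<in> carrier W" "w' \<in> carrier W"
  then show "tens V W v (w \<oplus>\<^bsub>W\<^esub> w') = tens V W v w \<oplus>\<^bsub>tensor V W\<^esub> tens V W v w'"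
    using tensor_null.add_right[of v V w W w' 1]
    by (simp add: tens_def tensor_add_class tensor_class_eq_iff diff_diff_eq)
next
  fix v v' w assume "v \<in> carrier V" "v' \<in> carrier V" "w \<in> carrier W"
  then show "tens V W (v \<oplus>\<^bsub>V\<^esub> v') w = tens V W v w \<oplus>\<^bsub>tensor V W\<^esub> tens V W v' w"
    using tensor_null.add_left[of v V v' w W 1]
    by (simp add: tens_def tensor_add_class tensor_class_eq_iff diff_diff_eq)
next
  fix c v w assume "v \<in> carrier V" "w \<in> carrier W"
  then show "tens V W v (c \<odot>\<^bsub>W\<^esub> w) = c \<odot>\<^bsub>tensor V W\<^esub> tens V W v w"
    using tensor_null.smult_right[of v V w W c 1]
    by (simp add: tens_def tensor_smult_class pm_scale_simps tensor_class_eq_iff)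
next
  fix c v w assume "v \<in> carrier V" "w \<in> carrier W"
  then show "tens V W (c \<odot>\<^bsub>V\<^esub> v) w = c \<odot>\<^bsub>tensor V W\<^esub> tens V W v w"
    using tensor_null.smult_left[of v V w W c 1]
    by (simp add: tens_def tensor_smult_class pm_scale_simps tensor_class_eq_iff)
qed simp_all

text \<open>A representative is built up key by key, and each new key contributes a multiple of one
  pure tensor.\<close>

lemma tensor_vspan_tens:
  "carrier (tensor V W) = vspan (tensor V W) {tens V W v w |v w. v \<in> carrier V \<and> w \<in> carrier W}"
    (is "_ = vspan _ ?P")
proof
  interpret T: kspace "tensor V W" ..
  have sub: "?P \<subseteq> carrier (tensor V W)" by auto
  note S = subsp_vspan[OF kspace_tensor sub]
  show "vspan (tensor V W) ?P \<subseteq> carrier (tensor V W)"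
    using S by (auto simp: subsp_def)
  show "carrier (tensor V W) \<subseteq> vspan (tensor V W) ?P"
  proof
    fix t assume "t \<in> carrier (tensor V W)"
    then obtain p where t: "t = tensor_class V W p" and p: "Poly_Mapping.keys p \<subseteq> carrier V \<times> carrier W"
      by (rule tensor_carrierE)
    have "tensor_class V W p \<in> vspan (tensor V W) ?P"
      using p
    proof (induction p rule: update_induct)
      case const
      then show ?case using subsp_zero[OF S] by (simp add: tensor_zero_class)
    next
      case (update f a b)
      note eq = update_eq_plus_single[OF update(1), of b]
      have keys: "Poly_Mapping.keys (Poly_Mapping.update a b f) = insert a (Poly_Mapping.keys f)"
        using update(1,2) by (auto simp: in_keys_iff lookup_update split: if_splits)
      obtain v w where a: "a = (v, w)" "v \<in> carrier V" "w \<in> carrier W"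
        using update(4) keys by auto
      have "tensor_class V W (Poly_Mapping.update a b f) =
          tensor_class V W f \<oplus>\<^bsub>tensor V W\<^esub> b \<odot>\<^bsub>tensor V W\<^esub> tens V W v w"
        by (simp add: tens_def tensor_smult_class tensor_add_class pm_scale_simps eq[unfolded a(1)] a(1))
      also have "\<dots> \<in> vspan (tensor V W) ?P"
        using update keys a
        by (intro subsp_add[OF S] subsp_smult[OF S]) (auto intro!: vspan_base)
      finally show ?case .
    qed
    then show "t \<in> vspan (tensor V W) ?P" by (simp add: t)
  qed
qed

text \<open>The uniqueness half of the universal property; existence is provided by
  \<open>tsum\<close>.\<close>

lemma tensor_lin_eqI:
  assumes "kspace X" "lin_map (tensor V W) X f" "lin_map (tensor V W) X g"
    "\<And>v w. v \<in> carrier V \<Longrightarrow> w \<in> carrier W \<Longrightarrow> f (tens V W v w) = g (tens V W v w)"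
    "t \<in> carrier (tensor V W)"
  shows "f t = g t"
  by (rule lin_map_eq_on_vspan[OF kspace_tensor assms(1-3)])
     (use assms(4,5) tensor_vspan_tens[of V W] in auto)

text \<open>The linear extension of \<open>f\<close> to the free vector space on pairs, before
  passing to cosets; \<open>tsum\<close> is its value at a chosen representative.\<close>

definition pm_ext where
  "pm_ext X f r = finsum X (\<lambda>z. Poly_Mapping.lookup r z \<odot>\<^bsub>X\<^esub> f (fst z) (snd z)) (Poly_Mapping.keys r)"

context
  fixes V W X and f
  assumes X: "kspace X" and f: "bilin V W X f"
begin

interpretation X: kspace X by (rule X)

text \<open>Sums over different supports become comparable on one finite index set, the additional
  entries having coefficient zero.\<close>

lemma pm_ext_superset:
  assumes "finite A" "Poly_Mapping.keys r \<subseteq> A" "A \<subseteq> carrier V \<times> carrier W"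
  shows "pm_ext X f r = finsum X (\<lambda>z. Poly_Mapping.lookup r z \<odot>\<^bsub>X\<^esub> f (fst z) (snd z)) A"
  unfolding pm_ext_def
proof (rule X.add.finprod_mono_neutral_cong_left[OF assms(1,2)])
  have *: "f (fst z) (snd z) \<in> carrier X" if "z \<in> A" for z
    using bilin_closed[OF f, of "fst z" "snd z"] subsetD[OF assms(3) that]
    by (auto simp: mem_Times_iff)
  show "Poly_Mapping.lookup r z \<odot>\<^bsub>X\<^esub> f (fst z) (snd z) = \<zero>\<^bsub>X\<^esub>" if "z \<in> A - Poly_Mapping.keys r" for z
    using * that by (simp add: in_keys_iff)
  show "(\<lambda>z. Poly_Mapping.lookup r z \<odot>\<^bsub>X\<^esub> f (fst z) (snd z)) \<in> A \<rightarrow> carrier X"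
    using * by simp
qed simp

lemma pm_ext_closed:
  "Poly_Mapping.keys r \<subseteq> carrier V \<times> carrier W \<Longrightarrow> pm_ext X f r \<in> carrier X"
  unfolding pm_ext_def using bilin_closed[OF f] by (intro X.finsum_closed) (auto simp: subset_iff)

lemma pm_ext_add:
  assumes "Poly_Mapping.keys p \<subseteq> carrier V \<times> carrier W" "Poly_Mapping.keys r \<subseteq> carrier V \<times> carrier W"
  shows "pm_ext X f (p + r) = pm_ext X f p \<oplus>\<^bsub>X\<^esub> pm_ext X f r"
proof -
  let ?A = "Poly_Mapping.keys p \<union> Poly_Mapping.keys r"
  have f': "f (fst z) (snd z) \<in> carrier X" if "z \<in> ?A" for z
    using bilin_closed[OF f, of "fst z" "snd z"] that assms by force
  have "pm_ext X f (p + r) = finsum X (\<lambda>z. Poly_Mapping.lookup p z \<odot>\<^bsub>X\<^esub> f (fst z) (snd z)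
      \<oplus>\<^bsub>X\<^esub> Poly_Mapping.lookup r z \<odot>\<^bsub>X\<^esub> f (fst z) (snd z)) ?A"
    using assms f' keys_add_sub[of p ?A r]
    by (subst pm_ext_superset[where A = ?A])
       (auto simp del: X.finsum_addf simp: lookup_add X.smult_l_distr intro!: X.finsum_cong')
  also have "\<dots> = pm_ext X f p \<oplus>\<^bsub>X\<^esub> pm_ext X f r"
    using assms f'
    by (subst (1 2) pm_ext_superset[where A = ?A]) (auto intro!: X.finsum_addf)
  finally show ?thesis .
qed

lemma pm_ext_scale:
  assumes "Poly_Mapping.keys p \<subseteq> carrier V \<times> carrier W"
  shows "pm_ext X f (pm_scale c p) = c \<odot>\<^bsub>X\<^esub> pm_ext X f p"
proof -
  have f': "f (fst z) (snd z) \<in> carrier X" if "z \<in> Poly_Mapping.keys p" for z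
    using bilin_closed[OF f, of "fst z" "snd z"] that assms by force
  show ?thesis
    using assms f'
    apply (subst pm_ext_superset[where A = "Poly_Mapping.keys p"])
       apply (auto simp: keys_pm_scale)
    apply (subst pm_ext_def)
    apply (subst X.smult_finsum)
     apply (auto simp: lookup_pm_scale X.smult_smult intro!: X.finsum_cong')
    done
qed

lemma pm_ext_single:
  assumes "v \<in> carrier V" "w \<in> carrier W"
  shows "pm_ext X f (Poly_Mapping.single (v, w) c) = c \<odot>\<^bsub>X\<^esub> f v w"
  using assms bilin_closed[OF f]
  by (subst pm_ext_superset[where A = "{(v, w)}"]) (auto simp: X.finsum_insert)

lemma pm_ext_minus:
  assumes "Poly_Mapping.keys p \<subseteq> carrier V \<times> carrier W" "Poly_Mapping.keys r \<subseteq> carrier V \<times> carrier W"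
  shows "pm_ext X f (p - r) = pm_ext X f p \<ominus>\<^bsub>X\<^esub> pm_ext X f r"
proof -
  have eq: "p - r = p + pm_scale (- 1) r"
    by (rule poly_mapping_eqI) (simp add: lookup_minus lookup_add lookup_pm_scale)
  show ?thesis unfolding eq using assms keys_pm_scale[of "-1" r]
    by (subst pm_ext_add) (auto simp: pm_ext_scale X.minus_eq_smult pm_ext_closed)
qed

text \<open>Bilinearity of \<open>f\<close> sends each generating relation to zero. This makes
  \<open>tsum\<close> independent of the representative picked by \<open>SOME\<close>.\<close>

lemma pm_ext_null:
  assumes V: "kspace V" and W: "kspace W" and "p \<in> tensor_null V W"
  shows "pm_ext X f p = \<zero>\<^bsub>X\<^esub>"
proof -
  interpret V: kspace V by fact
  interpret W: kspace W by fact
  have keys: "Poly_Mapping.keys (Poly_Mapping.single (v, w) c) \<subseteq> carrier V \<times> carrier W"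
    if "v \<in> carrier V" "w \<in> carrier W" for v w and c
    using that by simp
  have fc: "f v w \<in> carrier X" if "v \<in> carrier V" "w \<in> carrier W" for v w
    using that bilin_closed[OF f] by auto
  have cancel2: "a \<ominus>\<^bsub>X\<^esub> a = \<zero>\<^bsub>X\<^esub>" if "a \<in> carrier X" for a
    using that by (simp add: a_minus_def X.r_neg)
  have cancel: "a \<oplus>\<^bsub>X\<^esub> b \<ominus>\<^bsub>X\<^esub> a \<ominus>\<^bsub>X\<^esub> b = \<zero>\<^bsub>X\<^esub>" if "a \<in> carrier X" "b \<in> carrier X" for a b
  proof -
    have "a \<oplus>\<^bsub>X\<^esub> b \<ominus>\<^bsub>X\<^esub> a = b"
      using that X.a_lcomm[of a b "\<ominus>\<^bsub>X\<^esub> a"] by (simp add: a_minus_def X.a_assoc X.r_neg)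
    then show ?thesis using that by (simp add: cancel2)
  qed
  show ?thesis using assms(3)
  proof induction
    case zero
    then show ?case by (simp add: pm_ext_def)
  next
    case (plus p r)
    then show ?case using tensor_null_keys[OF V W] by (subst pm_ext_add) auto
  next
    case (add_left v v' w c)
    then show ?case
      by (simp add: pm_ext_minus keys keys_minus_sub pm_ext_single lin_map_add[OF bilin_left[OF f]]
          X.smult_r_distr fc cancel)
  next
    case (add_right v w w' c)
    then show ?case
      by (simp add: pm_ext_minus keys keys_minus_sub pm_ext_single lin_map_add[OF bilin_right[OF f]]
          X.smult_r_distr fc cancel)
  next
    case (smult_left v w a c)
    then show ?case
      by (simp add: pm_ext_minus keys pm_ext_single lin_map_smult[OF bilin_left[OF f]]
          X.smult_smult mult.commute fc cancel2)
  next
    case (smult_right v w a c)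
    then show ?case
      by (simp add: pm_ext_minus keys pm_ext_single lin_map_smult[OF bilin_right[OF f]]
          X.smult_smult mult.commute fc cancel2)
  qed
qed

lemma tsum_tensor_class:
  assumes "kspace V" "kspace W" "Poly_Mapping.keys p \<subseteq> carrier V \<times> carrier W"
  shows "tsum X f (tensor_class V W p) = pm_ext X f p"
proof -
  let ?r = "SOME r. r \<in> tensor_class V W p"
  have "?r \<in> tensor_class V W p" 
    using self_in_tensor_class by (rule someI)
  then have n: "?r - p \<in> tensor_null V W" by (simp add: mem_tensor_class)
  have "tsum X f (tensor_class V W p) = pm_ext X f (p + (?r - p))"
    by (simp add: tsum_def pm_ext_def Let_def)
  also have "\<dots> = pm_ext X f p"
    using n assms tensor_null_keys[OF assms(1,2) n]
    by (subst pm_ext_add) (auto simp: pm_ext_null pm_ext_closed)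
  finally show ?thesis .
qed

lemma lin_map_tsum:
  assumes "kspace V" "kspace W"
  shows "lin_map (tensor V W) X (tsum X f)"
proof (rule lin_mapI)
  fix u v assume "u \<in> carrier (tensor V W)" "v \<in> carrier (tensor V W)"
  then show "tsum X f (u \<oplus>\<^bsub>tensor V W\<^esub> v) = tsum X f u \<oplus>\<^bsub>X\<^esub> tsum X f v"
    by (elim tensor_carrierE)
       (simp add: tensor_add_class tsum_tensor_class assms pm_ext_add keys_add_sub)
next
  fix c u assume "u \<in> carrier (tensor V W)"
  then show "tsum X f (c \<odot>\<^bsub>tensor V W\<^esub> u) = c \<odot>\<^bsub>X\<^esub> tsum X f u"
    by (elim tensor_carrierE)
       (simp add: tensor_smult_class tsum_tensor_class assms pm_ext_scale
          subset_trans[OF keys_pm_scale])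
qed (auto elim!: tensor_carrierE simp: tsum_tensor_class assms pm_ext_closed)

lemma tsum_tens:
  assumes "kspace V" "kspace W" "v \<in> carrier V" "w \<in> carrier W"
  shows "tsum X f (tens V W v w) = f v w"
  using assms bilin_closed[OF f]
  by (simp add: tens_def tsum_tensor_class pm_ext_single)

end

text \<open>Both sides are linear in \<open>t\<close> and agree on pure tensors. This is the rule
  for moving a linear map inside Sweedler notation.\<close>

lemma tsum_comp:
  assumes "kspace V" "kspace W" "kspace X" "kspace Y" "bilin V W X f" "lin_map X Y g"
    "t \<in> carrier (tensor V W)"
  shows "g (tsum X f t) = tsum Y (\<lambda>v w. g (f v w)) t"
proof (rule tensor_lin_eqI[OF assms(4)])
  have b: "bilin V W Y (\<lambda>v w. g (f v w))"
    using bilin_comp[OF assms(5) lin_map_id lin_map_id assms(6)] .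
  show "lin_map (tensor V W) Y (\<lambda>t. g (tsum X f t))"
    using assms by (intro lin_map_comp[OF lin_map_tsum])
  show "lin_map (tensor V W) Y (tsum Y (\<lambda>v w. g (f v w)))"
    using assms b by (intro lin_map_tsum)
  show "g (tsum X f (tens V W v w)) = tsum Y (\<lambda>v w. g (f v w)) (tens V W v w)"
    if "v \<in> carrier V" "w \<in> carrier W" for v w
    using assms b that by (simp add: tsum_tens)
qed (use assms in auto)

lemma tsum_cong:
  assumes "kspace V" "kspace W" "kspace X" "bilin V W X f" "bilin V W X g"
    "\<And>v w. v \<in> carrier V \<Longrightarrow> w \<in> carrier W \<Longrightarrow> f v w = g v w"
    "t \<in> carrier (tensor V W)"
  shows "tsum X f t = tsum X g t"
  by (rule tensor_lin_eqI[OF assms(3) lin_map_tsum[OF assms(3,4,1,2)]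
        lin_map_tsum[OF assms(3,5,1,2)] _ assms(7)])
     (simp add: tsum_tens[OF assms(3,4,1,2)] tsum_tens[OF assms(3,5,1,2)] assms(6))

lemma tsum_plus:
  assumes "kspace V" "kspace W" "kspace X" "bilin V W X f" "bilin V W X g"
    "t \<in> carrier (tensor V W)"
  shows "tsum X (\<lambda>v w. f v w \<oplus>\<^bsub>X\<^esub> g v w) t = tsum X f t \<oplus>\<^bsub>X\<^esub> tsum X g t"
proof -
  note p = bilin_plus[OF assms(3-5)]
  show ?thesis
    by (rule tensor_lin_eqI[OF assms(3) lin_map_tsum[OF assms(3) p assms(1,2)]
          lin_map_plus[OF assms(3) lin_map_tsum[OF assms(3,4,1,2)] lin_map_tsum[OF assms(3,5,1,2)]]
          _ assms(6)])
       (simp add: tsum_tens[OF assms(3,4,1,2)] tsum_tens[OF assms(3,5,1,2)]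
          tsum_tens[OF assms(3) p assms(1,2)])
qed

lemma tsum_scale:
  assumes "kspace V" "kspace W" "kspace X" "bilin V W X f" "t \<in> carrier (tensor V W)"
  shows "tsum X (\<lambda>v w. c \<odot>\<^bsub>X\<^esub> f v w) t = c \<odot>\<^bsub>X\<^esub> tsum X f t"
proof -
  note p = bilin_scale[OF assms(3,4), of c]
  show ?thesis
    by (rule tensor_lin_eqI[OF assms(3) lin_map_tsum[OF assms(3) p assms(1,2)]
          lin_map_scale[OF assms(3) lin_map_tsum[OF assms(3,4,1,2)]] _ assms(5)])
       (simp add: tsum_tens[OF assms(3,4,1,2)] tsum_tens[OF assms(3) p assms(1,2)])
qed

lemma tsum_id:
  assumes "kspace V" "kspace W" "t \<in> carrier (tensor V W)"
  shows "tsum (tensor V W) (tens V W) t = t"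
  by (rule tensor_lin_eqI[OF kspace_tensor lin_map_tsum[OF kspace_tensor bilin_tens assms(1,2)]
        lin_map_id _ assms(3)])
     (simp add: tsum_tens[OF kspace_tensor bilin_tens assms(1,2)])

text \<open>Needed for nested Sweedler sums: the inner sum has to be linear in the outer variables
  before the outer sum can be evaluated.\<close>

lemma lin_map_tsum_param:
  assumes "kspace V" "kspace W" "kspace X"
    and "\<And>u. u \<in> carrier U \<Longrightarrow> bilin V W X (f u)"
    and "\<And>v w. v \<in> carrier V \<Longrightarrow> w \<in> carrier W \<Longrightarrow> lin_map U X (\<lambda>u. f u v w)"
    and "t \<in> carrier (tensor V W)" and "kspace U"
  shows "lin_map U X (\<lambda>u. tsum X (f u) t)"
proof -
  interpret U: kspace U by fact
  note b = assms(4)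
  show ?thesis
  proof (rule lin_mapI)
    fix u assume u: "u \<in> carrier U"
    show "tsum X (f u) t \<in> carrier X"
      using lin_map_closed[OF lin_map_tsum[OF assms(3) b[OF u] assms(1,2)] assms(6)] .
    show "tsum X (f (c \<odot>\<^bsub>U\<^esub> u)) t = c \<odot>\<^bsub>X\<^esub> tsum X (f u) t" for c
      unfolding tsum_scale[OF assms(1-3) b[OF u] assms(6), symmetric]
      by (rule tsum_cong[OF assms(1-3) b bilin_scale[OF assms(3) b] _ assms(6)])
         (use u lin_map_smult[OF assms(5)] in auto)
  next
    fix u u' assume u: "u \<in> carrier U" "u' \<in> carrier U"
    show "tsum X (f (u \<oplus>\<^bsub>U\<^esub> u')) t = tsum X (f u) t \<oplus>\<^bsub>X\<^esub> tsum X (f u') t"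
      unfolding tsum_plus[OF assms(1-3) b[OF u(1)] b[OF u(2)] assms(6), symmetric]
      by (rule tsum_cong[OF assms(1-3) b bilin_plus[OF assms(3) b b] _ assms(6)])
         (use u lin_map_add[OF assms(5)] in auto)
  qed
qed

section \<open>Algebras and words in the generators\<close>

locale kalg = kspace A + ring A for A :: "('k::field, 'a, 'm) module_scheme" (structure) +
  assumes smult_mult_left: "a \<in> carrier A \<Longrightarrow> b \<in> carrier A \<Longrightarrow> (c \<odot> a) \<otimes> b = c \<odot> (a \<otimes> b)"
    and smult_mult_right: "a \<in> carrier A \<Longrightarrow> b \<in> carrier A \<Longrightarrow> a \<otimes> (c \<odot> b) = c \<odot> (a \<otimes> b)"

lemma kalg_iff: "kalg A \<longleftrightarrow> k_algebra A"
proof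
  assume "kalg A"
  then interpret kalg A .
  have "kspace A" ..
  then show "k_algebra A"
    by (auto simp: k_algebra_def kspace_iff_module ring_axioms smult_mult_left smult_mult_right)
next
  assume *: "k_algebra A"
  then interpret kspace A by (simp add: k_algebra_def kspace_iff_module)
  interpret ring A using * by (simp add: k_algebra_def)
  show "kalg A" using * by unfold_locales (auto simp: k_algebra_def)
qed

primrec wmon :: "('k::field, 'a, 'm) module_scheme \<Rightarrow> (gen \<Rightarrow> 'a) \<Rightarrow> gen list \<Rightarrow> 'a" where
  "wmon A y [] = \<one>\<^bsub>A\<^esub>"
| "wmon A y (i # w) = y i \<otimes>\<^bsub>A\<^esub> wmon A y w"

context kalg
begin

lemma lin_map_mult_left: "a \<in> carrier A \<Longrightarrow> lin_map A A (\<lambda>b. a \<otimes> b)"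
  by (intro lin_mapI) (auto simp: r_distr smult_mult_right)

lemma lin_map_mult_right: "a \<in> carrier A \<Longrightarrow> lin_map A A (\<lambda>b. b \<otimes> a)"
  by (intro lin_mapI) (auto simp: l_distr smult_mult_left)

lemma bilin_mult: "bilin A A A (\<otimes>)"
  by (intro bilinI lin_map_mult_left lin_map_mult_right)

lemma wmon_closed: "(\<And>i. y i \<in> carrier A) \<Longrightarrow> wmon A y w \<in> carrier A"
  by (induction w) auto

end

text \<open>Phrased as spanning by words, so that identities between linear maps can be tested on
  words.\<close>

definition generated_by :: "('k::field, 'a, 'm) module_scheme \<Rightarrow> (gen \<Rightarrow> 'a) \<Rightarrow> bool" where
  "generated_by A y \<longleftrightarrow> (\<forall>i. y i \<in> carrier A) \<and> carrier A \<subseteq> vspan A (range (wmon A y))"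

lemma generated_lin_eqI:
  assumes "kalg A" "kspace X" "generated_by A y" "lin_map A X f" "lin_map A X g"
    "\<And>w. f (wmon A y w) = g (wmon A y w)" "a \<in> carrier A"
  shows "f a = g a"
proof -
  interpret kalg A by fact
  show ?thesis
    by (rule lin_map_eq_on_vspan[OF kspace_axioms assms(2,4,5), of "range (wmon A y)"])
       (use assms(3,6,7) in \<open>auto simp: generated_by_def intro!: wmon_closed\<close>)
qed

lemma generated_subsp:
  assumes "kalg A" "generated_by A y" "subsp A S" "\<one>\<^bsub>A\<^esub> \<in> S"
    "\<And>i a. a \<in> S \<Longrightarrow> y i \<otimes>\<^bsub>A\<^esub> a \<in> S"
  shows "carrier A \<subseteq> S"
proof -
  have "wmon A y w \<in> S" for w
    using assms(4,5) by (induction w) auto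
  then have "vspan A (range (wmon A y)) \<subseteq> S"
    using assms(3) by (intro vspan_minimal) auto
  then show ?thesis using assms(2) by (auto simp: generated_by_def)
qed

section \<open>Quantum shuffles\<close>

text \<open>The scalar picked up when the letter \<open>i\<close> crosses the word
  \<open>u\<close>.\<close>

definition wscal :: "(gen \<Rightarrow> gen \<Rightarrow> 'k::field) \<Rightarrow> gen \<Rightarrow> gen list \<Rightarrow> 'k" where
  "wscal b i u = prod_list (map (b i) u)"

text \<open>The crossing scalar ignores the order of the letters, and a coproduct term only
  redistributes them.\<close>

lemma wscal_mset: "mset u + mset v = mset w \<Longrightarrow> wscal b i w = wscal b i u * wscal b i v"
proof -
  assume *: "mset u + mset v = mset w"
  have "wscal b i w = prod_mset (image_mset (b i) (mset w))" for w
    by (induction w) (simp_all add: wscal_def)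
  then show ?thesis by (simp flip: *)
qed

text \<open>\<open>qshuf X b w F\<close> is the image, under the bilinear extension of \<open>F\<close>, of the braided coproduct of
  the word \<open>w\<close> for the diagonal braiding \<open>b\<close>.\<close>

primrec qshuf :: "('k::field, 'x, 'm) module_scheme \<Rightarrow> (gen \<Rightarrow> gen \<Rightarrow> 'k) \<Rightarrow> gen list \<Rightarrow>
    (gen list \<Rightarrow> gen list \<Rightarrow> 'x) \<Rightarrow> 'x" where
  "qshuf X b [] F = F [] []"
| "qshuf X b (i # w) F =
     qshuf X b w (\<lambda>u v. F (i # u) v \<oplus>\<^bsub>X\<^esub> wscal b i u \<odot>\<^bsub>X\<^esub> F u (i # v))"

text \<open>Every term of the coproduct of \<open>w\<close> distributes its letters over two words,
  so \<open>F\<close> is evaluated only at such pairs.\<close>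

lemma qshuf_cong:
  "(\<And>u v. mset u + mset v = mset w \<Longrightarrow> F u v = F' u v) \<Longrightarrow> qshuf X b w F = qshuf X b w F'"
proof (induction w arbitrary: F F')
  case (Cons i w)
  show ?case unfolding qshuf.simps
    by (rule Cons.IH) (auto simp: Cons.prems)
qed simp

context kspace
begin

lemma qshuf_plus:
  "(\<And>u v. F u v \<in> carrier V) \<Longrightarrow> (\<And>u v. F' u v \<in> carrier V) \<Longrightarrow>
   qshuf V b w (\<lambda>u v. F u v \<oplus> F' u v) = qshuf V b w F \<oplus> qshuf V b w F'"
proof (induction w arbitrary: F F')
  case (Cons i w)
  have "qshuf V b (i # w) (\<lambda>u v. F u v \<oplus> F' u v) =
      qshuf V b w (\<lambda>u v. (F (i # u) v \<oplus> wscal b i u \<odot> F u (i # v)) \<oplus>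
        (F' (i # u) v \<oplus> wscal b i u \<odot> F' u (i # v)))"
    unfolding qshuf.simps
    by (rule qshuf_cong) (simp add: Cons.prems smult_r_distr a_ac)
  also have "\<dots> = qshuf V b (i # w) F \<oplus> qshuf V b (i # w) F'"
    unfolding qshuf.simps by (rule Cons.IH) (auto simp: Cons.prems)
  finally show ?case .
qed simp

lemma qshuf_zero: "qshuf V b w (\<lambda>u v. \<zero>) = \<zero>"
  by (induction w) auto

lemma qshuf_lin:
  assumes "kspace X" "lin_map V X g" "\<And>u v. F u v \<in> carrier V"
  shows "g (qshuf V b w F) = qshuf X b w (\<lambda>u v. g (F u v))"
  using assms(3)
proof (induction w arbitrary: F)
  case (Cons i w)
  then show ?case
    by (simp add: lin_map_add[OF assms(2)] lin_map_smult[OF assms(2)])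
qed simp

text \<open>Either side distributes the letters over three words. The first letter meets the same
  three possibilities with the same scalars on both sides, and induction on \<open>w\<close> treats
  the remaining letters.\<close>

lemma qshuf_coassoc:
  assumes "\<And>u v w. F u v w \<in> carrier V"
  shows "qshuf V b w (\<lambda>u v. qshuf V b u (\<lambda>u1 u2. F u1 u2 v)) =
    qshuf V b w (\<lambda>u v. qshuf V b v (\<lambda>v1 v2. F u v1 v2))"
  using assms
proof (induction w arbitrary: F)
  case (Cons i w)
  \<comment> \<open>The three positions of the letter \<open>i\<close>; to reach the third one it
    crosses both words in front.\<close>
  let ?G = "\<lambda>u1 u2 v. (F (i # u1) u2 v \<oplus> wscal b i u1 \<odot> F u1 (i # u2) v) \<oplus>
    (wscal b i u1 * wscal b i u2) \<odot> F u1 u2 (i # v)"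
  have scale: "c \<odot> qshuf V b u F' = qshuf V b u (\<lambda>u v. c \<odot> F' u v)"
    if "\<And>u v. F' u v \<in> carrier V" for c F' u
    using qshuf_lin[OF kspace_axioms lin_map_scale[OF kspace_axioms lin_map_id] that] .
  have "qshuf V b (i # w) (\<lambda>u v. qshuf V b u (\<lambda>u1 u2. F u1 u2 v)) =
      qshuf V b w (\<lambda>u v. qshuf V b u (\<lambda>u1 u2. ?G u1 u2 v))"
  proof (simp, rule qshuf_cong)
    fix u v
    \<comment> \<open>Crossing \<open>u\<close> amounts to crossing the two parts into which
      \<open>u\<close> is split.\<close>
    have "wscal b i u \<odot> qshuf V b u (\<lambda>u1 u2. F u1 u2 (i # v)) =
        qshuf V b u (\<lambda>u1 u2. (wscal b i u1 * wscal b i u2) \<odot> F u1 u2 (i # v))"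
      by (simp add: scale Cons.prems, rule qshuf_cong) (simp add: wscal_mset)
    then show "qshuf V b u (\<lambda>ua va. F (i # ua) va v \<oplus> wscal b i ua \<odot> F ua (i # va) v) \<oplus>
        wscal b i u \<odot> qshuf V b u (\<lambda>u1 u2. F u1 u2 (i # v)) = qshuf V b u (\<lambda>u1 u2. ?G u1 u2 v)"
      by (simp add: qshuf_plus Cons.prems)
  qed
  also have "\<dots> = qshuf V b w (\<lambda>u v. qshuf V b v (\<lambda>v1 v2. ?G u v1 v2))"
    by (rule Cons.IH) (simp add: Cons.prems)
  also have "\<dots> = qshuf V b (i # w) (\<lambda>u v. qshuf V b v (\<lambda>v1 v2. F u v1 v2))"
    by (simp, rule qshuf_cong)
       (simp add: scale qshuf_plus[symmetric] Cons.prems smult_r_distr smult_smult a_ac)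
  finally show ?case .
qed simp

end

section \<open>Comodule algebras with a diagonal coaction on generators\<close>

text \<open>\<open>G i\<close> is the action of the group-like element that accompanies the \<open>i\<close>-th generator.
  Only multiplication by generators from the left is recorded, so that neither associativity of the
  braided product nor the Hopf algebra is needed any more.\<close>

locale diag_comod = A: kalg A + B: kalg B
  for A :: "('k::field, 'a, 'm) module_scheme" and B :: "('k, 'b, 'n) module_scheme" +
  fixes y :: "gen \<Rightarrow> 'a" and x :: "gen \<Rightarrow> 'b" and b :: "gen \<Rightarrow> gen \<Rightarrow> 'k"
    and G :: "gen \<Rightarrow> 'a \<Rightarrow> 'a" and \<rho> :: "'a \<Rightarrow> ('a \<times> 'b \<Rightarrow>\<^sub>0 'k) set"
  assumes genA: "generated_by A y" and genB: "generated_by B x"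
    and G_lin: "lin_map A A (G i)"
    and G_one: "G i \<one>\<^bsub>A\<^esub> = \<one>\<^bsub>A\<^esub>"
    and G_gen: "a \<in> carrier A \<Longrightarrow> G i (y j \<otimes>\<^bsub>A\<^esub> a) = b i j \<odot>\<^bsub>A\<^esub> (y j \<otimes>\<^bsub>A\<^esub> G i a)"
    and rho_lin: "lin_map A (tensor A B) \<rho>"
    and rho_one: "\<rho> \<one>\<^bsub>A\<^esub> = tens A B \<one>\<^bsub>A\<^esub> \<one>\<^bsub>B\<^esub>"
    and rho_gen: "e \<in> carrier A \<Longrightarrow> \<rho> (y i \<otimes>\<^bsub>A\<^esub> e) =
      tsum (tensor A B) (\<lambda>a c. tens A B (y i \<otimes>\<^bsub>A\<^esub> a) c \<oplus>\<^bsub>tensor A B\<^esub> tens A B (G i a) (x i \<otimes>\<^bsub>B\<^esub> c)) (\<rho> e)"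
begin

lemma y_closed [simp]: "y i \<in> carrier A"
  using genA by (simp add: generated_by_def)

lemma x_closed [simp]: "x i \<in> carrier B"
  using genB by (simp add: generated_by_def)

lemma wmon_y_closed [simp]: "wmon A y w \<in> carrier A"
  by (simp add: A.wmon_closed)

lemma wmon_x_closed [simp]: "wmon B x w \<in> carrier B"
  by (simp add: B.wmon_closed)

lemma G_wmon: "G i (wmon A y w) = wscal b i w \<odot>\<^bsub>A\<^esub> wmon A y w"
  by (induction w)
     (simp_all add: G_one G_gen wscal_def A.smult_mult_right A.smult_smult mult.commute)

lemma A_kspace: "kspace A" ..

lemma B_kspace: "kspace B" ..

lemma bilin_step:
  assumes "kspace X" "bilin A B X f"
  shows "bilin A B X (\<lambda>a c. f (y i \<otimes>\<^bsub>A\<^esub> a) c \<oplus>\<^bsub>X\<^esub> f (G i a) (x i \<otimes>\<^bsub>B\<^esub> c))"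
  by (intro bilin_plus[OF assms(1)] bilin_comp[OF assms(2) _ _ lin_map_id] A.lin_map_mult_left
      B.lin_map_mult_left G_lin lin_map_id y_closed x_closed)

lemma tsum_rho_gen:
  assumes X: "kspace X" and f: "bilin A B X f" and e: "e \<in> carrier A"
  shows "tsum X f (\<rho> (y i \<otimes>\<^bsub>A\<^esub> e)) =
    tsum X (\<lambda>a c. f (y i \<otimes>\<^bsub>A\<^esub> a) c \<oplus>\<^bsub>X\<^esub> f (G i a) (x i \<otimes>\<^bsub>B\<^esub> c)) (\<rho> e)"
proof -
  have re: "\<rho> e \<in> carrier (tensor A B)" using lin_map_closed[OF rho_lin e] .
  note L = lin_map_tsum[OF X f A_kspace B_kspace]
  note bs = bilin_step[OF kspace_tensor bilin_tens, of i]
  show ?thesis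
    unfolding rho_gen[OF e] tsum_comp[OF A_kspace B_kspace kspace_tensor X bs L re]
  proof (rule tsum_cong[OF A_kspace B_kspace X _ bilin_step[OF X f] _ re])
    show "bilin A B X (\<lambda>v w. tsum X f (tens A B (y i \<otimes>\<^bsub>A\<^esub> v) w \<oplus>\<^bsub>tensor A B\<^esub> tens A B (G i v) (x i \<otimes>\<^bsub>B\<^esub> w)))"
      using bilin_comp[OF bs lin_map_id lin_map_id L] .
    fix v w assume vw: "v \<in> carrier A" "w \<in> carrier B"
    then show "tsum X f (tens A B (y i \<otimes>\<^bsub>A\<^esub> v) w \<oplus>\<^bsub>tensor A B\<^esub> tens A B (G i v) (x i \<otimes>\<^bsub>B\<^esub> w)) =
        f (y i \<otimes>\<^bsub>A\<^esub> v) w \<oplus>\<^bsub>X\<^esub> f (G i v) (x i \<otimes>\<^bsub>B\<^esub> w)"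
      using lin_map_closed[OF G_lin]
      by (simp add: lin_map_add[OF L] tsum_tens[OF X f A_kspace B_kspace])
  qed
qed

text \<open>By \<open>rho_gen\<close>, splitting off the first letter replaces \<open>f\<close> by a
  modified bilinear map, in the same way as the recursion of \<open>qshuf\<close>. Hence the
  induction is over all \<open>f\<close>.\<close>

lemma tsum_rho_wmon:
  assumes X: "kspace X" and f: "bilin A B X f"
  shows "tsum X f (\<rho> (wmon A y w)) = qshuf X b w (\<lambda>u v. f (wmon A y u) (wmon B x v))"
  using f
proof (induction w arbitrary: f)
  case Nil
  then show ?case by (simp add: rho_one tsum_tens[OF X _ A_kspace B_kspace])
next
  case (Cons i w)
  have "tsum X f (\<rho> (wmon A y (i # w))) =
      tsum X (\<lambda>a c. f (y i \<otimes>\<^bsub>A\<^esub> a) c \<oplus>\<^bsub>X\<^esub> f (G i a) (x i \<otimes>\<^bsub>B\<^esub> c)) (\<rho> (wmon A y w))"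
    by (simp add: tsum_rho_gen[OF X Cons.prems])
  also have "\<dots> = qshuf X b (i # w) (\<lambda>u v. f (wmon A y u) (wmon B x v))"
    unfolding Cons.IH[OF bilin_step[OF X Cons.prems]]
    by (simp add: G_wmon lin_map_smult[OF bilin_left[OF Cons.prems]])
  finally show ?case .
qed

lemma rho_wmon: "\<rho> (wmon A y w) = qshuf (tensor A B) b w (\<lambda>u v. tens A B (wmon A y u) (wmon B x v))"
  using tsum_rho_wmon[OF kspace_tensor bilin_tens, of w]
    tsum_id[OF A_kspace B_kspace lin_map_closed[OF rho_lin]] by simp

end

section \<open>Gaussian binomial coefficients\<close>

text \<open>The q-Pascal rule for polynomials. At a root of unity the q-factorials themselves may
  vanish, so the quotient in \<open>gauss_binomial\<close> has to be identified before it is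
  evaluated.\<close>

fun gauss_poly :: "nat \<Rightarrow> nat \<Rightarrow> 'k::field poly" where
  "gauss_poly n 0 = 1"
| "gauss_poly 0 (Suc k) = 0"
| "gauss_poly (Suc n) (Suc k) = gauss_poly n (Suc k) + monom 1 (n - k) * gauss_poly n k"

lemma gauss_poly_0: "n < k \<Longrightarrow> gauss_poly n k = 0"
  by (induction n k rule: gauss_poly.induct) auto

abbreviation q_int_poly :: "nat \<Rightarrow> 'k::field poly" where
  "q_int_poly n \<equiv> (\<Sum>j<n. monom 1 j)"

lemma q_int_poly_add: "q_int_poly (m + n) = q_int_poly m + monom 1 m * q_int_poly n"
  by (induction n) (auto simp: algebra_simps mult_monom)

lemma q_fact_poly_Suc: "q_fact_poly (Suc n) = q_fact_poly n * q_int_poly (Suc n)"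
  by (simp add: q_fact_poly_def)

lemma q_fact_poly_eq_gauss:
  "k \<le> n \<Longrightarrow> q_fact_poly n = gauss_poly n k * (q_fact_poly k * q_fact_poly (n - k))"
proof (induction n k rule: gauss_poly.induct)
  case (3 n k)
  let ?F = "q_fact_poly :: nat \<Rightarrow> 'a poly"
  have IH2: "?F n = gauss_poly n k * (?F k * ?F (n - k))" using 3 by simp
  \<comment> \<open>The decomposition [n+1] = [n-k] + q^(n-k) [k+1] of q-integers yields the two
    terms of the q-Pascal rule.\<close>
  have split: "q_int_poly (Suc n) = (q_int_poly (n - k) + monom 1 (n - k) * q_int_poly (Suc k) :: 'a poly)"
    using q_int_poly_add[of "n - k" "Suc k"] 3(3) by simp
  have A: "?F n * q_int_poly (n - k) = gauss_poly n (Suc k) * (?F (Suc k) * ?F (n - k))"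
  proof (cases "k = n")
    case True
    \<comment> \<open>Both sides vanish: the q-integer of 0 is an empty sum, and
      \<open>gauss_poly n (Suc n)\<close> is zero.\<close>
    then show ?thesis by (simp add: gauss_poly_0)
  next
    case False
    then have "?F n = gauss_poly n (Suc k) * (?F (Suc k) * ?F (n - Suc k))" using 3 by simp
    moreover have "?F (n - k) = ?F (n - Suc k) * q_int_poly (n - k)"
      using q_fact_poly_Suc[of "n - Suc k"] False 3(3) by (simp add: Suc_diff_Suc)
    ultimately show ?thesis by (simp only: mult_ac)
  qed
  have "?F (Suc n) = ?F n * q_int_poly (n - k) + monom 1 (n - k) * (?F n * q_int_poly (Suc k))"
    unfolding q_fact_poly_Suc split by (simp only: algebra_simps)
  also have "?F n * q_int_poly (Suc k) = gauss_poly n k * (?F (Suc k) * ?F (n - k))"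
    unfolding q_fact_poly_Suc[of k] IH2 by (simp only: mult_ac)
  finally show ?case unfolding A by (simp add: algebra_simps)
qed (auto simp: q_fact_poly_def)

text \<open>Each factor has constant coefficient 1. Consequently the division in
  \<open>gauss_binomial\<close> is a genuine cancellation.\<close>

lemma q_fact_poly_nonzero: "q_fact_poly n \<noteq> (0 :: 'k::field poly)"
proof -
  have "q_int_poly i \<noteq> (0 :: 'k poly)" if "i \<ge> 1" for i
  proof
    assume "q_int_poly i = (0 :: 'k poly)"
    then have "coeff (q_int_poly i :: 'k poly) 0 = 0" by simp
    moreover have "(\<Sum>j<i. coeff (monom 1 j) 0) = (\<Sum>j<i. if j = 0 then 1 else 0 :: 'k)"
      by (rule sum.cong) auto
    ultimately show False using that by (simp add: coeff_sum)
  qed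
  then show ?thesis by (simp add: q_fact_poly_def)
qed

lemma gauss_binomial_eq: "gauss_binomial q n k = poly (gauss_poly n k) q"
proof (cases "k \<le> n")
  case True
  then show ?thesis
    using q_fact_poly_eq_gauss[OF True, where 'a = 'a]
      q_fact_poly_nonzero[of k, where 'k = 'a] q_fact_poly_nonzero[of "n - k", where 'k = 'a]
    by (simp add: gauss_binomial_def)
qed (simp add: gauss_binomial_def gauss_poly_0)

lemma gauss_binomial_0 [simp]: "gauss_binomial q n 0 = 1"
  by (simp add: gauss_binomial_eq)

lemma gauss_binomial_eq_0: "n < k \<Longrightarrow> gauss_binomial q n k = 0"
  by (simp add: gauss_binomial_def)

lemma gauss_binomial_Suc_Suc:
  "gauss_binomial q (Suc n) (Suc k) = gauss_binomial q n (Suc k) + q ^ (n - k) * gauss_binomial q n k"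
  by (simp add: gauss_binomial_eq poly_monom)

text \<open>The noncommutative \<open>q\<close>-binomial theorem, phrased for the values of a linear map on the monomials
  that arise when \<open>(a + b)\<^sup>n\<close> with \<open>b a = q a b\<close> is expanded from the right.\<close>

lemma (in kspace) gauss_recursion:
  assumes closed: "\<And>n r j. U n r j \<in> carrier V"
    and rec: "\<And>n r j. n < M \<Longrightarrow> U (Suc n) r j = U n (Suc r) j \<oplus> q ^ r \<odot> U n r (Suc j)"
    and "n \<le> M"
  shows "U n r j =
    (\<Oplus>m\<in>{..n}. (gauss_binomial q n m * q ^ (r * (n - m))) \<odot> U 0 (r + m) (j + (n - m)))"
  using assms(3)
proof (induction n arbitrary: r j)
  case 0
  then show ?case using closed by simp
next
  case (Suc n)
  let ?t = "\<lambda>m. U 0 (r + m) (j + (Suc n - m))"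
  let ?a = "\<lambda>m. gauss_binomial q n m * q ^ (Suc r * (n - m))"
  let ?b = "\<lambda>m. gauss_binomial q n m * q ^ (r * (Suc n - m))"
  \<comment> \<open>There are two ways to arrive at index \<open>Suc m\<close>; the q-Pascal rule
    merges their coefficients.\<close>
  have coef: "?a m + ?b (Suc m) = gauss_binomial q (Suc n) (Suc m) * q ^ (r * (Suc n - Suc m))" for m
    unfolding gauss_binomial_Suc_Suc mult_Suc power_add diff_Suc_Suc
    by (simp only: ring_distribs ac_simps)
  have "U n (Suc r) j = (\<Oplus>m\<in>{..n}. ?a m \<odot> ?t (Suc m))"
    using Suc closed by (auto intro!: finsum_cong')
  moreover have "q ^ r \<odot> U n r (Suc j) = (\<Oplus>m\<in>{..Suc n}. ?b m \<odot> ?t m)"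
  proof -
    have "q ^ r \<odot> U n r (Suc j) = (\<Oplus>m\<in>{..n}. ?b m \<odot> ?t m)"
      using Suc closed
      by (auto simp: smult_finsum smult_smult Suc_diff_le power_add mult_ac intro!: finsum_cong')
    \<comment> \<open>The index \<open>Suc n\<close> may be added because its binomial coefficient
      is zero.\<close>
    then show ?thesis using closed by (simp add: gauss_binomial_eq_0)
  qed
  moreover have "(\<Oplus>m\<in>{..Suc n}. ?b m \<odot> ?t m) = (\<Oplus>m\<in>{..n}. ?b (Suc m) \<odot> ?t (Suc m)) \<oplus> ?b 0 \<odot> ?t 0"
    using closed by (intro finsum_Suc2) auto
  ultimately have "U (Suc n) r j =
      (\<Oplus>m\<in>{..n}. ?a m \<odot> ?t (Suc m) \<oplus> ?b (Suc m) \<odot> ?t (Suc m)) \<oplus> ?b 0 \<odot> ?t 0"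
    using Suc closed by (simp add: rec finsum_addf a_assoc finsum_closed)
  also have "(\<Oplus>m\<in>{..n}. ?a m \<odot> ?t (Suc m) \<oplus> ?b (Suc m) \<odot> ?t (Suc m)) =
      (\<Oplus>m\<in>{..n}. (gauss_binomial q (Suc n) (Suc m) * q ^ (r * (Suc n - Suc m))) \<odot> ?t (Suc m))"
    unfolding coef[symmetric] using closed
    by (intro finsum_cong') (auto simp: smult_l_distr)
  also have "\<dots> \<oplus> ?b 0 \<odot> ?t 0 =
      (\<Oplus>m\<in>{..Suc n}. (gauss_binomial q (Suc n) m * q ^ (r * (Suc n - m))) \<odot> ?t m)"
    using closed by (subst finsum_Suc2) auto
  finally show ?case .
qed

section \<open>PBW monomials\<close>

text \<open>One set of relations for both algebras: the cleft object, and the Nichols algebra as the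
  case where all three parameters are zero.\<close>

locale pbw_alg = kalg A for A :: "('k::field, 'a, 'm) module_scheme" (structure) +
  fixes y :: "gen \<Rightarrow> 'a" and N :: nat and q q12 l1 l2 l12 :: 'k
  assumes N_pos: "N > 0"
    and gen: "generated_by A y"
    and rel1: "y G1 [^] N = l1 \<odot> \<one>"
    and rel2: "y G2 [^] N = l2 \<odot> \<one>"
    and rel12: "(y G1 \<otimes> y G2 \<ominus> q12 \<odot> (y G2 \<otimes> y G1)) [^] N = l12 \<odot> \<one>"
    and rel112: "y G1 \<otimes> (y G1 \<otimes> y G2 \<ominus> q12 \<odot> (y G2 \<otimes> y G1)) =
      (q * q12) \<odot> ((y G1 \<otimes> y G2 \<ominus> q12 \<odot> (y G2 \<otimes> y G1)) \<otimes> y G1)"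
    and rel122: "(y G1 \<otimes> y G2 \<ominus> q12 \<odot> (y G2 \<otimes> y G1)) \<otimes> y G2 =
      (q * q12) \<odot> (y G2 \<otimes> (y G1 \<otimes> y G2 \<ominus> q12 \<odot> (y G2 \<otimes> y G1)))"
begin

definition y12 where "y12 = y G1 \<otimes> y G2 \<ominus> q12 \<odot> (y G2 \<otimes> y G1)"

abbreviation Y where "Y \<equiv> pbw A q12 y"

lemma gen_closed [simp]: "y i \<in> carrier A"
  using gen by (simp add: generated_by_def)

lemma y12_closed [simp]: "y12 \<in> carrier A"
  by (simp add: y12_def)

lemma Y_eq: "Y a b c = y G2 [^] a \<otimes> (y12 [^] b \<otimes> y G1 [^] c)"
  by (simp add: pbw_def y12_def[symmetric] m_assoc)

lemma Y_closed [simp]: "Y a b c \<in> carrier A"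
  by (simp add: Y_eq)

lemma Y_000: "Y 0 0 0 = \<one>"
  by (simp add: Y_eq)

lemma pow_Suc_left: "a \<in> carrier A \<Longrightarrow> a [^] Suc n = a \<otimes> a [^] n"
  by (rule nat_pow_Suc2)

lemma y2_Y: "y G2 \<otimes> Y a b c = Y (Suc a) b c"
  unfolding Y_eq pow_Suc_left[OF gen_closed] by (simp add: m_assoc)

lemma pow_y2_Y: "y G2 [^] n \<otimes> Y a b c = Y (n + a) b c"
  by (simp add: Y_eq m_assoc[symmetric] nat_pow_mult)

lemma y12_Y0: "y12 \<otimes> Y 0 b c = Y 0 (Suc b) c"
  unfolding Y_eq pow_Suc_left[OF y12_closed] by (simp add: m_assoc)

lemma y1_Y00: "y G1 \<otimes> Y 0 0 c = Y 0 0 (Suc c)"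
  unfolding Y_eq pow_Suc_left[OF gen_closed] by simp

lemma y1_y12: "e \<in> carrier A \<Longrightarrow> y G1 \<otimes> (y12 \<otimes> e) = (q * q12) \<odot> (y12 \<otimes> (y G1 \<otimes> e))"
  using rel112 by (simp add: y12_def[symmetric] m_assoc[symmetric] smult_mult_left)

lemma y12_y2: "e \<in> carrier A \<Longrightarrow> y12 \<otimes> (y G2 \<otimes> e) = (q * q12) \<odot> (y G2 \<otimes> (y12 \<otimes> e))"
  using rel122 by (simp add: y12_def[symmetric] m_assoc[symmetric] smult_mult_left)

lemma y12_mult: "e \<in> carrier A \<Longrightarrow> y12 \<otimes> e = y G1 \<otimes> (y G2 \<otimes> e) \<ominus> q12 \<odot> (y G2 \<otimes> (y G1 \<otimes> e))"
  by (simp add: y12_def minus_eq_smult l_distr smult_mult_left m_assoc)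

lemma y1_y2: "e \<in> carrier A \<Longrightarrow> y G1 \<otimes> (y G2 \<otimes> e) = y12 \<otimes> e \<oplus> q12 \<odot> (y G2 \<otimes> (y G1 \<otimes> e))"
  by (simp add: y12_mult a_minus_def a_assoc l_neg)

lemma y12_Y: "y12 \<otimes> Y a b c = (q * q12) ^ a \<odot> Y a (Suc b) c"
proof (induction a)
  case 0
  then show ?case by (simp add: y12_Y0)
next
  case (Suc a)
  have "y12 \<otimes> Y (Suc a) b c = (q * q12) \<odot> (y G2 \<otimes> (y12 \<otimes> Y a b c))"
    unfolding y2_Y[symmetric] by (simp add: y12_y2)
  then show ?case
    unfolding Suc.IH by (simp add: smult_mult_right y2_Y smult_smult)
qed

lemma y1_Y0: "y G1 \<otimes> Y 0 b c = (q * q12) ^ b \<odot> Y 0 b (Suc c)"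
proof (induction b)
  case 0
  then show ?case by (simp add: y1_Y00)
next
  case (Suc b)
  have "y G1 \<otimes> Y 0 (Suc b) c = (q * q12) \<odot> (y12 \<otimes> (y G1 \<otimes> Y 0 b c))"
    unfolding y12_Y0[symmetric] by (simp add: y1_y12)
  then show ?case
    unfolding Suc.IH by (simp add: smult_mult_right y12_Y0 smult_smult)
qed

lemma Y_wrap2: "Y (N + a) b c = l2 \<odot> Y a b c"
  by (simp add: Y_eq nat_pow_mult[symmetric] rel2 m_assoc smult_mult_left)

lemma Y_wrap12: "Y a (N + b) c = l12 \<odot> Y a b c"
  by (simp add: Y_eq nat_pow_mult[symmetric] rel12[folded y12_def] m_assoc smult_mult_left
      smult_mult_right)

lemma Y_wrap1: "Y a b (N + c) = l1 \<odot> Y a b c"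
  by (simp add: Y_eq nat_pow_mult[symmetric] rel1 smult_mult_left smult_mult_right)

abbreviation PBW where "PBW \<equiv> {Y a b c |a b c. a < N \<and> b < N \<and> c < N}"

lemma subsp_PBW: "subsp A (vspan A PBW)"
  by (rule subsp_vspan) (auto simp: kspace_axioms)

text \<open>An exponent that reaches \<open>N\<close> is reduced by the corresponding relation,
  which lowers the sum of the exponents by \<open>N\<close>.\<close>

lemma Y_in_span: "Y a b c \<in> vspan A PBW"
proof (induction "a + b + c" arbitrary: a b c rule: less_induct)
  case less
  consider "a \<ge> N" | "b \<ge> N" | "c \<ge> N" | "a < N" "b < N" "c < N" by linarith
  then show ?case
  proof cases
    case 1
    then obtain a' where "a = N + a'" using le_Suc_ex by blast
    then show ?thesis using less[of a' b c] N_pos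
      by (simp add: Y_wrap2 subsp_smult[OF subsp_PBW])
  next
    case 2
    then obtain b' where "b = N + b'" using le_Suc_ex by blast
    then show ?thesis using less[of a b' c] N_pos
      by (simp add: Y_wrap12 subsp_smult[OF subsp_PBW])
  next
    case 3
    then obtain c' where "c = N + c'" using le_Suc_ex by blast
    then show ?thesis using less[of a b c'] N_pos
      by (simp add: Y_wrap1 subsp_smult[OF subsp_PBW])
  next
    case 4
    then show ?thesis by (intro vspan_base) blast
  qed
qed

lemma PBW_image:
  assumes "z \<in> carrier A" "\<And>a b c. z \<otimes> Y a b c \<in> vspan A PBW" "e \<in> vspan A PBW"
  shows "z \<otimes> e \<in> vspan A PBW"
  by (rule vspan_image[OF kspace_axioms kspace_axioms lin_map_mult_left[OF assms(1)] _ _ _ assms(3)])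
     (use assms(2) in auto)

text \<open>The span contains 1 and is stable under left multiplication by the generators. For
  \<open>y G1\<close> the only interesting case is passing a \<open>y G2\<close>, where y1 y2 = y12
  + q12 y2 y1 allows an induction on the exponent of \<open>y G2\<close>.\<close>

lemma PBW_spans: "carrier A \<subseteq> vspan A PBW"
proof (rule generated_subsp[OF _ gen subsp_PBW])
  show "kalg A" ..
  show "\<one> \<in> vspan A PBW" using Y_in_span[of 0 0 0] by (simp add: Y_000)
  have y2: "y G2 \<otimes> e \<in> vspan A PBW" if "e \<in> vspan A PBW" for e
    using that by (rule PBW_image[rotated 2]) (simp_all add: y2_Y Y_in_span)
  have "y G1 \<otimes> Y a b c \<in> vspan A PBW" for a b c
  proof (induction a)
    case 0
    then show ?case by (simp add: y1_Y0 subsp_smult[OF subsp_PBW] Y_in_span)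
  next
    case (Suc a)
    then show ?case unfolding y2_Y[symmetric]
      by (simp add: y1_y2 y12_Y subsp_smult[OF subsp_PBW] subsp_add[OF subsp_PBW] Y_in_span y2)
  qed
  then have y1: "y G1 \<otimes> e \<in> vspan A PBW" if "e \<in> vspan A PBW" for e
    by (rule PBW_image[OF gen_closed _ that])
  show "y i \<otimes> e \<in> vspan A PBW" if "e \<in> vspan A PBW" for i e
    using that y1 y2 by (cases i) auto
qed

lemma PBW_lin_eqI:
  assumes "kspace X" "lin_map A X f" "lin_map A X g"
    "\<And>a b c. a < N \<Longrightarrow> b < N \<Longrightarrow> c < N \<Longrightarrow> f (Y a b c) = g (Y a b c)" "e \<in> carrier A"
  shows "f e = g e"
  by (rule lin_map_eq_on_vspan[OF kspace_axioms assms(1-3), of PBW])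
     (use assms(4,5) PBW_spans in auto)

text \<open>The filtration by word length. It supplies the bound after which the Neumann series for
  the convolution inverse stops.\<close>

definition word_filt where "word_filt n = vspan A (wmon A y ` {w. length w \<le> n})"

lemma wmon_closed' [simp]: "wmon A y w \<in> carrier A"
  by (simp add: wmon_closed)

lemma subsp_word_filt: "subsp A (word_filt n)"
  unfolding word_filt_def by (rule subsp_vspan) (auto simp: kspace_axioms)

lemma word_filt_mono: "m \<le> n \<Longrightarrow> word_filt m \<subseteq> word_filt n"
  unfolding word_filt_def
  by (intro vspan_minimal subsp_word_filt[unfolded word_filt_def]) (auto intro!: vspan_base)

lemma word_filt_gen: "e \<in> word_filt n \<Longrightarrow> y i \<otimes> e \<in> word_filt (Suc n)"
  unfolding word_filt_def
  by (rule vspan_image[OF kspace_axioms kspace_axioms lin_map_mult_left[OF gen_closed]])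
     (auto intro!: vspan_base image_eqI[where x = "i # _"])

lemma word_filt_y12: "e \<in> word_filt n \<Longrightarrow> y12 \<otimes> e \<in> word_filt (n + 2)"
  using subsp_carrier[OF subsp_word_filt, of e n]
  by (auto simp: y12_mult
      intro!: subsp_diff[OF kspace_axioms subsp_word_filt] subsp_smult[OF subsp_word_filt] word_filt_gen)

lemma Y_word_filt: "Y a b c \<in> word_filt (a + 2 * b + c)"
proof -
  have 1: "Y 0 0 c \<in> word_filt c"
  proof (induction c)
    case 0
    have "wmon A y [] \<in> word_filt 0" unfolding word_filt_def by (intro vspan_base) blast
    then show ?case by (simp add: Y_000)
  next
    case (Suc c)
    then show ?case unfolding y1_Y00[symmetric] by (rule word_filt_gen)
  qed
  have 2: "Y 0 b c \<in> word_filt (2 * b + c)"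
  proof (induction b)
    case (Suc b)
    then show ?case unfolding y12_Y0[symmetric] using word_filt_y12[OF Suc] by simp
  qed (simp add: 1)
  show ?thesis
  proof (induction a)
    case (Suc a)
    then show ?case unfolding y2_Y[symmetric] using word_filt_gen[OF Suc] by simp
  qed (simp add: 2)
qed

text \<open>All exponents of a basis monomial are below \<open>N\<close> and y12 has length 2, so
  the length stays below 4N.\<close>

lemma carrier_word_filt: "carrier A \<subseteq> word_filt (4 * N)"
proof -
  have "Y a b c \<in> word_filt (4 * N)" if "a < N" "b < N" "c < N" for a b c
    using Y_word_filt[of a b c] word_filt_mono[of "a + 2 * b + c" "4 * N"] that by auto
  then have "vspan A PBW \<subseteq> word_filt (4 * N)"
    by (intro vspan_minimal subsp_word_filt) auto
  then show ?thesis using PBW_spans by blast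
qed

end

section \<open>The cleft object and the inverse of the section\<close>

text \<open>\<open>A\<close> is the cleft object and \<open>B\<close> the Nichols algebra; \<open>bm\<close> is the braiding matrix.\<close>

locale cleft_comod = diag_comod A B y x bm G \<rho> +
    A: pbw_alg A y N q q12 l1 l2 l12 + B: pbw_alg B x N q q12 0 0 0
  for A :: "('k::field, 'a, 'm) module_scheme" and B :: "('k, 'b, 'n) module_scheme"
    and y :: "gen \<Rightarrow> 'a" and x :: "gen \<Rightarrow> 'b" and bm :: "gen \<Rightarrow> gen \<Rightarrow> 'k"
    and G :: "gen \<Rightarrow> 'a \<Rightarrow> 'a" and \<rho> :: "'a \<Rightarrow> ('a \<times> 'b \<Rightarrow>\<^sub>0 'k) set"
    and N :: nat and q q12 l1 l2 l12 :: 'k +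
  fixes q21 :: 'k and \<epsilon>0 :: "'a \<Rightarrow> 'k"
  assumes q_nz: "q \<noteq> 0" and q12q21: "q12 * q21 = inverse q"
    and bm: "bm G1 G1 = q" "bm G1 G2 = q12" "bm G2 G1 = q21" "bm G2 G2 = q"
    and eps0_lin: "lin_map A ground \<epsilon>0"
    and eps0_Y: "a < N \<Longrightarrow> b < N \<Longrightarrow> c < N \<Longrightarrow>
      \<epsilon>0 (pbw A q12 y a b c) = (if a = 0 \<and> b = 0 \<and> c = 0 then 1 else 0)"
begin

abbreviation T where "T \<equiv> tensor A B"
abbreviation X where "X \<equiv> B.Y"
abbreviation Y where "Y \<equiv> A.Y"

interpretation T: kspace T ..

text \<open>This is \<epsilon>0 \<otimes> id, so that \<open>retr\<close> below is the map \<Phi> of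
  the overview.\<close>

definition contract where "contract = tsum B (\<lambda>a c. \<epsilon>0 a \<odot>\<^bsub>B\<^esub> c)"

definition retr where "retr e = contract (\<rho> e)"

lemma bilin_contract: "bilin A B B (\<lambda>a c. \<epsilon>0 a \<odot>\<^bsub>B\<^esub> c)"
  by (rule bilin_smult_fun[OF B_kspace eps0_lin lin_map_id])

lemma contract_lin: "lin_map T B contract"
  unfolding contract_def by (rule lin_map_tsum[OF B_kspace bilin_contract A_kspace B_kspace])

lemma contract_tens: "a \<in> carrier A \<Longrightarrow> c \<in> carrier B \<Longrightarrow> contract (tens A B a c) = \<epsilon>0 a \<odot>\<^bsub>B\<^esub> c"
  unfolding contract_def by (rule tsum_tens[OF B_kspace bilin_contract A_kspace B_kspace])

lemma retr_lin: "lin_map A B retr"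
  unfolding retr_def by (rule lin_map_comp[OF rho_lin contract_lin])

text \<open>Left multiplication by \<open>\<rho> (y i)\<close> in the braided product, as an
  operator on the tensor product. Composing such operators takes the place of computing in that
  product.\<close>

definition Lop where
  "Lop i = tsum T (\<lambda>a c. tens A B (y i \<otimes>\<^bsub>A\<^esub> a) c \<oplus>\<^bsub>T\<^esub> tens A B (G i a) (x i \<otimes>\<^bsub>B\<^esub> c))"

lemma Lop_lin: "lin_map T T (Lop i)"
  unfolding Lop_def
  by (rule lin_map_tsum[OF kspace_tensor bilin_step[OF kspace_tensor bilin_tens] A_kspace B_kspace])

lemma Lop_rho: "e \<in> carrier A \<Longrightarrow> \<rho> (y i \<otimes>\<^bsub>A\<^esub> e) = Lop i (\<rho> e)"
  by (simp add: Lop_def rho_gen)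

lemma tens_smult_left: "a \<in> carrier A \<Longrightarrow> c \<in> carrier B \<Longrightarrow>
    tens A B (s \<odot>\<^bsub>A\<^esub> a) c = s \<odot>\<^bsub>T\<^esub> tens A B a c"
  using lin_map_smult[OF bilin_left[OF bilin_tens]] .

lemma tens_smult_right: "a \<in> carrier A \<Longrightarrow> c \<in> carrier B \<Longrightarrow>
    tens A B a (s \<odot>\<^bsub>B\<^esub> c) = s \<odot>\<^bsub>T\<^esub> tens A B a c"
  using lin_map_smult[OF bilin_right[OF bilin_tens]] .

lemma Lop_tens:
  assumes "a \<in> carrier A" "c \<in> carrier B" "G i a = s \<odot>\<^bsub>A\<^esub> a"
  shows "Lop i (tens A B a c) = tens A B (y i \<otimes>\<^bsub>A\<^esub> a) c \<oplus>\<^bsub>T\<^esub> s \<odot>\<^bsub>T\<^esub> tens A B a (x i \<otimes>\<^bsub>B\<^esub> c)"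
  unfolding Lop_def
  by (subst tsum_tens[OF kspace_tensor bilin_step[OF kspace_tensor bilin_tens] A_kspace B_kspace])
     (simp_all add: assms tens_smult_left)

definition Lop12 where "Lop12 t = Lop G1 (Lop G2 t) \<oplus>\<^bsub>T\<^esub> (- q12) \<odot>\<^bsub>T\<^esub> Lop G2 (Lop G1 t)"

lemma Lop12_lin: "lin_map T T Lop12"
  unfolding Lop12_def
  by (intro lin_map_plus[OF kspace_tensor] lin_map_scale[OF kspace_tensor] lin_map_comp[OF Lop_lin Lop_lin])

lemma Lop12_rho: "e \<in> carrier A \<Longrightarrow> \<rho> (A.y12 \<otimes>\<^bsub>A\<^esub> e) = Lop12 (\<rho> e)"
  by (simp add: A.y12_mult A.minus_eq_smult A.smult_smult lin_map_add[OF rho_lin]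
      lin_map_smult[OF rho_lin] Lop_rho Lop12_def)

text \<open>The formula for \<rho>(y12), applied to a tensor whose left factor is an eigenvector. In
  y1 y2 - q12 y2 y1 the two terms in y2 \<otimes> x1 cancel, and those in y1 \<otimes> x2 add up to
  1 - q12 q21.\<close>

lemma Lop12_tens:
  assumes a: "a \<in> carrier A" and c: "c \<in> carrier B"
    and G1: "G G1 a = s1 \<odot>\<^bsub>A\<^esub> a" and G2: "G G2 a = s2 \<odot>\<^bsub>A\<^esub> a"
  shows "Lop12 (tens A B a c) = tens A B (A.y12 \<otimes>\<^bsub>A\<^esub> a) c
    \<oplus>\<^bsub>T\<^esub> ((1 - inverse q) * s2) \<odot>\<^bsub>T\<^esub> tens A B (y G1 \<otimes>\<^bsub>A\<^esub> a) (x G2 \<otimes>\<^bsub>B\<^esub> c)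
    \<oplus>\<^bsub>T\<^esub> (s1 * s2) \<odot>\<^bsub>T\<^esub> tens A B a (B.y12 \<otimes>\<^bsub>B\<^esub> c)"
proof -
  define t1 t2 t3 t4 t5 t6 where
    "t1 = tens A B (y G1 \<otimes>\<^bsub>A\<^esub> (y G2 \<otimes>\<^bsub>A\<^esub> a)) c" and "t2 = tens A B (y G2 \<otimes>\<^bsub>A\<^esub> (y G1 \<otimes>\<^bsub>A\<^esub> a)) c"
    and "t3 = tens A B (y G2 \<otimes>\<^bsub>A\<^esub> a) (x G1 \<otimes>\<^bsub>B\<^esub> c)" and "t4 = tens A B (y G1 \<otimes>\<^bsub>A\<^esub> a) (x G2 \<otimes>\<^bsub>B\<^esub> c)"
    and "t5 = tens A B a (x G1 \<otimes>\<^bsub>B\<^esub> (x G2 \<otimes>\<^bsub>B\<^esub> c))" and "t6 = tens A B a (x G2 \<otimes>\<^bsub>B\<^esub> (x G1 \<otimes>\<^bsub>B\<^esub> c))"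
  note t_defs = t1_def t2_def t3_def t4_def t5_def t6_def
  have tc [simp]: "t1 \<in> carrier T" "t2 \<in> carrier T" "t3 \<in> carrier T" "t4 \<in> carrier T"
    "t5 \<in> carrier T" "t6 \<in> carrier T" using a c by (simp_all add: t_defs)
  have Gy: "G i (y j \<otimes>\<^bsub>A\<^esub> a) = (bm i j * s) \<odot>\<^bsub>A\<^esub> (y j \<otimes>\<^bsub>A\<^esub> a)" if "G i a = s \<odot>\<^bsub>A\<^esub> a" for i j s
    using a by (simp add: G_gen that A.smult_mult_right A.smult_smult)
  have E1: "Lop G1 (Lop G2 (tens A B a c)) =
      (t1 \<oplus>\<^bsub>T\<^esub> (q12 * s1) \<odot>\<^bsub>T\<^esub> t3) \<oplus>\<^bsub>T\<^esub> s2 \<odot>\<^bsub>T\<^esub> (t4 \<oplus>\<^bsub>T\<^esub> s1 \<odot>\<^bsub>T\<^esub> t5)"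
    using a c
    by (simp add: Lop_tens[OF _ _ G2] lin_map_add[OF Lop_lin] lin_map_smult[OF Lop_lin]
        Lop_tens[OF _ _ Gy[OF G1]] Lop_tens[OF _ _ G1] bm t_defs)
  have E2: "Lop G2 (Lop G1 (tens A B a c)) =
      (t2 \<oplus>\<^bsub>T\<^esub> (q21 * s2) \<odot>\<^bsub>T\<^esub> t4) \<oplus>\<^bsub>T\<^esub> s1 \<odot>\<^bsub>T\<^esub> (t3 \<oplus>\<^bsub>T\<^esub> s2 \<odot>\<^bsub>T\<^esub> t6)"
    using a c
    by (simp add: Lop_tens[OF _ _ G1] lin_map_add[OF Lop_lin] lin_map_smult[OF Lop_lin]
        Lop_tens[OF _ _ Gy[OF G2]] Lop_tens[OF _ _ G2] bm t_defs)
  have F1: "tens A B (A.y12 \<otimes>\<^bsub>A\<^esub> a) c = t1 \<oplus>\<^bsub>T\<^esub> (- q12) \<odot>\<^bsub>T\<^esub> t2"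
    using a c by (simp add: A.y12_mult A.minus_eq_smult A.smult_smult t_defs tens_smult_left
        lin_map_add[OF bilin_left[OF bilin_tens]])
  have F2: "tens A B a (B.y12 \<otimes>\<^bsub>B\<^esub> c) = t5 \<oplus>\<^bsub>T\<^esub> (- q12) \<odot>\<^bsub>T\<^esub> t6"
    using a c by (simp add: B.y12_mult B.minus_eq_smult B.smult_smult t_defs tens_smult_right
        lin_map_add[OF bilin_right[OF bilin_tens]])
  have c3: "(q12 * s1) \<odot>\<^bsub>T\<^esub> t3 \<oplus>\<^bsub>T\<^esub> (- (q12 * s1)) \<odot>\<^bsub>T\<^esub> t3 = \<zero>\<^bsub>T\<^esub>"
    by (simp flip: T.smult_l_distr)
  have c4: "((1 - inverse q) * s2) \<odot>\<^bsub>T\<^esub> t4 = s2 \<odot>\<^bsub>T\<^esub> t4 \<oplus>\<^bsub>T\<^esub> (- (q12 * (q21 * s2))) \<odot>\<^bsub>T\<^esub> t4"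
    by (simp add: q12q21[symmetric] algebra_simps flip: T.smult_l_distr)
  have "Lop12 (tens A B a c) = t1 \<oplus>\<^bsub>T\<^esub> (- q12) \<odot>\<^bsub>T\<^esub> t2 \<oplus>\<^bsub>T\<^esub>
      (s2 \<odot>\<^bsub>T\<^esub> t4 \<oplus>\<^bsub>T\<^esub> (- (q12 * (q21 * s2))) \<odot>\<^bsub>T\<^esub> t4) \<oplus>\<^bsub>T\<^esub>
      ((s1 * s2) \<odot>\<^bsub>T\<^esub> t5 \<oplus>\<^bsub>T\<^esub> (- (q12 * (s1 * s2))) \<odot>\<^bsub>T\<^esub> t6) \<oplus>\<^bsub>T\<^esub>
      ((q12 * s1) \<odot>\<^bsub>T\<^esub> t3 \<oplus>\<^bsub>T\<^esub> (- (q12 * s1)) \<odot>\<^bsub>T\<^esub> t3)"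
    unfolding Lop12_def E1 E2 by (simp add: T.smult_r_distr T.smult_smult T.a_ac mult_ac)
  also have "\<dots> = (t1 \<oplus>\<^bsub>T\<^esub> (- q12) \<odot>\<^bsub>T\<^esub> t2) \<oplus>\<^bsub>T\<^esub> ((1 - inverse q) * s2) \<odot>\<^bsub>T\<^esub> t4 \<oplus>\<^bsub>T\<^esub>
      (s1 * s2) \<odot>\<^bsub>T\<^esub> (t5 \<oplus>\<^bsub>T\<^esub> (- q12) \<odot>\<^bsub>T\<^esub> t6)"
    unfolding c3 c4 by (simp add: T.smult_r_distr T.smult_smult mult_ac)
  finally show ?thesis unfolding F1 F2 t4_def .
qed

text \<open>Existence of an eigenvalue suffices for the vanishing arguments below, where the scalar
  multiplies zero.\<close>

lemma G_Y: "\<exists>s. G i (Y a b c) = s \<odot>\<^bsub>A\<^esub> Y a b c"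
proof -
  have gen: "\<exists>s. G i (y j \<otimes>\<^bsub>A\<^esub> e) = s \<odot>\<^bsub>A\<^esub> (y j \<otimes>\<^bsub>A\<^esub> e)"
    if "e \<in> carrier A" "\<exists>s. G i e = s \<odot>\<^bsub>A\<^esub> e" for j e
    using that by (auto simp: G_gen A.smult_mult_right A.smult_smult)
  have g12: "\<exists>s. G i (A.y12 \<otimes>\<^bsub>A\<^esub> e) = s \<odot>\<^bsub>A\<^esub> (A.y12 \<otimes>\<^bsub>A\<^esub> e)"
    if e: "e \<in> carrier A" and ex: "\<exists>s. G i e = s \<odot>\<^bsub>A\<^esub> e" for e
  proof -
    obtain s where s: "G i e = s \<odot>\<^bsub>A\<^esub> e" using ex by blast
    have "G i (A.y12 \<otimes>\<^bsub>A\<^esub> e) = (bm i G1 * bm i G2 * s) \<odot>\<^bsub>A\<^esub> (A.y12 \<otimes>\<^bsub>A\<^esub> e)"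
      using e by (simp add: A.y12_mult A.minus_eq_smult lin_map_add[OF G_lin] lin_map_smult[OF G_lin]
          G_gen s A.smult_mult_right A.smult_smult A.smult_r_distr mult_ac)
    then show ?thesis by blast
  qed
  have 1: "\<exists>s. G i (Y 0 0 c) = s \<odot>\<^bsub>A\<^esub> Y 0 0 c"
  proof (induction c)
    case 0
    show ?case by (auto simp: A.Y_000 G_one intro: exI[of _ 1])
  qed (auto simp: A.y1_Y00[symmetric] intro: gen)
  have 2: "\<exists>s. G i (Y 0 b c) = s \<odot>\<^bsub>A\<^esub> Y 0 b c"
    by (induction b) (auto simp: 1 A.y12_Y0[symmetric] intro: g12)
  show ?thesis
    by (induction a) (auto simp: 2 A.y2_Y[symmetric] intro: gen)
qed

lemma G_Y00: "G i (Y 0 0 r) = bm i G1 ^ r \<odot>\<^bsub>A\<^esub> Y 0 0 r"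
  by (induction r)
     (simp_all add: A.Y_000 G_one A.y1_Y00[symmetric] G_gen A.smult_mult_right A.smult_smult mult_ac)

text \<open>The last exponent is unrestricted, since powers of \<open>y G1\<close> accumulate on the
  left beyond \<open>N\<close>; reducing them by y1^N = l1 leaves the other two exponents
  untouched.\<close>

lemma eps0_Y_zero:
  assumes "a < N" "b < N" "a \<noteq> 0 \<or> b \<noteq> 0"
  shows "\<epsilon>0 (Y a b c) = 0"
proof (induction c rule: less_induct)
  case (less c)
  show ?case
  proof (cases "c < N")
    case True
    then show ?thesis using assms by (auto simp: eps0_Y)
  next
    case False
    then obtain c' where "c = N + c'" using le_Suc_ex by (metis linorder_not_less)
    then show ?thesis using less[of c'] A.N_pos
      by (simp add: A.Y_wrap1 lin_map_smult[OF eps0_lin])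
  qed
qed

text \<open>Below 2N at most one reduction by y1^N = l1 is possible. The exponents in question are m
  + k with m \<le> n1 < N and k \<le> n12 < N.\<close>

lemma eps0_y1_pow:
  assumes "s < 2 * N"
  shows "\<epsilon>0 (Y 0 0 s) = (if s = 0 then 1 else if s = N then l1 else 0)"
proof (cases "s < N")
  case True
  then show ?thesis using A.N_pos by (auto simp: eps0_Y)
next
  case False
  then obtain s' where "s = N + s'" using le_Suc_ex by (metis linorder_not_less)
  then show ?thesis using assms A.N_pos
    by (auto simp: A.Y_wrap1 lin_map_smult[OF eps0_lin] eps0_Y)
qed

definition Z2 where "Z2 n t = contract ((Lop G2 ^^ n) t)"

lemma funpow_lin: "lin_map T T f \<Longrightarrow> lin_map T T (f ^^ n)"
  by (induction n) (auto simp: comp_def lin_map_id id_def intro: lin_map_comp)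

lemma Z2_lin: "lin_map T B (Z2 n)"
  unfolding Z2_def by (rule lin_map_comp[OF funpow_lin[OF Lop_lin] contract_lin])

lemma Z2_Suc: "Z2 (Suc n) t = Z2 n (Lop G2 t)"
  by (simp add: Z2_def funpow_swap1)

text \<open>A y2 or y12 on the left never disappears under further multiplication by y2, as the
  bound \<open>i + n < N\<close> keeps the relation for y2^N out of reach.\<close>

lemma Z2_vanish:
  assumes "c \<in> carrier B" "i \<noteq> 0 \<or> a \<noteq> 0" "i + n < N" "a < N"
  shows "Z2 n (tens A B (Y i a r) c) = \<zero>\<^bsub>B\<^esub>"
  using assms
proof (induction n arbitrary: i c)
  case 0
  then show ?case by (simp add: Z2_def contract_tens eps0_Y_zero)
next
  case (Suc n)
  obtain s where s: "G G2 (Y i a r) = s \<odot>\<^bsub>A\<^esub> Y i a r" using G_Y by blast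
  show ?case unfolding Z2_Suc
    using Suc by (simp add: Lop_tens[OF _ _ s] lin_map_add[OF Z2_lin] lin_map_smult[OF Z2_lin] A.y2_Y)
qed

text \<open>By \<open>Z2_vanish\<close> every y2 must act through its right summand, and each x2
  crosses y1^r at the cost of q21^r.\<close>

lemma Z2_y1:
  assumes "c \<in> carrier B" "n < N"
  shows "Z2 n (tens A B (Y 0 0 r) c) = (q21 ^ (r * n) * \<epsilon>0 (Y 0 0 r)) \<odot>\<^bsub>B\<^esub> (x G2 [^]\<^bsub>B\<^esub> n \<otimes>\<^bsub>B\<^esub> c)"
  using assms
proof (induction n arbitrary: c)
  case 0
  then show ?case by (simp add: Z2_def contract_tens)
next
  case (Suc n)
  have "Z2 (Suc n) (tens A B (Y 0 0 r) c) = q21 ^ r \<odot>\<^bsub>B\<^esub> Z2 n (tens A B (Y 0 0 r) (x G2 \<otimes>\<^bsub>B\<^esub> c))"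
    unfolding Z2_Suc using Suc lin_map_closed[OF Z2_lin]
    by (simp add: Lop_tens[OF _ _ G_Y00] lin_map_add[OF Z2_lin] lin_map_smult[OF Z2_lin] A.y2_Y
        Z2_vanish bm)
  then show ?case using Suc
    by (simp add: B.smult_smult B.m_assoc[symmetric] power_add mult_ac)
qed

definition Z12 where "Z12 n2 n t = Z2 n2 ((Lop12 ^^ n) t)"

lemma Z12_lin: "lin_map T B (Z12 n2 n)"
  unfolding Z12_def by (rule lin_map_comp[OF funpow_lin[OF Lop12_lin] Z2_lin])

lemma Z12_Suc: "Z12 n2 (Suc n) t = Z12 n2 n (Lop12 t)"
  by (simp add: Z12_def funpow_swap1)

text \<open>The analogue for y12: each of the three terms of \<rho>(y12) keeps or raises the
  exponent of y12 on the left, and that exponent stays below \<open>N\<close>.\<close>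

lemma Z12_vanish:
  assumes "c \<in> carrier B" "a \<noteq> 0" "a + n < N" "n2 < N"
  shows "Z12 n2 n (tens A B (Y 0 a r) c) = \<zero>\<^bsub>B\<^esub>"
  using assms
proof (induction n arbitrary: a r c)
  case 0
  then show ?case by (simp add: Z12_def Z2_vanish)
next
  case (Suc n)
  obtain s1 s2 where s: "G G1 (Y 0 a r) = s1 \<odot>\<^bsub>A\<^esub> Y 0 a r" "G G2 (Y 0 a r) = s2 \<odot>\<^bsub>A\<^esub> Y 0 a r"
    using G_Y by meson
  show ?case unfolding Z12_Suc
    using Suc by (simp add: Lop12_tens[OF _ _ s] lin_map_add[OF Z12_lin] lin_map_smult[OF Z12_lin]
        A.y12_Y0 A.y1_Y0 tens_smult_left)
qed

text \<open>By \<open>Z12_vanish\<close> only two terms of \<rho>(y12) matter, those in y1 \<otimes>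
  x2 and 1 \<otimes> x12. Here \<open>k\<close> counts uses of the first; suitably normalised, the
  two obey the q-binomial recursion.\<close>

lemma Z12_y1:
  assumes "n2 < N" "n < N"
  shows "Z12 n2 n (tens A B (Y 0 0 m) (X 0 0 j)) =
    (\<Oplus>\<^bsub>B\<^esub>k\<in>{..n}. (gauss_binomial q n k * ((1 - inverse q) * q21 ^ m) ^ k * q21 ^ (k * (k - 1) div 2)
      * ((q * q21) ^ m) ^ (n - k) * q21 ^ ((m + k) * n2) * \<epsilon>0 (Y 0 0 (m + k)))
      \<odot>\<^bsub>B\<^esub> X (n2 + k) (n - k) j)"
proof -
  define \<alpha> \<beta> where "\<alpha> = (1 - inverse q) * q21 ^ m" and "\<beta> = (q * q21) ^ m"
  \<comment> \<open>The normalising weight: \<alpha> and \<beta> stem from crossing y1^m, and the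
    triangular exponent of \<open>q21\<close> from crossing the further copies of y1 created one at
    a time.\<close>
  define w where "w k d = \<alpha> ^ k * q21 ^ (k * (k - 1) div 2) * \<beta> ^ d" for k d :: nat
  define h where "h n k d = Z12 n2 n (tens A B (Y 0 0 (m + k)) (X k d j))" for n k d
  define U where "U n k d = w k d \<odot>\<^bsub>B\<^esub> h n k d" for n k d
  have h_closed [simp]: "h n k d \<in> carrier B" for n k d
    unfolding h_def by (rule lin_map_closed[OF Z12_lin]) simp
  have tri: "Suc k * (Suc k - 1) div 2 = k * (k - 1) div 2 + k" for k :: nat
    by (cases k) (auto simp: algebra_simps)
  have w_Suc: "w (Suc k) d = \<alpha> * q21 ^ k * w k d" "w k (Suc d) = \<beta> * w k d" for k d
    by (simp_all only: w_def tri power_add power_Suc mult_ac)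
  \<comment> \<open>Each additional pair of crossings contributes q^2 q12 q21 = q; this is the
    q-commutation of the two remaining terms.\<close>
  have qq: "(q * q21) ^ (m + k) * (q * q12) ^ k = \<beta> * q ^ k" for k
  proof -
    have "(q * q21) ^ (m + k) * (q * q12) ^ k = \<beta> * (q * (q * (q12 * q21))) ^ k"
      by (simp only: \<beta>_def power_add power_mult_distrib mult_ac)
    then show ?thesis using q_nz by (simp add: q12q21)
  qed
  have rec_h: "h (Suc n) k d = (\<alpha> * q21 ^ k) \<odot>\<^bsub>B\<^esub> h n (Suc k) d \<oplus>\<^bsub>B\<^esub> (\<beta> * q ^ k) \<odot>\<^bsub>B\<^esub> h n k (Suc d)"
    if "Suc n < N" for n k d
  proof -
    have "h (Suc n) k d = ((1 - inverse q) * q21 ^ (m + k)) \<odot>\<^bsub>B\<^esub> h n (Suc k) d \<oplus>\<^bsub>B\<^esub>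
       ((q * q21) ^ (m + k) * (q * q12) ^ k) \<odot>\<^bsub>B\<^esub> h n k (Suc d)"
      unfolding h_def Z12_Suc using that assms lin_map_closed[OF Z12_lin]
      by (simp add: Lop12_tens[OF _ _ G_Y00 G_Y00] lin_map_add[OF Z12_lin] lin_map_smult[OF Z12_lin]
          A.y12_Y0 A.y1_Y00 Z12_vanish B.y2_Y B.y12_Y tens_smult_right B.smult_smult bm
          power_mult_distrib)
    then show ?thesis unfolding qq by (simp add: \<alpha>_def power_add mult_ac)
  qed
  have "U n 0 0 = (\<Oplus>\<^bsub>B\<^esub>k\<in>{..n}. (gauss_binomial q n k * q ^ (0 * (n - k))) \<odot>\<^bsub>B\<^esub> U 0 (0 + k) (0 + (n - k)))"
  \<comment> \<open>The recursion drops a term with exponent 1 of y12 on the left, which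
    \<open>Z12_vanish\<close> permits only while \<open>Suc n < N\<close>.\<close>
  proof (rule B.gauss_recursion[where M = "N - 1"])
    show "U n r j \<in> carrier B" for n r j by (simp add: U_def)
    show "U (Suc n) r j = U n (Suc r) j \<oplus>\<^bsub>B\<^esub> q ^ r \<odot>\<^bsub>B\<^esub> U n r (Suc j)" if "n < N - 1" for n r j
      using that
      by (simp add: U_def rec_h w_Suc B.smult_r_distr B.smult_smult mult_ac)
  qed (use assms in simp)
  also have "U n 0 0 = h n 0 0" by (simp add: U_def w_def)
  also have "h n 0 0 = Z12 n2 n (tens A B (Y 0 0 m) (X 0 0 j))" by (simp add: h_def)
  finally have "Z12 n2 n (tens A B (Y 0 0 m) (X 0 0 j)) =
      (\<Oplus>\<^bsub>B\<^esub>k\<in>{..n}. gauss_binomial q n k \<odot>\<^bsub>B\<^esub> U 0 k (n - k))" by simp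
  also have "\<dots> = (\<Oplus>\<^bsub>B\<^esub>k\<in>{..n}. (gauss_binomial q n k * \<alpha> ^ k * q21 ^ (k * (k - 1) div 2)
      * \<beta> ^ (n - k) * q21 ^ ((m + k) * n2) * \<epsilon>0 (Y 0 0 (m + k))) \<odot>\<^bsub>B\<^esub> X (n2 + k) (n - k) j)"
    using assms
    by (intro B.finsum_cong')
       (auto simp: U_def h_def Z12_def Z2_y1 B.pow_y2_Y B.smult_smult w_def mult_ac)
  finally show ?thesis by (simp add: \<alpha>_def \<beta>_def)
qed

text \<open>The innermost factor \<rho>(y1)^n1 is expanded first: y1 \<otimes> 1 and 1 \<otimes> x1
  commute up to \<open>bm G1 G1 = q\<close>.\<close>

lemma retr_Y_sum:
  assumes "n2 < N" "n12 < N"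
  shows "retr (Y n2 n12 n1) = (\<Oplus>\<^bsub>B\<^esub>m\<in>{..n1}. gauss_binomial q n1 m \<odot>\<^bsub>B\<^esub>
    Z12 n2 n12 (tens A B (Y 0 0 m) (X 0 0 (n1 - m))))"
proof -
  have 1: "\<rho> (Y 0 0 c) = (Lop G1 ^^ c) (\<rho> \<one>\<^bsub>A\<^esub>)" for c
    by (induction c) (simp_all add: A.Y_000 A.y1_Y00[symmetric] Lop_rho)
  have 2: "\<rho> (Y 0 b c) = (Lop12 ^^ b) (\<rho> (Y 0 0 c))" for b c
    by (induction b) (simp_all add: A.y12_Y0[symmetric] Lop12_rho)
  have 3: "\<rho> (Y a b c) = (Lop G2 ^^ a) (\<rho> (Y 0 b c))" for a b c
    by (induction a) (simp_all add: A.y2_Y[symmetric] Lop_rho)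
  define U where "U n m j = Z12 n2 n12 ((Lop G1 ^^ n) (tens A B (Y 0 0 m) (X 0 0 j)))" for n m j
  have "U n1 0 0 = (\<Oplus>\<^bsub>B\<^esub>m\<in>{..n1}. (gauss_binomial q n1 m * q ^ (0 * (n1 - m))) \<odot>\<^bsub>B\<^esub> U 0 (0 + m) (0 + (n1 - m)))"
  proof (rule B.gauss_recursion[where M = n1])
    show "U n r j \<in> carrier B" for n r j
      unfolding U_def by (intro lin_map_closed[OF Z12_lin] lin_map_closed[OF funpow_lin[OF Lop_lin]]) simp
    have L: "lin_map T B (\<lambda>t. Z12 n2 n12 ((Lop G1 ^^ n) t))" for n
      by (rule lin_map_comp[OF funpow_lin[OF Lop_lin] Z12_lin])
    show "U (Suc n) r j = U n (Suc r) j \<oplus>\<^bsub>B\<^esub> q ^ r \<odot>\<^bsub>B\<^esub> U n r (Suc j)" for n r j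
      unfolding U_def
      by (simp add: funpow_swap1 Lop_tens[OF _ _ G_Y00] lin_map_add[OF L] lin_map_smult[OF L]
          A.y1_Y00 B.y1_Y00 bm)
  qed simp
  moreover have "retr (Y n2 n12 n1) = U n1 0 0"
    by (simp add: retr_def 3[of n2] 2[of n12] 1 U_def Z12_def Z2_def rho_one A.Y_000 B.Y_000)
  ultimately show ?thesis by (simp add: U_def)
qed

end

lemma minus_ground: "a \<ominus>\<^bsub>ground\<^esub> b = a - (b :: 'k::field)"
  by (simp add: a_minus_def a_inv_ground)

lemma (in kspace) add_minus_cancel: "a \<in> carrier V \<Longrightarrow> b \<in> carrier V \<Longrightarrow> a \<oplus> b \<ominus> b = a"
  by (simp add: a_minus_def a_assoc r_neg)

context cleft_comod
begin

definition corr_coeff :: "nat \<Rightarrow> nat \<Rightarrow> nat \<Rightarrow> nat \<Rightarrow> nat \<Rightarrow> 'k" where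
  "corr_coeff n2 n12 n1 k m = gauss_binomial q n12 k * gauss_binomial q n1 m * (1 - inverse q) ^ k
     * q21 ^ (n2 * (k + m) + m * n12 + k * (k - 1) div 2) * q ^ (m * (n12 - k))"

abbreviation corr_set :: "nat \<Rightarrow> nat \<Rightarrow> nat \<Rightarrow> (nat \<times> nat) set" where
  "corr_set n2 n12 n1 \<equiv> {(k, m). k \<le> n12 \<and> m \<le> n1 \<and> k + m = N \<and> n2 + k < N}"

text \<open>In the double sum over k and m, \<epsilon>0 keeps y1^(m+k) only for m + k = 0, the
  leading monomial, and for m + k = N, the correction.\<close>

lemma retr_Y:
  assumes "n2 < N" "n12 < N" "n1 < N"
  shows "retr (Y n2 n12 n1) = X n2 n12 n1 \<oplus>\<^bsub>B\<^esub> l1 \<odot>\<^bsub>B\<^esub>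
    finsum B (\<lambda>(k, m). corr_coeff n2 n12 n1 k m \<odot>\<^bsub>B\<^esub> X (n2 + k) (n12 - k) (n1 - m)) (corr_set n2 n12 n1)"
proof -
  let ?C = "corr_coeff n2 n12 n1"
  define W where "W k m = ?C k m \<odot>\<^bsub>B\<^esub> X (n2 + k) (n12 - k) (n1 - m)" for k m
  have W_closed [simp]: "W k m \<in> carrier B" for k m by (simp add: W_def)
  define inner where "inner m = (\<Oplus>\<^bsub>B\<^esub>k\<in>{..n12}. \<epsilon>0 (Y 0 0 (m + k)) \<odot>\<^bsub>B\<^esub> W k m)" for m
  have inner_closed [simp]: "inner m \<in> carrier B" for m by (auto simp: inner_def intro!: B.finsum_closed)
  have summand: "gauss_binomial q n1 m \<odot>\<^bsub>B\<^esub> Z12 n2 n12 (tens A B (Y 0 0 m) (X 0 0 (n1 - m))) = inner m" for m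
  proof -
    \<comment> \<open>Collects the crossing scalars into \<open>corr_coeff\<close>; the exponent m
      n12 of \<open>q21\<close> is split as m k + m (n12 - k).\<close>
    have coeff: "gauss_binomial q n1 m * (gauss_binomial q n12 k * ((1 - inverse q) * q21 ^ m) ^ k *
        q21 ^ (k * (k - 1) div 2) * ((q * q21) ^ m) ^ (n12 - k) * q21 ^ ((m + k) * n2) * e) = e * ?C k m"
      if "k \<le> n12" for k e
    proof -
      have "m * n12 = m * k + m * (n12 - k)" using that by (simp flip: distrib_left)
      then have "q21 ^ (n2 * (k + m) + m * n12 + k * (k - 1) div 2) =
          (q21 ^ m) ^ k * q21 ^ (k * (k - 1) div 2) * (q21 ^ m) ^ (n12 - k) * q21 ^ ((m + k) * n2)"
        by (simp only: power_add power_mult[symmetric] mult_ac add_ac)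
      then show ?thesis
        by (simp only: corr_coeff_def power_mult_distrib power_mult[of q] mult_ac)
    qed
    show ?thesis unfolding Z12_y1[OF assms(1,2)] inner_def
      by (subst B.smult_finsum) (auto simp: B.smult_smult coeff W_def simp del: One_nat_def intro!: B.finsum_cong')
  qed
  have inner0: "inner 0 = X n2 n12 n1"
  proof -
    have "inner 0 = (\<Oplus>\<^bsub>B\<^esub>k\<in>{0}. W k 0)" unfolding inner_def
      by (rule B.add.finprod_mono_neutral_cong_right) (use assms in \<open>auto simp: eps0_y1_pow\<close>)
    then show ?thesis by (simp add: W_def corr_coeff_def)
  qed
  have inner_pos: "inner m = (if (N - m, m) \<in> corr_set n2 n12 n1 then l1 \<odot>\<^bsub>B\<^esub> W (N - m) m else \<zero>\<^bsub>B\<^esub>)"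
    if m: "m \<in> {1..n1}" for m
  proof -
    \<comment> \<open>Since 0 < m + k < 2N, only k = N - m survives; the intersection is empty if
      that value exceeds n12.\<close>
    have "inner m = (\<Oplus>\<^bsub>B\<^esub>k\<in>{N - m} \<inter> {..n12}. l1 \<odot>\<^bsub>B\<^esub> W k m)" unfolding inner_def
      by (rule B.add.finprod_mono_neutral_cong_right) (use m assms in \<open>auto simp: eps0_y1_pow\<close>)
    also have "\<dots> = (if N - m \<le> n12 then l1 \<odot>\<^bsub>B\<^esub> W (N - m) m else \<zero>\<^bsub>B\<^esub>)" by simp
    also have "\<dots> = (if (N - m, m) \<in> corr_set n2 n12 n1 then l1 \<odot>\<^bsub>B\<^esub> W (N - m) m else \<zero>\<^bsub>B\<^esub>)"
    proof -
      \<comment> \<open>Here x2^N = 0 in the Nichols algebra removes the term, whence the condition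
        \<open>n2 + k < N\<close>.\<close>
      have "W (N - m) m = \<zero>\<^bsub>B\<^esub>" if "\<not> n2 + (N - m) < N"
      proof -
        have "n2 + (N - m) = N + (n2 + (N - m) - N)" using that by simp
        then have "X (n2 + (N - m)) (n12 - (N - m)) (n1 - m) = \<zero>\<^bsub>B\<^esub>"
          by (metis B.Y_wrap2 B.smult_0 B.Y_closed)
        then show ?thesis by (simp add: W_def)
      qed
      then show ?thesis using m assms(3) by auto
    qed
    finally show ?thesis .
  qed
  define M where "M = {m \<in> {1..n1}. (N - m, m) \<in> corr_set n2 n12 n1}"
  have "retr (Y n2 n12 n1) = (\<Oplus>\<^bsub>B\<^esub>m\<in>insert 0 {1..n1}. inner m)"
    using retr_Y_sum[OF assms(1,2), of n1] by (simp add: summand atMost_atLeast0 atLeastAtMost_insertL)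
  also have "\<dots> = X n2 n12 n1 \<oplus>\<^bsub>B\<^esub> (\<Oplus>\<^bsub>B\<^esub>m\<in>{1..n1}. inner m)"
    by (subst B.finsum_insert) (auto simp: inner0)
  also have "(\<Oplus>\<^bsub>B\<^esub>m\<in>{1..n1}. inner m) = (\<Oplus>\<^bsub>B\<^esub>m\<in>M. l1 \<odot>\<^bsub>B\<^esub> W (N - m) m)"
    by (rule B.add.finprod_mono_neutral_cong_right) (auto simp: M_def inner_pos)
  also have "\<dots> = l1 \<odot>\<^bsub>B\<^esub> (\<Oplus>\<^bsub>B\<^esub>m\<in>M. W (N - m) m)"
    by (subst B.smult_finsum) auto
  also have "(\<Oplus>\<^bsub>B\<^esub>m\<in>M. W (N - m) m) = finsum B (\<lambda>(k, m). W k m) ((\<lambda>m. (N - m, m)) ` M)"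
    by (subst B.finsum_reindex) (auto simp: inj_on_def)
  also have "(\<lambda>m. (N - m, m)) ` M = corr_set n2 n12 n1"
    using assms by (auto simp: M_def image_iff)
  finally show ?thesis by (simp add: W_def)
qed

end

section \<open>The section\<close>

text \<open>Every letter has to go to the right factor, crossing only the empty word.\<close>

lemma (in kspace) qshuf_left_unit:
  assumes "\<And>u v. F u v \<in> carrier V" "\<And>u v. u \<noteq> [] \<Longrightarrow> F u v = \<zero>"
  shows "qshuf V b w F = F [] w"
  using assms
proof (induction w arbitrary: F)
  case (Cons i w)
  show ?case using Cons.prems
    by (simp, subst Cons.IH) (auto simp: wscal_def)
qed simp

lemma (in kspace) qshuf_right_unit:
  assumes "\<And>u v. F u v \<in> carrier V" "\<And>u v. v \<noteq> [] \<Longrightarrow> F u v = \<zero>"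
  shows "qshuf V b w F = F w []"
  using assms
proof (induction w arbitrary: F)
  case (Cons i w)
  show ?case using Cons.prems
    by (simp, subst Cons.IH) auto
qed simp

text \<open>\<open>B\<close> coacts on itself through \<open>\<Delta>\<close> with the same braiding
  matrix \<open>bm\<close>, so \<rho> and \<Delta> are expanded by the same
  \<open>qshuf\<close>.\<close>

locale cleft_section = cleft_comod A B y x bm G \<rho> N q q12 l1 l2 l12 q21 \<epsilon>0 +
    D: diag_comod B B x x bm GB \<Delta>
  for A :: "('k::field, 'a, 'm) module_scheme" and B :: "('k, 'b, 'n) module_scheme"
    and y :: "gen \<Rightarrow> 'a" and x :: "gen \<Rightarrow> 'b" and bm :: "gen \<Rightarrow> gen \<Rightarrow> 'k"
    and G :: "gen \<Rightarrow> 'a \<Rightarrow> 'a" and \<rho> :: "'a \<Rightarrow> ('a \<times> 'b \<Rightarrow>\<^sub>0 'k) set"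
    and N :: nat and q q12 l1 l2 l12 q21 :: 'k and \<epsilon>0 :: "'a \<Rightarrow> 'k"
    and GB :: "gen \<Rightarrow> 'b \<Rightarrow> 'b" and \<Delta> :: "'b \<Rightarrow> ('b \<times> 'b \<Rightarrow>\<^sub>0 'k) set" +
  fixes \<epsilon> :: "'b \<Rightarrow> 'k" and \<gamma> :: "'b \<Rightarrow> 'a"
  assumes eps_lin: "lin_map B ground \<epsilon>" and eps_one: "\<epsilon> \<one>\<^bsub>B\<^esub> = 1"
    and eps_gen: "c \<in> carrier B \<Longrightarrow> \<epsilon> (x i \<otimes>\<^bsub>B\<^esub> c) = 0"
    and gamma_lin: "lin_map B A \<gamma>"
    and gamma_small: "n2 < N \<Longrightarrow> n12 < N \<Longrightarrow> n1 < N \<Longrightarrow> n12 + n1 < N \<Longrightarrow>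
      \<gamma> (pbw B q12 x n2 n12 n1) = pbw A q12 y n2 n12 n1"
    and gamma_large: "n2 < N \<Longrightarrow> n12 < N \<Longrightarrow> n1 < N \<Longrightarrow> n12 + n1 \<ge> N \<Longrightarrow>
      \<gamma> (pbw B q12 x n2 n12 n1) = pbw A q12 y n2 n12 n1 \<ominus>\<^bsub>A\<^esub> l1 \<odot>\<^bsub>A\<^esub>
        finsum A (\<lambda>(k, m). corr_coeff n2 n12 n1 k m \<odot>\<^bsub>A\<^esub> pbw A q12 y (n2 + k) (n12 - k) (n1 - m))
          (corr_set n2 n12 n1)"
begin

interpretation BB: kspace "tensor B B" ..

lemma gamma_closed [simp]: "c \<in> carrier B \<Longrightarrow> \<gamma> c \<in> carrier A"
  using lin_map_closed[OF gamma_lin] .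

lemma retr_gamma:
  assumes "c \<in> carrier B"
  shows "retr (\<gamma> c) = c"
proof (rule B.PBW_lin_eqI[OF B_kspace lin_map_comp[OF gamma_lin retr_lin] lin_map_id _ assms])
  have small: "retr (Y n2 n12 n1) = X n2 n12 n1"
    if "n2 < N" "n12 < N" "n1 < N" "n12 + n1 < N" for n2 n12 n1
  proof -
    have empty: "corr_set n2 n12 n1 = {}" using that by auto
    show ?thesis unfolding retr_Y[OF that(1-3)] empty by simp
  qed
  fix n2 n12 n1 assume n: "n2 < N" "n12 < N" "n1 < N"
  show "retr (\<gamma> (X n2 n12 n1)) = X n2 n12 n1"
  proof (cases "n12 + n1 < N")
    case True
    then show ?thesis using n by (simp add: gamma_small small)
  next
    case False
    let ?C = "corr_coeff n2 n12 n1" and ?S = "corr_set n2 n12 n1"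
    have "retr (finsum A (\<lambda>(k, m). ?C k m \<odot>\<^bsub>A\<^esub> Y (n2 + k) (n12 - k) (n1 - m)) ?S) =
        finsum B (\<lambda>z. retr (case z of (k, m) \<Rightarrow> ?C k m \<odot>\<^bsub>A\<^esub> Y (n2 + k) (n12 - k) (n1 - m))) ?S"
      by (rule lin_map_finsum[OF A_kspace B_kspace retr_lin]) auto
    also have "\<dots> = finsum B (\<lambda>(k, m). ?C k m \<odot>\<^bsub>B\<^esub> X (n2 + k) (n12 - k) (n1 - m)) ?S"
      using n by (intro B.finsum_cong') (auto simp: lin_map_smult[OF retr_lin] small)
    finally have fs: "retr (finsum A (\<lambda>(k, m). ?C k m \<odot>\<^bsub>A\<^esub> Y (n2 + k) (n12 - k) (n1 - m)) ?S) =
        finsum B (\<lambda>(k, m). ?C k m \<odot>\<^bsub>B\<^esub> X (n2 + k) (n12 - k) (n1 - m)) ?S" .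
    have cA: "finsum A (\<lambda>(k, m). ?C k m \<odot>\<^bsub>A\<^esub> Y (n2 + k) (n12 - k) (n1 - m)) ?S \<in> carrier A"
      by (rule A.finsum_closed) auto
    have cB: "finsum B (\<lambda>(k, m). ?C k m \<odot>\<^bsub>B\<^esub> X (n2 + k) (n12 - k) (n1 - m)) ?S \<in> carrier B"
      by (rule B.finsum_closed) auto
    have "\<gamma> (X n2 n12 n1) = Y n2 n12 n1 \<ominus>\<^bsub>A\<^esub> l1 \<odot>\<^bsub>A\<^esub>
        finsum A (\<lambda>(k, m). ?C k m \<odot>\<^bsub>A\<^esub> Y (n2 + k) (n12 - k) (n1 - m)) ?S"
      using n False by (simp add: gamma_large)
    then show ?thesis
      using cA cB by (simp add: lin_map_diff[OF A_kspace B_kspace retr_lin] lin_map_smult[OF retr_lin]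
          fs retr_Y[OF n] B.add_minus_cancel)
  qed
qed

lemma gamma_surj: "\<gamma> ` carrier B = carrier A"
proof
  show "\<gamma> ` carrier B \<subseteq> carrier A" by auto
  have S: "subsp A (\<gamma> ` carrier B)"
    by (rule subsp_image[OF B_kspace A_kspace gamma_lin subsp_UNIV[OF B_kspace]])
  have small: "Y n2 n12 n1 \<in> \<gamma> ` carrier B"
    if "n2 < N" "n12 < N" "n1 < N" "n12 + n1 < N" for n2 n12 n1
    using gamma_small[OF that] B.Y_closed[of n2 n12 n1] by (metis imageI)
  have "Y n2 n12 n1 \<in> \<gamma> ` carrier B" if n: "n2 < N" "n12 < N" "n1 < N" for n2 n12 n1
  proof (cases "n12 + n1 < N")
    case False
    let ?f = "finsum A (\<lambda>(k, m). corr_coeff n2 n12 n1 k m \<odot>\<^bsub>A\<^esub> Y (n2 + k) (n12 - k) (n1 - m))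
      (corr_set n2 n12 n1)"
    have f: "?f \<in> \<gamma> ` carrier B"
      by (rule subsp_finsum[OF A_kspace S]) (use n in \<open>auto intro!: subsp_smult[OF S] small\<close>)
    then have fc: "?f \<in> carrier A" by (rule subsp_carrier[OF S])
    have "Y n2 n12 n1 = \<gamma> (X n2 n12 n1) \<oplus>\<^bsub>A\<^esub> l1 \<odot>\<^bsub>A\<^esub> ?f"
      using gamma_large[OF n] False fc by (simp add: a_minus_def A.a_assoc A.l_neg)
    also have "\<dots> \<in> \<gamma> ` carrier B"
      using f by (intro subsp_add[OF S] subsp_smult[OF S]) auto
    finally show ?thesis .
  qed (use n small in auto)
  then have "vspan A A.PBW \<subseteq> \<gamma> ` carrier B" by (intro vspan_minimal[OF S]) auto
  then show "carrier A \<subseteq> \<gamma> ` carrier B" using A.PBW_spans by blast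
qed

lemma gamma_bij: "bij_betw \<gamma> (carrier B) (carrier A)"
  using gamma_surj retr_gamma by (metis bij_betw_def inj_on_inverseI)

lemma gamma_retr: "e \<in> carrier A \<Longrightarrow> \<gamma> (retr e) = e"
  using gamma_surj retr_gamma by (metis imageE)

lemma eps_word: "\<epsilon> (wmon B x w) = (if w = [] then 1 else 0)"
  by (cases w) (auto simp: eps_one eps_gen)

lemma eps_X: "\<epsilon> (X a b c) = (if a = 0 \<and> b = 0 \<and> c = 0 then 1 else 0)"
proof -
  have y12: "\<epsilon> (B.y12 \<otimes>\<^bsub>B\<^esub> e) = 0" if "e \<in> carrier B" for e
    using that by (simp add: B.y12_mult lin_map_diff[OF B_kspace kspace_ground eps_lin]
        lin_map_smult[OF eps_lin] eps_gen minus_ground)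
  have "\<epsilon> (X (Suc a) b c) = 0" "\<epsilon> (X 0 (Suc b) c) = 0" "\<epsilon> (X 0 0 (Suc c)) = 0" for a b c
    by (simp_all add: B.y2_Y[symmetric] B.y12_Y0[symmetric] B.y1_Y00[symmetric] y12 eps_gen)
  then show ?thesis by (cases a; cases b; cases c) (auto simp: B.Y_000 eps_one)
qed

lemma eps0_gamma:
  assumes "c \<in> carrier B"
  shows "\<epsilon>0 (\<gamma> c) = \<epsilon> c"
proof (rule B.PBW_lin_eqI[OF kspace_ground lin_map_comp[OF gamma_lin eps0_lin] eps_lin _ assms])
  fix n2 n12 n1 assume n: "n2 < N" "n12 < N" "n1 < N"
  show "\<epsilon>0 (\<gamma> (X n2 n12 n1)) = \<epsilon> (X n2 n12 n1)"
  proof (cases "n12 + n1 < N")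
    case True
    then show ?thesis using n by (simp add: gamma_small eps_X eps0_Y)
  next
    case False
    let ?f = "\<lambda>(k, m). corr_coeff n2 n12 n1 k m \<odot>\<^bsub>A\<^esub> Y (n2 + k) (n12 - k) (n1 - m)"
    let ?S = "corr_set n2 n12 n1"
    interpret K: kspace "ground :: ('k, 'k) module" ..
    \<comment> \<open>From m \<le> n1 < N and k + m = N one gets k > 0, so y2 occurs in every
      correction monomial.\<close>
    have z: "\<epsilon>0 (?f z) = \<zero>\<^bsub>ground\<^esub>" if "z \<in> ?S" for z
      using that n by (auto simp: lin_map_smult[OF eps0_lin] eps0_Y_zero)
    have "\<epsilon>0 (finsum A ?f ?S) = finsum ground (\<lambda>z. \<epsilon>0 (?f z)) ?S"
      by (rule lin_map_finsum[OF A_kspace kspace_ground eps0_lin]) auto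
    also have "\<dots> = \<zero>\<^bsub>ground\<^esub>"
      by (rule K.add.finprod_one_eqI) (rule z)
    finally have "\<epsilon>0 (finsum A ?f ?S) = 0" by simp
    moreover have "finsum A ?f ?S \<in> carrier A" by (rule A.finsum_closed) auto
    ultimately have "\<epsilon>0 (\<gamma> (X n2 n12 n1)) = \<epsilon>0 (Y n2 n12 n1)"
      using gamma_large[OF n] False
      by (simp add: lin_map_diff[OF A_kspace kspace_ground eps0_lin] lin_map_smult[OF eps0_lin]
          minus_ground)
    then show ?thesis using n by (simp add: eps_X eps0_Y)
  qed
qed

lemma bilin_tens_lin:
  assumes "lin_map V V' f" shows "bilin V W (tensor V' W) (\<lambda>u v. tens V' W (f u) v)"
  using bilin_comp[OF bilin_tens assms lin_map_id lin_map_id] .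

text \<open>Colinearity of \<Phi>. On a word both sides are iterated quantum shuffles of the
  trilinear expression \<open>F\<close>, bracketed in the two possible ways.\<close>

lemma Delta_retr:
  assumes "e \<in> carrier A"
  shows "\<Delta> (retr e) = tsum (tensor B B) (\<lambda>u v. tens B B (retr u) v) (\<rho> e)"
proof (rule generated_lin_eqI[OF _ kspace_tensor genA _ _ _ assms])
  show "kalg A" ..
  note b = bilin_tens_lin[OF retr_lin, of B]
  show "lin_map A (tensor B B) (\<lambda>e. \<Delta> (retr e))"
    by (rule lin_map_comp[OF retr_lin D.rho_lin])
  show "lin_map A (tensor B B) (\<lambda>e. tsum (tensor B B) (\<lambda>u v. tens B B (retr u) v) (\<rho> e))"
    by (rule lin_map_comp[OF rho_lin lin_map_tsum[OF kspace_tensor b A_kspace B_kspace]])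
  fix w
  let ?x = "wmon B x" and ?y = "wmon A y"
  have retr_word: "retr (?y w) = qshuf B bm w (\<lambda>u v. \<epsilon>0 (?y u) \<odot>\<^bsub>B\<^esub> ?x v)" for w
    unfolding retr_def contract_def by (rule tsum_rho_wmon[OF B_kspace bilin_contract])
  define F where "F u1 u2 v = \<epsilon>0 (?y u1) \<odot>\<^bsub>tensor B B\<^esub> tens B B (?x u2) (?x v)" for u1 u2 v
  have "\<Delta> (retr (?y w)) = qshuf (tensor B B) bm w (\<lambda>u v. \<Delta> (\<epsilon>0 (?y u) \<odot>\<^bsub>B\<^esub> ?x v))"
    unfolding retr_word by (rule B.qshuf_lin[OF kspace_tensor D.rho_lin]) simp
  also have "\<dots> = qshuf (tensor B B) bm w (\<lambda>u v. qshuf (tensor B B) bm v (\<lambda>v1 v2. F u v1 v2))"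
  proof (rule qshuf_cong)
    fix u v
    show "\<Delta> (\<epsilon>0 (?y u) \<odot>\<^bsub>B\<^esub> ?x v) = qshuf (tensor B B) bm v (\<lambda>v1 v2. F u v1 v2)"
      by (simp add: lin_map_smult[OF D.rho_lin] D.rho_wmon F_def
          BB.qshuf_lin[OF kspace_tensor lin_map_scale[OF kspace_tensor lin_map_id]])
  qed
  also have "\<dots> = qshuf (tensor B B) bm w (\<lambda>u v. qshuf (tensor B B) bm u (\<lambda>u1 u2. F u1 u2 v))"
    by (rule BB.qshuf_coassoc[symmetric]) (simp add: F_def)
  also have "\<dots> = qshuf (tensor B B) bm w (\<lambda>u v. tens B B (retr (?y u)) (?x v))"
  proof (rule qshuf_cong)
    fix u v
    have L: "lin_map B (tensor B B) (\<lambda>a. tens B B a (?x v))" by (rule bilin_left[OF bilin_tens]) simp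
    show "qshuf (tensor B B) bm u (\<lambda>u1 u2. F u1 u2 v) = tens B B (retr (?y u)) (?x v)"
      unfolding retr_word
      by (subst B.qshuf_lin[OF kspace_tensor L]) (simp_all add: F_def lin_map_smult[OF L])
  qed
  also have "\<dots> = tsum (tensor B B) (\<lambda>u v. tens B B (retr u) v) (\<rho> (?y w))"
    by (rule tsum_rho_wmon[OF kspace_tensor b, symmetric])
  finally show "\<Delta> (retr (?y w)) = tsum (tensor B B) (\<lambda>u v. tens B B (retr u) v) (\<rho> (?y w))" .
qed

text \<open>Apply \<gamma> \<otimes> id to the colinearity of \<open>retr\<close> at
  \<open>\<gamma> c\<close>; as the two maps are mutually inverse, this is the colinearity of
  \<gamma>.\<close>

lemma gamma_colinear:
  assumes c: "c \<in> carrier B"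
  shows "\<rho> (\<gamma> c) = tsum T (\<lambda>u v. tens A B (\<gamma> u) v) (\<Delta> c)"
proof -
  note bg = bilin_tens_lin[OF gamma_lin, of B] and br = bilin_tens_lin[OF retr_lin, of B]
  note L = lin_map_tsum[OF kspace_tensor bg B_kspace B_kspace]
  have r: "\<rho> (\<gamma> c) \<in> carrier T" using c by (intro lin_map_closed[OF rho_lin]) simp
  have "tsum T (\<lambda>u v. tens A B (\<gamma> u) v) (\<Delta> c) =
      tsum T (\<lambda>u v. tens A B (\<gamma> u) v) (tsum (tensor B B) (\<lambda>u v. tens B B (retr u) v) (\<rho> (\<gamma> c)))"
    using Delta_retr[of "\<gamma> c"] c by (simp add: retr_gamma)
  also have "\<dots> = tsum T (\<lambda>u v. tsum T (\<lambda>u v. tens A B (\<gamma> u) v) (tens B B (retr u) v)) (\<rho> (\<gamma> c))"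
    by (rule tsum_comp[OF A_kspace B_kspace kspace_tensor kspace_tensor br L r])
  also have "\<dots> = tsum T (tens A B) (\<rho> (\<gamma> c))"
    by (rule tsum_cong[OF A_kspace B_kspace kspace_tensor bilin_comp[OF br lin_map_id lin_map_id L]
          bilin_tens _ r])
       (simp add: tsum_tens[OF kspace_tensor bg B_kspace B_kspace] lin_map_closed[OF retr_lin] gamma_retr)
  also have "\<dots> = \<rho> (\<gamma> c)" by (rule tsum_id[OF A_kspace B_kspace r])
  finally show ?thesis ..
qed

end

section \<open>The convolution algebra and the convolution inverse of \<gamma>\<close>

context cleft_section
begin

interpretation BB: kspace "tensor B B" ..

abbreviation conv where "conv \<equiv> convol \<Delta> A"

definition unit_map where "unit_map c = \<epsilon> c \<odot>\<^bsub>A\<^esub> \<one>\<^bsub>A\<^esub>"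

lemma unit_map_lin: "lin_map B A unit_map"
  unfolding unit_map_def
  by (intro lin_mapI)
     (simp_all add: lin_map_add[OF eps_lin] lin_map_smult[OF eps_lin] A.smult_l_distr A.smult_smult)

lemma bilin_conv: "lin_map B A f \<Longrightarrow> lin_map B A g \<Longrightarrow> bilin B B A (\<lambda>u v. f u \<otimes>\<^bsub>A\<^esub> g v)"
  using bilin_comp[OF A.bilin_mult _ _ lin_map_id] .

lemma conv_lin: "lin_map B A f \<Longrightarrow> lin_map B A g \<Longrightarrow> lin_map B A (conv f g)"
  unfolding convol_def
  by (rule lin_map_comp[OF D.rho_lin lin_map_tsum[OF A_kspace bilin_conv B_kspace B_kspace]])

lemma conv_word: "lin_map B A f \<Longrightarrow> lin_map B A g \<Longrightarrow>
    conv f g (wmon B x w) = qshuf A bm w (\<lambda>u v. f (wmon B x u) \<otimes>\<^bsub>A\<^esub> g (wmon B x v))"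
  unfolding convol_def by (rule D.tsum_rho_wmon[OF A_kspace bilin_conv])

lemma conv_cong:
  assumes "lin_map B A f" "lin_map B A g" "lin_map B A f'" "lin_map B A g'"
    "\<And>c. c \<in> carrier B \<Longrightarrow> f c = f' c" "\<And>c. c \<in> carrier B \<Longrightarrow> g c = g' c" "c \<in> carrier B"
  shows "conv f g c = conv f' g' c"
  unfolding convol_def
  by (rule tsum_cong[OF B_kspace B_kspace A_kspace bilin_conv bilin_conv])
     (use assms lin_map_closed[OF D.rho_lin] in auto)

lemma conv_plus_right:
  assumes "lin_map B A f" "lin_map B A g" "lin_map B A h" "c \<in> carrier B"
  shows "conv f (\<lambda>c. g c \<oplus>\<^bsub>A\<^esub> h c) c = conv f g c \<oplus>\<^bsub>A\<^esub> conv f h c"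
proof -
  have r: "\<Delta> c \<in> carrier (tensor B B)" by (rule lin_map_closed[OF D.rho_lin assms(4)])
  show ?thesis
    unfolding convol_def tsum_plus[OF B_kspace B_kspace A_kspace bilin_conv[OF assms(1,2)]
        bilin_conv[OF assms(1,3)] r, symmetric]
    by (rule tsum_cong[OF B_kspace B_kspace A_kspace bilin_conv[OF assms(1) lin_map_plus[OF A_kspace assms(2,3)]]
          bilin_plus[OF A_kspace bilin_conv[OF assms(1,2)] bilin_conv[OF assms(1,3)]] _ r])
       (use assms in \<open>auto simp: A.r_distr lin_map_closed\<close>)
qed

lemma conv_plus_left:
  assumes "lin_map B A f" "lin_map B A g" "lin_map B A h" "c \<in> carrier B"
  shows "conv (\<lambda>c. g c \<oplus>\<^bsub>A\<^esub> h c) f c = conv g f c \<oplus>\<^bsub>A\<^esub> conv h f c"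
proof -
  have r: "\<Delta> c \<in> carrier (tensor B B)" by (rule lin_map_closed[OF D.rho_lin assms(4)])
  show ?thesis
    unfolding convol_def tsum_plus[OF B_kspace B_kspace A_kspace bilin_conv[OF assms(2,1)]
        bilin_conv[OF assms(3,1)] r, symmetric]
    by (rule tsum_cong[OF B_kspace B_kspace A_kspace bilin_conv[OF lin_map_plus[OF A_kspace assms(2,3)] assms(1)]
          bilin_plus[OF A_kspace bilin_conv[OF assms(2,1)] bilin_conv[OF assms(3,1)]] _ r])
       (use assms in \<open>auto simp: A.l_distr lin_map_closed\<close>)
qed

lemma conv_unit_left:
  assumes f: "lin_map B A f" and c: "c \<in> carrier B"
  shows "conv unit_map f c = f c"
proof (rule generated_lin_eqI[OF _ A_kspace genB conv_lin[OF unit_map_lin f] f _ c])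
  show "kalg B" ..
  fix w
  show "conv unit_map f (wmon B x w) = f (wmon B x w)"
    unfolding conv_word[OF unit_map_lin f]
    by (subst A.qshuf_left_unit)
       (auto simp: unit_map_def eps_word lin_map_closed[OF f] A.smult_mult_left eps_one)
qed

lemma conv_unit_right:
  assumes f: "lin_map B A f" and c: "c \<in> carrier B"
  shows "conv f unit_map c = f c"
proof (rule generated_lin_eqI[OF _ A_kspace genB conv_lin[OF f unit_map_lin] f _ c])
  show "kalg B" ..
  fix w
  show "conv f unit_map (wmon B x w) = f (wmon B x w)"
    unfolding conv_word[OF f unit_map_lin]
    by (subst A.qshuf_right_unit)
       (auto simp: unit_map_def eps_word lin_map_closed[OF f] A.smult_mult_right eps_one)
qed

text \<open>On words both sides are iterated quantum shuffles of the same triple product, so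
  \<open>qshuf_coassoc\<close> applies.\<close>

lemma conv_assoc:
  assumes f: "lin_map B A f" and g: "lin_map B A g" and h: "lin_map B A h" and c: "c \<in> carrier B"
  shows "conv (conv f g) h c = conv f (conv g h) c"
proof (rule generated_lin_eqI[OF _ A_kspace genB conv_lin[OF conv_lin[OF f g] h]
      conv_lin[OF f conv_lin[OF g h]] _ c])
  show "kalg B" ..
  fix w
  let ?x = "wmon B x"
  have [simp]: "f (?x u) \<in> carrier A" "g (?x u) \<in> carrier A" "h (?x u) \<in> carrier A" for u
    using f g h by (simp_all add: lin_map_closed)
  define F where "F u v z = f (?x u) \<otimes>\<^bsub>A\<^esub> g (?x v) \<otimes>\<^bsub>A\<^esub> h (?x z)" for u v z
  have "conv (conv f g) h (?x w) = qshuf A bm w (\<lambda>u z. qshuf A bm u (\<lambda>u v. F u v z))"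
    unfolding conv_word[OF conv_lin[OF f g] h] conv_word[OF f g] F_def
    by (rule qshuf_cong) (subst A.qshuf_lin[OF A_kspace A.lin_map_mult_right], auto)
  also have "\<dots> = qshuf A bm w (\<lambda>u v. qshuf A bm v (\<lambda>v z. F u v z))"
    by (rule A.qshuf_coassoc) (simp add: F_def)
  also have "\<dots> = conv f (conv g h) (?x w)"
    unfolding conv_word[OF f conv_lin[OF g h]] conv_word[OF g h] F_def
    by (rule qshuf_cong) (subst A.qshuf_lin[OF A_kspace A.lin_map_mult_left], auto simp: A.m_assoc)
  finally show "conv (conv f g) h (?x w) = conv f (conv g h) (?x w)" .
qed

lemma gamma_one: "\<gamma> \<one>\<^bsub>B\<^esub> = \<one>\<^bsub>A\<^esub>"
  using gamma_small[of 0 0 0] A.N_pos by (simp add: A.Y_000 B.Y_000)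

text \<open>The convolution inverse is the Neumann series of \<open>\<gamma> = \<epsilon> - (\<epsilon> - \<gamma>)\<close>; it is finite because
  \<open>\<epsilon> - \<gamma>\<close> kills \<open>1\<close> and word length is additive under the coproduct.\<close>

definition dev where "dev c = unit_map c \<oplus>\<^bsub>A\<^esub> (- 1) \<odot>\<^bsub>A\<^esub> \<gamma> c"

primrec dev_pow where
  "dev_pow 0 = unit_map"
| "dev_pow (Suc n) = conv dev (dev_pow n)"

primrec neumann where
  "neumann 0 = unit_map"
| "neumann (Suc n) = (\<lambda>c. neumann n c \<oplus>\<^bsub>A\<^esub> dev_pow (Suc n) c)"

lemma dev_lin: "lin_map B A dev"
  unfolding dev_def
  by (rule lin_map_plus[OF A_kspace unit_map_lin lin_map_scale[OF A_kspace gamma_lin]])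

lemma dev_pow_lin: "lin_map B A (dev_pow n)"
  by (induction n) (simp_all add: unit_map_lin conv_lin dev_lin)

lemma neumann_lin: "lin_map B A (neumann n)"
proof (induction n)
  case (Suc n)
  then show ?case unfolding neumann.simps by (rule lin_map_plus[OF A_kspace _ dev_pow_lin])
qed (simp add: unit_map_lin)

lemma dev_pow_word: "length w < n \<Longrightarrow> dev_pow n (wmon B x w) = \<zero>\<^bsub>A\<^esub>"
proof (induction n arbitrary: w)
  case (Suc n)
  have "dev (wmon B x u) \<otimes>\<^bsub>A\<^esub> dev_pow n (wmon B x v) = \<zero>\<^bsub>A\<^esub>" if "mset u + mset v = mset w" for u v
  proof (cases u)
    case Nil
    have "dev \<one>\<^bsub>B\<^esub> = \<zero>\<^bsub>A\<^esub>"
      by (simp add: dev_def unit_map_def eps_one gamma_one A.smult_minus1 A.r_neg)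
    then show ?thesis using Nil lin_map_closed[OF dev_pow_lin] by simp
  next
    case (Cons i u')
    have "length u + length v = length w" using that by (metis size_mset size_union)
    then have "length v < n" using Suc.prems Cons by simp
    then show ?thesis using Suc.IH lin_map_closed[OF dev_lin] by simp
  qed
  then have "qshuf A bm w (\<lambda>u v. dev (wmon B x u) \<otimes>\<^bsub>A\<^esub> dev_pow n (wmon B x v)) =
      qshuf A bm w (\<lambda>u v. \<zero>\<^bsub>A\<^esub>)"
    by (rule qshuf_cong)
  then show ?case
    by (simp add: conv_word[OF dev_lin dev_pow_lin] A.qshuf_zero)
qed simp

text \<open>The exponent is uniform in \<open>c\<close> because words of length at most 4N span all
  of \<open>B\<close>.\<close>

lemma dev_pow_zero:
  assumes "c \<in> carrier B"
  shows "dev_pow (Suc (4 * N)) c = \<zero>\<^bsub>A\<^esub>"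
proof (rule lin_map_eq_on_vspan[OF B_kspace A_kspace dev_pow_lin])
  show "lin_map B A (\<lambda>_. \<zero>\<^bsub>A\<^esub>)" by (rule lin_mapI) auto
  show "c \<in> vspan B (wmon B x ` {w. length w \<le> 4 * N})"
    using assms B.carrier_word_filt by (auto simp: B.word_filt_def)
qed (auto simp: dev_pow_word simp del: dev_pow.simps)

text \<open>The powers are built by multiplication from the left; the right-hand version makes the
  series an inverse on both sides.\<close>

lemma dev_pow_right:
  assumes "c \<in> carrier B"
  shows "conv (dev_pow n) dev c = dev_pow (Suc n) c"
  using assms
proof (induction n arbitrary: c)
  case 0
  then show ?case by (simp add: conv_unit_left conv_unit_right dev_lin)
next
  case (Suc n)
  have "conv (dev_pow (Suc n)) dev c = conv dev (conv (dev_pow n) dev) c"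
    using Suc.prems by (simp add: conv_assoc dev_lin dev_pow_lin)
  also have "\<dots> = conv dev (dev_pow (Suc n)) c"
    by (rule conv_cong) (use Suc in \<open>simp_all add: conv_lin dev_lin dev_pow_lin\<close>)
  finally show ?case by simp
qed

lemma gamma_eq: "c \<in> carrier B \<Longrightarrow> \<gamma> c = unit_map c \<oplus>\<^bsub>A\<^esub> (- 1) \<odot>\<^bsub>A\<^esub> dev c"
  using lin_map_closed[OF unit_map_lin, of c]
  by (simp add: dev_def A.smult_r_distr A.smult_smult A.smult_minus1 A.a_assoc[symmetric] A.r_neg)

lemma conv_scale_left:
  assumes "lin_map B A f" "lin_map B A g" "c \<in> carrier B"
  shows "conv (\<lambda>c. s \<odot>\<^bsub>A\<^esub> f c) g c = s \<odot>\<^bsub>A\<^esub> conv f g c"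
proof -
  have r: "\<Delta> c \<in> carrier (tensor B B)" by (rule lin_map_closed[OF D.rho_lin assms(3)])
  show ?thesis
    unfolding convol_def tsum_scale[OF B_kspace B_kspace A_kspace bilin_conv[OF assms(1,2)] r, symmetric]
    by (rule tsum_cong[OF B_kspace B_kspace A_kspace bilin_conv[OF lin_map_scale[OF A_kspace assms(1)] assms(2)]
          bilin_scale[OF A_kspace bilin_conv[OF assms(1,2)]] _ r])
       (use assms in \<open>auto simp: A.smult_mult_left lin_map_closed\<close>)
qed

lemma conv_scale_right:
  assumes "lin_map B A f" "lin_map B A g" "c \<in> carrier B"
  shows "conv f (\<lambda>c. s \<odot>\<^bsub>A\<^esub> g c) c = s \<odot>\<^bsub>A\<^esub> conv f g c"
proof -
  have r: "\<Delta> c \<in> carrier (tensor B B)" by (rule lin_map_closed[OF D.rho_lin assms(3)])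
  show ?thesis
    unfolding convol_def tsum_scale[OF B_kspace B_kspace A_kspace bilin_conv[OF assms(1,2)] r, symmetric]
    by (rule tsum_cong[OF B_kspace B_kspace A_kspace bilin_conv[OF assms(1) lin_map_scale[OF A_kspace assms(2)]]
          bilin_scale[OF A_kspace bilin_conv[OF assms(1,2)]] _ r])
       (use assms in \<open>auto simp: A.smult_mult_right lin_map_closed\<close>)
qed

lemma conv_gamma_dev_pow:
  assumes c: "c \<in> carrier B"
  shows "conv \<gamma> (dev_pow n) c = dev_pow n c \<oplus>\<^bsub>A\<^esub> (- 1) \<odot>\<^bsub>A\<^esub> dev_pow (Suc n) c"
    and "conv (dev_pow n) \<gamma> c = dev_pow n c \<oplus>\<^bsub>A\<^esub> (- 1) \<odot>\<^bsub>A\<^esub> dev_pow (Suc n) c"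
proof -
  let ?g = "\<lambda>c. unit_map c \<oplus>\<^bsub>A\<^esub> (- 1) \<odot>\<^bsub>A\<^esub> dev c"
  note s = lin_map_scale[OF A_kspace dev_lin, of "- 1"]
  note g = lin_map_plus[OF A_kspace unit_map_lin s]
  have "conv \<gamma> (dev_pow n) c = conv ?g (dev_pow n) c"
    by (rule conv_cong[OF gamma_lin dev_pow_lin g dev_pow_lin gamma_eq refl c])
  then show "conv \<gamma> (dev_pow n) c = dev_pow n c \<oplus>\<^bsub>A\<^esub> (- 1) \<odot>\<^bsub>A\<^esub> dev_pow (Suc n) c"
    by (simp add: conv_plus_left[OF dev_pow_lin unit_map_lin s c] conv_unit_left[OF dev_pow_lin c]
        conv_scale_left[OF dev_lin dev_pow_lin c])
  have "conv (dev_pow n) \<gamma> c = conv (dev_pow n) ?g c"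
    by (rule conv_cong[OF dev_pow_lin gamma_lin dev_pow_lin g refl gamma_eq c])
  then show "conv (dev_pow n) \<gamma> c = dev_pow n c \<oplus>\<^bsub>A\<^esub> (- 1) \<odot>\<^bsub>A\<^esub> dev_pow (Suc n) c"
    by (simp add: conv_plus_right[OF dev_pow_lin unit_map_lin s c] conv_unit_right[OF dev_pow_lin c]
        conv_scale_right[OF dev_pow_lin dev_lin c] dev_pow_right[OF c] del: dev_pow.simps)
qed

lemma telescope: "a \<in> carrier A \<Longrightarrow> b \<in> carrier A \<Longrightarrow> c \<in> carrier A \<Longrightarrow>
    (a \<oplus>\<^bsub>A\<^esub> (- 1) \<odot>\<^bsub>A\<^esub> b) \<oplus>\<^bsub>A\<^esub> (b \<oplus>\<^bsub>A\<^esub> (- 1) \<odot>\<^bsub>A\<^esub> c) = a \<oplus>\<^bsub>A\<^esub> (- 1) \<odot>\<^bsub>A\<^esub> c"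
proof -
  assume *: "a \<in> carrier A" "b \<in> carrier A" "c \<in> carrier A"
  then have "(- 1) \<odot>\<^bsub>A\<^esub> b \<oplus>\<^bsub>A\<^esub> (b \<oplus>\<^bsub>A\<^esub> (- 1) \<odot>\<^bsub>A\<^esub> c) = (- 1) \<odot>\<^bsub>A\<^esub> c"
    by (simp add: A.a_assoc[symmetric] A.smult_minus1 A.l_neg)
  then show ?thesis using * by (simp add: A.a_assoc)
qed

text \<open>Adding the next power telescopes, so the error is always a single convolution power of
  \<open>dev\<close>.\<close>

lemma conv_gamma_neumann:
  assumes c: "c \<in> carrier B"
  shows "conv \<gamma> (neumann n) c = unit_map c \<oplus>\<^bsub>A\<^esub> (- 1) \<odot>\<^bsub>A\<^esub> dev_pow (Suc n) c"
    and "conv (neumann n) \<gamma> c = unit_map c \<oplus>\<^bsub>A\<^esub> (- 1) \<odot>\<^bsub>A\<^esub> dev_pow (Suc n) c"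
proof (induction n)
  case 0
  show "conv \<gamma> (neumann 0) c = unit_map c \<oplus>\<^bsub>A\<^esub> (- 1) \<odot>\<^bsub>A\<^esub> dev_pow (Suc 0) c"
    "conv (neumann 0) \<gamma> c = unit_map c \<oplus>\<^bsub>A\<^esub> (- 1) \<odot>\<^bsub>A\<^esub> dev_pow (Suc 0) c"
    using conv_gamma_dev_pow[OF c, of 0] by simp_all
next
  case (Suc n)
  note cl = lin_map_closed[OF unit_map_lin c] lin_map_closed[OF dev_pow_lin c]
  show "conv \<gamma> (neumann (Suc n)) c = unit_map c \<oplus>\<^bsub>A\<^esub> (- 1) \<odot>\<^bsub>A\<^esub> dev_pow (Suc (Suc n)) c"
    unfolding neumann.simps conv_plus_right[OF gamma_lin neumann_lin dev_pow_lin c] Suc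
      conv_gamma_dev_pow[OF c]
    by (rule telescope) (rule cl)+
  show "conv (neumann (Suc n)) \<gamma> c = unit_map c \<oplus>\<^bsub>A\<^esub> (- 1) \<odot>\<^bsub>A\<^esub> dev_pow (Suc (Suc n)) c"
    unfolding neumann.simps conv_plus_left[OF gamma_lin neumann_lin dev_pow_lin c] Suc
      conv_gamma_dev_pow[OF c]
    by (rule telescope) (rule cl)+
qed

lemma gamma_convol_invertible: "convol_invertible B \<Delta> \<epsilon> A \<gamma>"
  unfolding convol_invertible_def
proof (intro exI conjI ballI)
  show "lin_map B A (neumann (4 * N))" by (rule neumann_lin)
  fix c assume c: "c \<in> carrier B"
  show "conv \<gamma> (neumann (4 * N)) c = \<epsilon> c \<odot>\<^bsub>A\<^esub> \<one>\<^bsub>A\<^esub>" "conv (neumann (4 * N)) \<gamma> c = \<epsilon> c \<odot>\<^bsub>A\<^esub> \<one>\<^bsub>A\<^esub>"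
    unfolding conv_gamma_neumann[OF c] dev_pow_zero[OF c] by (simp_all add: unit_map_def)
qed

end

section \<open>Algebras presented by generators and relations\<close>

lemma free_ring_simps [simp]:
  "carrier free_ring = UNIV" "monoid.mult free_ring = (*)" "one free_ring = 1" "zero free_ring = 0"
  "add free_ring = (+)"
  by (simp_all add: free_ring_def)

lemma ring_free_ring: "ring (free_ring :: 'k::field free_alg ring)"
proof (rule ringI)
  show "abelian_group (free_ring :: 'k free_alg ring)"
  proof (rule abelian_groupI)
    fix x :: "'k free_alg"
    show "\<exists>y\<in>carrier free_ring. y \<oplus>\<^bsub>free_ring\<^esub> x = \<zero>\<^bsub>free_ring\<^esub>"
      by (auto intro: exI[of _ "- x"])
  qed (auto simp: add_ac)
  show "Group.monoid (free_ring :: 'k free_alg ring)"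
    by (rule monoidI) (auto simp: mult.assoc)
qed (auto simp: algebra_simps)

lemma minus_free_ring: "a \<ominus>\<^bsub>free_ring\<^esub> b = a - (b :: 'k::field free_alg)"
proof -
  interpret ring "free_ring :: 'k free_alg ring" by (rule ring_free_ring)
  have "\<ominus>\<^bsub>free_ring\<^esub> b = - b" by (rule minus_equality) auto
  then show ?thesis by (simp add: a_minus_def)
qed

lemma scal_mult: "scal (a * b) = scal a * scal b" "scal 1 = 1" "scal (a + b) = scal a + scal b" "scal 0 = 0"
  by (simp_all add: scal_def mult_single single_add)

lemma scal_commute: "scal c * p = p * scal (c :: 'k::field)"
proof (induction p rule: update_induct)
  case const
  then show ?case by simp
next
  case (update f a b)
  have eq: "Poly_Mapping.update a b f = f + Poly_Mapping.single a b"
    using update(1)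
    by (intro poly_mapping_eqI)
       (auto simp: lookup_update lookup_add lookup_single when_def in_keys_iff)
  show ?case unfolding eq using update(3)
    by (simp add: distrib_left distrib_right scal_def mult_single mult.commute)
qed

lemma scal_left_commute: "p * (scal c * r) = scal c * (p * r)"
  by (metis mult.assoc scal_commute)

context
  fixes R :: "'k::field free_alg set"
begin

interpretation F: ring "free_ring :: 'k free_alg ring" by (rule ring_free_ring)

interpretation I: ideal "genideal free_ring R" free_ring
  by (rule F.genideal_ideal) simp

abbreviation (input) pcls :: "'k free_alg \<Rightarrow> 'k free_alg set" where
  "pcls p \<equiv> genideal free_ring R +>\<^bsub>free_ring\<^esub> p"

abbreviation (input) palg where "palg \<equiv> presented_alg R"

lemma pcls_eq_iff: "pcls p = pcls r \<longleftrightarrow> p - r \<in> genideal free_ring R"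
  using F.quotient_eq_iff_same_a_r_cos[OF I.is_ideal, of p r] by (simp add: minus_free_ring)

lemma palg_simps:
  "carrier palg = carrier (free_ring Quot genideal free_ring R)"
  "monoid.mult palg = monoid.mult (free_ring Quot genideal free_ring R)"
  "one palg = one (free_ring Quot genideal free_ring R)"
  "zero palg = zero (free_ring Quot genideal free_ring R)"
  "add palg = add (free_ring Quot genideal free_ring R)"
  "module.smult palg = (\<lambda>c X. \<Union>p\<in>X. pcls (scal c * p))"
  by (simp_all add: presented_alg_def Let_def ring.extend_def module.fields_def)

lemma palg_carrier: "carrier palg = range pcls"
  by (auto simp: palg_simps FactRing_def A_RCOSETS_def' a_r_coset_def)

lemma pcls_ops:
  "pcls p \<otimes>\<^bsub>palg\<^esub> pcls r = pcls (p * r)"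
  "pcls p \<oplus>\<^bsub>palg\<^esub> pcls r = pcls (p + r)"
  "\<one>\<^bsub>palg\<^esub> = pcls 1" "\<zero>\<^bsub>palg\<^esub> = pcls 0"
proof -
  note h = I.rcos_ring_hom
  show "pcls p \<otimes>\<^bsub>palg\<^esub> pcls r = pcls (p * r)" "pcls p \<oplus>\<^bsub>palg\<^esub> pcls r = pcls (p + r)"
    "\<one>\<^bsub>palg\<^esub> = pcls 1"
    using ring_hom_mult[OF h, of p r] ring_hom_add[OF h, of p r] ring_hom_one[OF h]
    by (simp_all add: palg_simps)
  interpret h: ring_hom_ring free_ring "free_ring Quot genideal free_ring R" pcls
    by (rule I.rcos_ring_hom_ring)
  show "\<zero>\<^bsub>palg\<^esub> = pcls 0" using h.hom_zero by (simp add: palg_simps)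
qed

text \<open>Representatives differ by ideal elements and the ideal absorbs \<open>scal c\<close>, so
  all cosets in the union coincide.\<close>

lemma pcls_smult: "c \<odot>\<^bsub>palg\<^esub> pcls p = pcls (scal c * p)"
proof -
  have "pcls (scal c * r) = pcls (scal c * p)" if r: "r \<in> pcls p" for r
  proof -
    obtain i where i: "i \<in> genideal free_ring R" "r = i + p"
      using r by (auto simp: a_r_coset_def')
    then show ?thesis
      using I.I_l_closed[OF i(1), of "scal c"] by (simp add: pcls_eq_iff distrib_left)
  qed
  then have "(\<Union>r\<in>pcls p. pcls (scal c * r)) = (\<Union>r\<in>pcls p. pcls (scal c * p))"
    by (intro SUP_cong refl)
  moreover have "pcls p \<noteq> {}"
    using I.zero_closed by (force simp: a_r_coset_def')
  ultimately show ?thesis by (simp add: palg_simps)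
qed

lemma palg_kalg: "kalg palg"
proof -
  have "ring palg"
  proof (rule ringI)
    show "abelian_group palg"
    proof (rule abelian_groupI)
      fix X assume "X \<in> carrier palg"
      then obtain p where "X = pcls p" by (auto simp: palg_carrier)
      then show "\<exists>Y\<in>carrier palg. Y \<oplus>\<^bsub>palg\<^esub> X = \<zero>\<^bsub>palg\<^esub>"
        by (intro bexI[of _ "pcls (- p)"]) (auto simp: pcls_ops palg_carrier)
    qed (auto simp: palg_carrier pcls_ops add_ac)
    show "Group.monoid palg"
      by (rule monoidI) (auto simp: palg_carrier pcls_ops mult.assoc)
  qed (auto simp: palg_carrier pcls_ops distrib_left distrib_right)
  then interpret ring palg .
  show ?thesis
  proof
    fix a b v w and c assume vw: "v \<in> carrier palg" "w \<in> carrier palg"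
    then obtain p r where [simp]: "v = pcls p" "w = pcls r" by (auto simp: palg_carrier)
    show "c \<odot>\<^bsub>palg\<^esub> v \<in> carrier palg"
      "(a + b) \<odot>\<^bsub>palg\<^esub> v = a \<odot>\<^bsub>palg\<^esub> v \<oplus>\<^bsub>palg\<^esub> b \<odot>\<^bsub>palg\<^esub> v"
      "c \<odot>\<^bsub>palg\<^esub> (v \<oplus>\<^bsub>palg\<^esub> w) = c \<odot>\<^bsub>palg\<^esub> v \<oplus>\<^bsub>palg\<^esub> c \<odot>\<^bsub>palg\<^esub> w"
      "a \<odot>\<^bsub>palg\<^esub> (b \<odot>\<^bsub>palg\<^esub> v) = (a * b) \<odot>\<^bsub>palg\<^esub> v" "1 \<odot>\<^bsub>palg\<^esub> v = v"
      "(c \<odot>\<^bsub>palg\<^esub> v) \<otimes>\<^bsub>palg\<^esub> w = c \<odot>\<^bsub>palg\<^esub> (v \<otimes>\<^bsub>palg\<^esub> w)"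
      by (simp_all add: pcls_ops pcls_smult palg_carrier scal_mult distrib_left distrib_right
          mult.assoc)
    show "v \<otimes>\<^bsub>palg\<^esub> (c \<odot>\<^bsub>palg\<^esub> w) = c \<odot>\<^bsub>palg\<^esub> (v \<otimes>\<^bsub>palg\<^esub> w)"
      by (simp add: pcls_ops pcls_smult scal_left_commute[of p])
  qed
qed

interpretation palg: kalg palg by (rule palg_kalg)

lemma pcls_diff: "pcls p \<ominus>\<^bsub>palg\<^esub> pcls r = pcls (p - r)"
proof -
  have "scal (- 1) + 1 = (0 :: 'k free_alg)"
    using scal_mult(3)[of "- 1" "1 :: 'k"] by (simp add: scal_mult)
  then have "scal (- 1) * r + r = 0" by (metis distrib_right mult_1 mult_zero_left)
  then have "scal (- 1) * r = - r" by (simp add: eq_neg_iff_add_eq_0)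
  then show ?thesis by (simp add: palg.minus_eq_smult palg_carrier pcls_smult pcls_ops)
qed

lemma pcls_pow: "pcls p [^]\<^bsub>palg\<^esub> (n :: nat) = pcls (p ^ n)"
  by (induction n) (simp_all add: pcls_ops power_Suc2 del: power_Suc)

lemma pcls_rel: "p - r \<in> R \<Longrightarrow> pcls p = pcls r"
  using F.genideal_self[of R] by (auto simp: pcls_eq_iff)

text \<open>A monomial of the free algebra maps to the corresponding word in the generators, so any
  representative displays its class as a combination of words.\<close>

lemma palg_generated: "generated_by palg (presented_gen R)"
proof -
  have w: "wmon palg (presented_gen R) w = pcls (Poly_Mapping.single (Word w) 1)" for w
  proof (induction w)
    case Nil
    show ?case by (simp add: pcls_ops flip: zero_free_word_def)
  qed (simp add: presented_gen_def pcls_ops var_def mult_single)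
  have g: "presented_gen R i \<in> carrier palg" for i
    by (simp add: presented_gen_def palg_carrier)
  let ?S = "vspan palg (range (wmon palg (presented_gen R)))"
  have S: "subsp palg ?S"
    by (rule subsp_vspan) (auto simp: palg.kspace_axioms g intro!: palg.wmon_closed)
  have "pcls p \<in> ?S" for p
  proof (induction p rule: update_induct)
    case const
    then show ?case using subsp_zero[OF S] by (simp add: pcls_ops)
  next
    case (update f a b)
    note eq = update_eq_plus_single[OF update(1), of b]
    obtain w where a: "a = Word w" by (cases a)
    have "pcls (Poly_Mapping.update a b f) =
        pcls f \<oplus>\<^bsub>palg\<^esub> b \<odot>\<^bsub>palg\<^esub> wmon palg (presented_gen R) w"
      by (simp add: eq[unfolded a] w pcls_ops pcls_smult scal_def mult_single a)
    also have "\<dots> \<in> ?S"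
      using update(3) by (intro subsp_add[OF S] subsp_smult[OF S]) (auto intro: vspan_base)
    finally show ?case .
  qed
  then show ?thesis using g by (auto simp: generated_by_def palg_carrier)
qed

end

lemma pbw_alg_presented:
  assumes "N > 0"
  shows "pbw_alg (presented_alg (cleft_rels N q q12 (l1, l2, l12, 0, 0)))
    (presented_gen (cleft_rels N q q12 (l1, l2, l12, 0, 0))) N q q12 l1 l2 l12"
proof -
  let ?R = "cleft_rels N q q12 (l1, l2, l12, 0, 0)"
  interpret kalg "presented_alg ?R" by (rule palg_kalg)
  note ops = presented_gen_def pcls_ops pcls_smult pcls_diff pcls_pow
  have 12: "presented_gen ?R G1 \<otimes>\<^bsub>presented_alg ?R\<^esub> presented_gen ?R G2
      \<ominus>\<^bsub>presented_alg ?R\<^esub> q12 \<odot>\<^bsub>presented_alg ?R\<^esub> (presented_gen ?R G2 \<otimes>\<^bsub>presented_alg ?R\<^esub> presented_gen ?R G1)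
      = pcls ?R (var12 q12)"
    by (simp only: ops var12_def mult.assoc)
  show ?thesis
    by unfold_locales
       (simp_all only: assms palg_generated 12, simp_all only: ops mult_1_right mult_1_left,
        auto intro!: pcls_rel simp: var112_def var122_def scal_mult mult.assoc)
qed

lemma nichols_rels_eq: "nichols_rels N q q12 = cleft_rels N q q12 (0, 0, 0, 0, 0)"
  by (simp add: nichols_rels_def scal_mult)

section \<open>The coaction on products with a generator\<close>

text \<open>The algebra structures on a tensor product change only product and unit of the record,
  so linearity can be read in the underlying space.\<close>

lemma lin_map_mod_mult_one [simp]:
  "lin_map V (W\<lparr>monoid.mult := m, one := e\<rparr>) f \<longleftrightarrow> lin_map V W f"
  by (simp add: lin_map_def)

context
  fixes H :: "('k::field, 'h, 'm) hopf_scheme"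
  assumes H: "hopf_algebra H"
begin

lemma H_kalg: "kalg H"
  using H by (simp add: hopf_algebra_def kalg_iff)

interpretation H: kalg H by (rule H_kalg)

lemma H_kspace: "kspace H" ..

lemma comult_lin: "lin_map H (tensor H H) (comult H)"
  using H by (simp add: hopf_algebra_def alg_map_def tensor_alg_def)

lemma counit_lin: "lin_map H ground (counit H)"
  using H by (simp add: hopf_algebra_def alg_map_def)

text \<open>Multiplicativity of \<rho> is evaluated with left factor \<rho>(y_i), where the general
  braided product reduces to two explicit terms. It is applied both to the cleft object and to the
  coproduct of the Nichols algebra.\<close>

lemma diag_comodI:
  fixes A :: "('k, 'a, 'n) module_scheme" and B :: "('k, 'b, 'p) module_scheme"
  assumes A: "kalg A" and B: "kalg B" and genA: "generated_by A y" and genB: "generated_by B x"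
    and yd: "\<And>i. yd_pair H (g i) (\<chi> i)"
    and ma: "module_algebra H A act"
    and act_gen: "\<And>h i. h \<in> carrier H \<Longrightarrow> act h (y i) = \<chi> i h \<odot>\<^bsub>A\<^esub> y i"
    and coact: "alg_map B (tensor_alg H B) coact" "\<And>i. coact (x i) = tens H B (g i) (x i)"
    and rho: "alg_map A (braided_tensor_alg act coact A B) \<rho>"
    and rho_y: "\<And>i. \<rho> (y i) = tens A B (y i) \<one>\<^bsub>B\<^esub> \<oplus>\<^bsub>tensor A B\<^esub> tens A B \<one>\<^bsub>A\<^esub> (x i)"
  shows "diag_comod A B y x (\<lambda>i j. \<chi> j (g i)) (\<lambda>i. act (g i)) \<rho>"
proof -
  interpret A: kalg A by fact
  interpret B: kalg B by fact
  let ?T = "tensor A B"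
  interpret T: kspace ?T ..
  have yc [simp]: "y i \<in> carrier A" and xc [simp]: "x i \<in> carrier B" for i
    using genA genB by (simp_all add: generated_by_def)
  have g [simp]: "g i \<in> carrier H" and gl: "comult H (g i) = tens H H (g i) (g i)" "counit H (g i) = 1" for i
    using yd[of i] by (simp_all add: yd_pair_def group_like_def)
  have act_lin: "lin_map A A (act h)" if "h \<in> carrier H" for h
    using ma that by (simp add: module_algebra_def)
  have act_lin': "lin_map H A (\<lambda>h. act h a)" if "a \<in> carrier A" for a
    using ma that by (simp add: module_algebra_def)
  have act_one: "act \<one>\<^bsub>H\<^esub> a = a" if "a \<in> carrier A" for a
    using ma that by (simp add: module_algebra_def)
  have act_closed [simp]: "act h a \<in> carrier A" if "h \<in> carrier H" "a \<in> carrier A" for h a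
    using lin_map_closed[OF act_lin] that .
  have act_mult: "act h (a \<otimes>\<^bsub>A\<^esub> a') = tsum A (\<lambda>h1 h2. act h1 a \<otimes>\<^bsub>A\<^esub> act h2 a') (comult H h)"
    if "h \<in> carrier H" "a \<in> carrier A" "a' \<in> carrier A" for h a a'
    using ma that by (simp add: module_algebra_def)
  have act_unit: "act h \<one>\<^bsub>A\<^esub> = counit H h \<odot>\<^bsub>A\<^esub> \<one>\<^bsub>A\<^esub>" if "h \<in> carrier H" for h
    using ma that by (simp add: module_algebra_def)
  have coact_lin: "lin_map B (tensor H B) coact" and coact_one: "coact \<one>\<^bsub>B\<^esub> = tens H B \<one>\<^bsub>H\<^esub> \<one>\<^bsub>B\<^esub>"
    using coact(1) ring_hom_one[of coact B "tensor_alg H B"] by (simp_all add: alg_map_def tensor_alg_def)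
  have rho_lin: "lin_map A ?T \<rho>"
    using rho by (simp add: alg_map_def braided_tensor_alg_def)
  \<comment> \<open>The braided product of a \<otimes> b and a' \<otimes> b'. Linearity in each of
    the four arguments is what allows the nested sums to be evaluated.\<close>
  define K where "K a b a' b' = tsum ?T (\<lambda>h b0. tens A B (a \<otimes>\<^bsub>A\<^esub> act h a') (b0 \<otimes>\<^bsub>B\<^esub> b')) (coact b)" for a b a' b'
  have hom: "\<rho> \<in> ring_hom A (braided_tensor_alg act coact A B)" using rho by (simp add: alg_map_def)
  have rho_mult: "\<rho> (a \<otimes>\<^bsub>A\<^esub> e) = tsum ?T (\<lambda>a b. tsum ?T (K a b) (\<rho> e)) (\<rho> a)"
    if "a \<in> carrier A" "e \<in> carrier A" for a e
    using ring_hom_mult[OF hom that] by (simp add: braided_tensor_alg_def K_def[abs_def])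
  have base: "bilin H B ?T (\<lambda>h b0. tens A B (a \<otimes>\<^bsub>A\<^esub> act h a') (b0 \<otimes>\<^bsub>B\<^esub> b'))"
    if "a \<in> carrier A" "a' \<in> carrier A" "b' \<in> carrier B" for a a' b'
    using bilin_comp[OF bilin_tens lin_map_comp[OF act_lin'[OF that(2)] A.lin_map_mult_left[OF that(1)]]
        B.lin_map_mult_right[OF that(3)] lin_map_id] .
  have coact_closed: "coact b \<in> carrier (tensor H B)" if "b \<in> carrier B" for b
    using lin_map_closed[OF coact_lin that] .
  have K_b: "lin_map B ?T (\<lambda>b. K a b a' b')" if "a \<in> carrier A" "a' \<in> carrier A" "b' \<in> carrier B" for a a' b'
    unfolding K_def
    by (rule lin_map_comp[OF coact_lin lin_map_tsum[OF kspace_tensor base[OF that] H_kspace B.kspace_axioms]])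
  note param = lin_map_tsum_param[OF H_kspace B.kspace_axioms kspace_tensor]
  have tl: "lin_map A ?T (\<lambda>a. tens A B a c)" if "c \<in> carrier B" for c
    by (rule bilin_left[OF bilin_tens that])
  have tr: "lin_map B ?T (tens A B a)" if "a \<in> carrier A" for a
    by (rule bilin_right[OF bilin_tens that])
  have K_a: "lin_map A ?T (\<lambda>a. K a b a' b')" if "b \<in> carrier B" "a' \<in> carrier A" "b' \<in> carrier B" for b a' b'
    unfolding K_def
  proof (rule param)
    fix h b0 assume "h \<in> carrier H" "b0 \<in> carrier B"
    then show "lin_map A ?T (\<lambda>a. tens A B (a \<otimes>\<^bsub>A\<^esub> act h a') (b0 \<otimes>\<^bsub>B\<^esub> b'))"
      using that by (intro lin_map_comp[OF A.lin_map_mult_right tl]) auto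
  qed (use that base coact_closed A.kspace_axioms in auto)
  have K_a': "lin_map A ?T (\<lambda>a'. K a b a' b')" if "b \<in> carrier B" "a \<in> carrier A" "b' \<in> carrier B" for b a b'
    unfolding K_def
  proof (rule param)
    fix h b0 assume "h \<in> carrier H" "b0 \<in> carrier B"
    then show "lin_map A ?T (\<lambda>a'. tens A B (a \<otimes>\<^bsub>A\<^esub> act h a') (b0 \<otimes>\<^bsub>B\<^esub> b'))"
      using that by (intro lin_map_comp[OF lin_map_comp[OF act_lin A.lin_map_mult_left] tl]) auto
  qed (use that base coact_closed A.kspace_axioms in auto)
  have K_b': "lin_map B ?T (\<lambda>b'. K a b a' b')" if "b \<in> carrier B" "a \<in> carrier A" "a' \<in> carrier A" for b a a'
    unfolding K_def
  proof (rule param)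
    fix h b0 assume "h \<in> carrier H" "b0 \<in> carrier B"
    then show "lin_map B ?T (\<lambda>b'. tens A B (a \<otimes>\<^bsub>A\<^esub> act h a') (b0 \<otimes>\<^bsub>B\<^esub> b'))"
      using that by (intro lin_map_comp[OF B.lin_map_mult_left tr]) auto
  qed (use that base coact_closed B.kspace_axioms in auto)
  have K_inner: "bilin A B ?T (K a b)" if "a \<in> carrier A" "b \<in> carrier B" for a b
    using K_a' K_b' that by (intro bilinI) auto
  note param2 = lin_map_tsum_param[OF A.kspace_axioms B.kspace_axioms kspace_tensor]
  have K_outer: "bilin A B ?T (\<lambda>a b. tsum ?T (K a b) t)" if "t \<in> carrier ?T" for t
  proof (rule bilinI)
    fix a assume "a \<in> carrier A"
    then show "lin_map B ?T (\<lambda>b. tsum ?T (K a b) t)"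
      using that K_inner K_b by (intro param2) (auto simp: B.kspace_axioms)
  next
    fix b assume "b \<in> carrier B"
    then show "lin_map A ?T (\<lambda>a. tsum ?T (K a b) t)"
      using that K_inner K_a by (intro param2) (auto simp: A.kspace_axioms)
  qed
  \<comment> \<open>The coaction of 1 is trivial, so y_i \<otimes> 1 multiplies without braiding; 1
    \<otimes> x_i brings in the action of g_i.\<close>
  have K_y: "K (y i) \<one>\<^bsub>B\<^esub> a' b' = tens A B (y i \<otimes>\<^bsub>A\<^esub> a') b'" if "a' \<in> carrier A" "b' \<in> carrier B" for i a' b'
    unfolding K_def coact_one using that
    by (subst tsum_tens[OF kspace_tensor base H_kspace B.kspace_axioms]) (auto simp: act_one)
  have K_x: "K \<one>\<^bsub>A\<^esub> (x i) a' b' = tens A B (act (g i) a') (x i \<otimes>\<^bsub>B\<^esub> b')"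
    if "a' \<in> carrier A" "b' \<in> carrier B" for i a' b'
    unfolding K_def coact(2) using that
    by (subst tsum_tens[OF kspace_tensor base H_kspace B.kspace_axioms]) auto
  show ?thesis
  proof (unfold_locales)
    show "generated_by A y" "generated_by B x" by fact+
    show "lin_map A A (act (g i))" for i by (rule act_lin) simp
    show "act (g i) \<one>\<^bsub>A\<^esub> = \<one>\<^bsub>A\<^esub>" for i by (simp add: act_unit gl)
    show "act (g i) (y j \<otimes>\<^bsub>A\<^esub> a) = \<chi> j (g i) \<odot>\<^bsub>A\<^esub> (y j \<otimes>\<^bsub>A\<^esub> act (g i) a)"
      if a: "a \<in> carrier A" for a i j
    proof -
      have "bilin H H A (\<lambda>h1 h2. act h1 (y j) \<otimes>\<^bsub>A\<^esub> act h2 a)"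
        using bilin_comp[OF A.bilin_mult act_lin'[OF yc] act_lin'[OF a] lin_map_id] .
      then show ?thesis
        using a by (simp add: act_mult gl tsum_tens[OF A.kspace_axioms _ H_kspace H_kspace] act_gen
            A.smult_mult_left)
    qed
    show "lin_map A ?T \<rho>" by fact
    show "\<rho> \<one>\<^bsub>A\<^esub> = tens A B \<one>\<^bsub>A\<^esub> \<one>\<^bsub>B\<^esub>"
      using ring_hom_one[OF hom] by (simp add: braided_tensor_alg_def)
    fix e i assume e: "e \<in> carrier A"
    have re: "\<rho> e \<in> carrier ?T" by (rule lin_map_closed[OF rho_lin e])
    note L = lin_map_tsum[OF kspace_tensor K_outer[OF re] A.kspace_axioms B.kspace_axioms]
    have "\<rho> (y i \<otimes>\<^bsub>A\<^esub> e) = tsum ?T (K (y i) \<one>\<^bsub>B\<^esub>) (\<rho> e) \<oplus>\<^bsub>?T\<^esub> tsum ?T (K \<one>\<^bsub>A\<^esub> (x i)) (\<rho> e)"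
      using e by (simp add: rho_mult rho_y lin_map_add[OF L]
          tsum_tens[OF kspace_tensor K_outer[OF re] A.kspace_axioms B.kspace_axioms])
    also have "\<dots> = tsum ?T (\<lambda>a c. K (y i) \<one>\<^bsub>B\<^esub> a c \<oplus>\<^bsub>?T\<^esub> K \<one>\<^bsub>A\<^esub> (x i) a c) (\<rho> e)"
      by (rule tsum_plus[OF A.kspace_axioms B.kspace_axioms kspace_tensor K_inner K_inner re, symmetric]) auto
    also have "\<dots> = tsum ?T (\<lambda>a c. tens A B (y i \<otimes>\<^bsub>A\<^esub> a) c \<oplus>\<^bsub>?T\<^esub> tens A B (act (g i) a) (x i \<otimes>\<^bsub>B\<^esub> c)) (\<rho> e)"
    proof (rule tsum_cong[OF A.kspace_axioms B.kspace_axioms kspace_tensor _ _ _ re])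
      show "bilin A B ?T (\<lambda>a c. K (y i) \<one>\<^bsub>B\<^esub> a c \<oplus>\<^bsub>?T\<^esub> K \<one>\<^bsub>A\<^esub> (x i) a c)"
        by (rule bilin_plus[OF kspace_tensor K_inner K_inner]) auto
      show "bilin A B ?T (\<lambda>a c. tens A B (y i \<otimes>\<^bsub>A\<^esub> a) c \<oplus>\<^bsub>?T\<^esub> tens A B (act (g i) a) (x i \<otimes>\<^bsub>B\<^esub> c))"
        by (intro bilin_plus[OF kspace_tensor] bilin_comp[OF bilin_tens _ _ lin_map_id] lin_map_id
            A.lin_map_mult_left B.lin_map_mult_left act_lin yc xc g)
    qed (simp add: K_y K_x)
    finally show "\<rho> (y i \<otimes>\<^bsub>A\<^esub> e) =
        tsum ?T (\<lambda>a c. tens A B (y i \<otimes>\<^bsub>A\<^esub> a) c \<oplus>\<^bsub>?T\<^esub> tens A B (act (g i) a) (x i \<otimes>\<^bsub>B\<^esub> c)) (\<rho> e)" .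
  qed
qed

section \<open>Characters and weights\<close>

abbreviation lin_fun where "lin_fun f \<equiv> lin_map H ground f"

lemma ground_kspace: "kspace (ground :: ('k, 'k) module)" ..

lemma bilin_fun: "lin_fun f \<Longrightarrow> lin_fun f' \<Longrightarrow> bilin H H ground (\<lambda>u v. f u * f' v)"
  using bilin_smult_fun[OF ground_kspace, of H f H f'] by simp

lemma char_mult_def': "char_mult H f f' h = tsum ground (\<lambda>u v. f u * f' v) (comult H h)"
  by (simp add: convol_def)

lemma char_mult_lin: "lin_fun f \<Longrightarrow> lin_fun f' \<Longrightarrow> lin_fun (char_mult H f f')"
  unfolding char_mult_def'
  by (rule lin_map_comp[OF comult_lin lin_map_tsum[OF ground_kspace bilin_fun H_kspace H_kspace]])

lemma comult_closed: "h \<in> carrier H \<Longrightarrow> comult H h \<in> carrier (tensor H H)"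
  by (rule lin_map_closed[OF comult_lin])

lemma char_mult_cong:
  assumes "lin_fun f" "lin_fun f'" "lin_fun k" "lin_fun k'"
    "\<And>h. h \<in> carrier H \<Longrightarrow> f h = k h" "\<And>h. h \<in> carrier H \<Longrightarrow> f' h = k' h" "h \<in> carrier H"
  shows "char_mult H f f' h = char_mult H k k' h"
  unfolding char_mult_def'
  by (rule tsum_cong[OF H_kspace H_kspace ground_kspace bilin_fun[OF assms(1,2)] bilin_fun[OF assms(3,4)]])
     (use assms comult_closed in auto)

text \<open>Evaluate f \<otimes> f' \<otimes> k on both sides of the coassociativity axiom.\<close>

lemma char_mult_assoc:
  assumes f: "lin_fun f" and f': "lin_fun f'" and k: "lin_fun k" and h: "h \<in> carrier H"
  shows "char_mult H (char_mult H f f') k h = char_mult H f (char_mult H f' k) h"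
proof -
  let ?T = "tensor H (tensor H H)"
  define P where "P = tsum ground (\<lambda>u v. f' u * k v)"
  have P: "lin_map (tensor H H) ground P"
    unfolding P_def by (rule lin_map_tsum[OF ground_kspace bilin_fun[OF f' k] H_kspace H_kspace])
  have P_tens: "P (tens H H u v) = f' u * k v" if "u \<in> carrier H" "v \<in> carrier H" for u v
    unfolding P_def by (rule tsum_tens[OF ground_kspace bilin_fun[OF f' k] H_kspace H_kspace that])
  have Qb: "bilin H (tensor H H) ground (\<lambda>a t. f a * P t)"
    using bilin_smult_fun[OF ground_kspace f P] by simp
  \<comment> \<open>With \<open>P\<close> as f' \<otimes> k, this is f \<otimes> f' \<otimes> k on
    the right-bracketed triple tensor product.\<close>
  define Q where "Q = tsum ground (\<lambda>a t. f a * P t)"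
  have Q: "lin_map ?T ground Q"
    unfolding Q_def by (rule lin_map_tsum[OF ground_kspace Qb H_kspace kspace_tensor])
  have Q_tens: "Q (tens H (tensor H H) a t) = f a * P t" if "a \<in> carrier H" "t \<in> carrier (tensor H H)" for a t
    unfolding Q_def by (rule tsum_tens[OF ground_kspace Qb H_kspace kspace_tensor that])
  have b1: "bilin H H ?T (\<lambda>a1 a2. tens H (tensor H H) a1 (tens H H a2 c))" if "c \<in> carrier H" for c
    by (rule bilin_comp[OF bilin_tens lin_map_id bilin_left[OF bilin_tens that] lin_map_id])
  define J where "J a c = tsum ?T (\<lambda>a1 a2. tens H (tensor H H) a1 (tens H H a2 c)) (comult H a)" for a c
  have J: "bilin H H ?T J"
  proof (rule bilinI)
    fix c assume c: "c \<in> carrier H"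
    show "lin_map H ?T (\<lambda>a. J a c)" unfolding J_def
      by (rule lin_map_comp[OF comult_lin lin_map_tsum[OF kspace_tensor b1[OF c] H_kspace H_kspace]])
  next
    fix a assume a: "a \<in> carrier H"
    show "lin_map H ?T (J a)" unfolding J_def
    proof (rule lin_map_tsum_param[OF H_kspace H_kspace kspace_tensor b1 _ comult_closed[OF a] H_kspace])
      fix a1 a2 assume "a1 \<in> carrier H" "a2 \<in> carrier H"
      then show "lin_map H ?T (\<lambda>c. tens H (tensor H H) a1 (tens H H a2 c))"
        by (intro lin_map_comp[OF bilin_right[OF bilin_tens] bilin_right[OF bilin_tens]])
    qed
  qed
  have QJ: "Q (J a c) = char_mult H f f' a * k c" if a: "a \<in> carrier H" and c: "c \<in> carrier H" for a c
  proof -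
    have "Q (J a c) = tsum ground (\<lambda>a1 a2. Q (tens H (tensor H H) a1 (tens H H a2 c))) (comult H a)"
      unfolding J_def
      by (rule tsum_comp[OF H_kspace H_kspace kspace_tensor ground_kspace b1[OF c] Q comult_closed[OF a]])
    also have "\<dots> = tsum ground (\<lambda>a1 a2. k c \<odot>\<^bsub>ground\<^esub> (f a1 * f' a2)) (comult H a)"
      by (rule tsum_cong[OF H_kspace H_kspace ground_kspace bilin_comp[OF b1[OF c] lin_map_id lin_map_id Q]
            bilin_scale[OF ground_kspace bilin_fun[OF f f']] _ comult_closed[OF a]])
         (simp add: Q_tens P_tens c)
    also have "\<dots> = k c \<odot>\<^bsub>ground\<^esub> char_mult H f f' a"
      unfolding char_mult_def'
      by (rule tsum_scale[OF H_kspace H_kspace ground_kspace bilin_fun[OF f f'] comult_closed[OF a]])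
    finally show ?thesis by simp
  qed
  have coassoc: "tsum ?T J (comult H h) = tsum ?T (\<lambda>a c. tens H (tensor H H) a (comult H c)) (comult H h)"
    using H h unfolding hopf_algebra_def J_def[abs_def] by blast
  have b2: "bilin H H ?T (\<lambda>a c. tens H (tensor H H) a (comult H c))"
    by (rule bilin_comp[OF bilin_tens lin_map_id comult_lin lin_map_id])
  have "char_mult H (char_mult H f f') k h = tsum ground (\<lambda>a c. Q (J a c)) (comult H h)"
    unfolding char_mult_def'[of "char_mult H f f'"]
    by (rule tsum_cong[OF H_kspace H_kspace ground_kspace bilin_fun[OF char_mult_lin[OF f f'] k]
          bilin_comp[OF J lin_map_id lin_map_id Q] _ comult_closed[OF h]])
       (simp add: QJ)
  also have "\<dots> = Q (tsum ?T J (comult H h))"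
    by (rule tsum_comp[OF H_kspace H_kspace kspace_tensor ground_kspace J Q comult_closed[OF h], symmetric])
  also have "\<dots> = tsum ground (\<lambda>a c. Q (tens H (tensor H H) a (comult H c))) (comult H h)"
    unfolding coassoc
    by (rule tsum_comp[OF H_kspace H_kspace kspace_tensor ground_kspace b2 Q comult_closed[OF h]])
  also have "\<dots> = char_mult H f (char_mult H f' k) h"
    unfolding char_mult_def'[of f]
    by (rule tsum_cong[OF H_kspace H_kspace ground_kspace bilin_comp[OF b2 lin_map_id lin_map_id Q]
          bilin_fun[OF f char_mult_lin[OF f' k]] _ comult_closed[OF h]])
       (simp add: Q_tens comult_closed char_mult_def' P_def)
  finally show ?thesis .
qed

lemma char_mult_counit:
  assumes f: "lin_fun f" and h: "h \<in> carrier H"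
  shows "char_mult H f (counit H) h = f h"
proof -
  have b: "bilin H H H (\<lambda>a c. counit H c \<odot>\<^bsub>H\<^esub> a)"
    using bilin_smult_fun[OF H_kspace counit_lin lin_map_id]
    by (auto simp: bilin_def)
  have "f h = f (tsum H (\<lambda>a c. counit H c \<odot>\<^bsub>H\<^esub> a) (comult H h))"
    using H h by (simp add: hopf_algebra_def)
  also have "\<dots> = tsum ground (\<lambda>a c. f (counit H c \<odot>\<^bsub>H\<^esub> a)) (comult H h)"
    by (rule tsum_comp[OF H_kspace H_kspace H_kspace ground_kspace b f comult_closed[OF h]])
  also have "\<dots> = char_mult H f (counit H) h"
    unfolding char_mult_def'
    by (rule tsum_cong[OF H_kspace H_kspace ground_kspace bilin_comp[OF b lin_map_id lin_map_id f]
          bilin_fun[OF f counit_lin] _ comult_closed[OF h]])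
       (simp add: lin_map_smult[OF f])
  finally show ?thesis ..
qed

lemma yd_char_lin: "yd_pair H g \<chi> \<Longrightarrow> lin_fun \<chi>"
  by (simp add: yd_pair_def alg_map_def)

text \<open>Applying \<open>\<chi>'\<close> to the Yetter-Drinfeld condition of \<open>(g, \<chi>)\<close> gives
  \<open>\<chi> = \<chi>' \<chi> (\<chi>' S)\<close>, and \<open>\<chi>' S\<close> is the inverse of \<open>\<chi>'\<close>.\<close>

lemma yd_chars_commute:
  assumes yd: "yd_pair H g \<chi>" and yd': "yd_pair H g' \<chi>'" and nz: "\<chi>' g \<noteq> 0" and h: "h \<in> carrier H"
  shows "char_mult H \<chi> \<chi>' h = char_mult H \<chi>' \<chi> h"
proof -
  note c = yd_char_lin[OF yd] and c' = yd_char_lin[OF yd']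
  have g: "g \<in> carrier H" using yd by (simp add: yd_pair_def group_like_def)
  have S: "lin_map H H (antipode H)" using H by (simp add: hopf_algebra_def)
  have hom': "\<chi>' \<in> ring_hom H ground" using yd' by (simp add: yd_pair_def alg_map_def)
  have m': "\<chi>' (a \<otimes>\<^bsub>H\<^esub> b) = \<chi>' a * \<chi>' b" if "a \<in> carrier H" "b \<in> carrier H" for a b
    using ring_hom_mult[OF hom' that] by simp
  have Sc [simp]: "antipode H a \<in> carrier H" if "a \<in> carrier H" for a by (rule lin_map_closed[OF S that])
  define \<sigma> where "\<sigma> a = \<chi>' (antipode H a)" for a
  have s: "lin_fun \<sigma>" unfolding \<sigma>_def by (rule lin_map_comp[OF S c'])
  have inv: "char_mult H \<sigma> \<chi>' a = counit H a" if a: "a \<in> carrier H" for a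
  proof -
    have b: "bilin H H H (\<lambda>u v. antipode H u \<otimes>\<^bsub>H\<^esub> v)"
      by (rule bilin_comp[OF H.bilin_mult S lin_map_id lin_map_id])
    have "char_mult H \<sigma> \<chi>' a = tsum ground (\<lambda>u v. \<chi>' (antipode H u \<otimes>\<^bsub>H\<^esub> v)) (comult H a)"
      unfolding char_mult_def'
      by (rule tsum_cong[OF H_kspace H_kspace ground_kspace bilin_fun[OF s c']
            bilin_comp[OF b lin_map_id lin_map_id c'] _ comult_closed[OF a]])
         (simp add: m' \<sigma>_def)
    also have "\<dots> = \<chi>' (tsum H (\<lambda>u v. antipode H u \<otimes>\<^bsub>H\<^esub> v) (comult H a))"
      by (rule tsum_comp[OF H_kspace H_kspace H_kspace ground_kspace b c' comult_closed[OF a], symmetric])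
    also have "\<dots> = counit H a"
      using H a ring_hom_one[OF hom'] by (simp add: hopf_algebra_def lin_map_smult[OF c'])
    finally show ?thesis .
  qed
  define J where "J h1 b = tsum H (\<lambda>h2 h3. \<chi> h2 \<odot>\<^bsub>H\<^esub> (h1 \<otimes>\<^bsub>H\<^esub> g \<otimes>\<^bsub>H\<^esub> antipode H h3)) (comult H b)" for h1 b
  have b1: "bilin H H H (\<lambda>h2 h3. \<chi> h2 \<odot>\<^bsub>H\<^esub> (h1 \<otimes>\<^bsub>H\<^esub> g \<otimes>\<^bsub>H\<^esub> antipode H h3))" if "h1 \<in> carrier H" for h1
    using that g
    by (intro bilin_smult_fun[OF H_kspace c] lin_map_comp[OF S H.lin_map_mult_left]) auto
  have J: "bilin H H H J"
  proof (rule bilinI)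
    fix h1 assume h1: "h1 \<in> carrier H"
    show "lin_map H H (J h1)" unfolding J_def
      by (rule lin_map_comp[OF comult_lin lin_map_tsum[OF H_kspace b1[OF h1] H_kspace H_kspace]])
  next
    fix b assume b: "b \<in> carrier H"
    show "lin_map H H (\<lambda>h1. J h1 b)" unfolding J_def
    proof (rule lin_map_tsum_param[OF H_kspace H_kspace H_kspace b1 _ comult_closed[OF b] H_kspace])
      fix h2 h3 assume "h2 \<in> carrier H" "h3 \<in> carrier H"
      then show "lin_map H H (\<lambda>h1. \<chi> h2 \<odot>\<^bsub>H\<^esub> (h1 \<otimes>\<^bsub>H\<^esub> g \<otimes>\<^bsub>H\<^esub> antipode H h3))"
        using g by (intro lin_map_scale[OF H_kspace]
            lin_map_comp[OF H.lin_map_mult_right[OF g] H.lin_map_mult_right]) auto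
    qed
  qed
  have cJ: "\<chi>' (J h1 b) = \<chi>' g * (\<chi>' h1 * char_mult H \<chi> \<sigma> b)" if h1: "h1 \<in> carrier H" and b: "b \<in> carrier H" for h1 b
  proof -
    have "\<chi>' (J h1 b) = tsum ground (\<lambda>h2 h3. \<chi>' (\<chi> h2 \<odot>\<^bsub>H\<^esub> (h1 \<otimes>\<^bsub>H\<^esub> g \<otimes>\<^bsub>H\<^esub> antipode H h3))) (comult H b)"
      unfolding J_def
      by (rule tsum_comp[OF H_kspace H_kspace H_kspace ground_kspace b1[OF h1] c' comult_closed[OF b]])
    also have "\<dots> = tsum ground (\<lambda>h2 h3. (\<chi>' g * \<chi>' h1) \<odot>\<^bsub>ground\<^esub> (\<chi> h2 * \<sigma> h3)) (comult H b)"
      by (rule tsum_cong[OF H_kspace H_kspace ground_kspace bilin_comp[OF b1[OF h1] lin_map_id lin_map_id c']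
            bilin_scale[OF ground_kspace bilin_fun[OF c s]] _ comult_closed[OF b]])
         (simp add: lin_map_smult[OF c'] m' h1 g \<sigma>_def)
    also have "\<dots> = (\<chi>' g * \<chi>' h1) \<odot>\<^bsub>ground\<^esub> char_mult H \<chi> \<sigma> b"
      unfolding char_mult_def'
      by (rule tsum_scale[OF H_kspace H_kspace ground_kspace bilin_fun[OF c s] comult_closed[OF b]])
    finally show ?thesis by simp
  qed
  \<comment> \<open>Since \<open>\<chi>'\<close> is multiplicative, \<open>\<chi>' g\<close> is a
    common factor of both sides; being nonzero, it cancels.\<close>
  have conj: "\<chi> a = char_mult H \<chi>' (char_mult H \<chi> \<sigma>) a" if a: "a \<in> carrier H" for a
  proof -
    have "\<chi> a \<odot>\<^bsub>H\<^esub> g = tsum H J (comult H a)"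
      using yd a unfolding yd_pair_def J_def[abs_def] by blast
    then have "\<chi> a * \<chi>' g = \<chi>' (tsum H J (comult H a))"
      using lin_map_smult[OF c' g, of "\<chi> a"] by simp
    also have "\<dots> = tsum ground (\<lambda>h1 b. \<chi>' (J h1 b)) (comult H a)"
      by (rule tsum_comp[OF H_kspace H_kspace H_kspace ground_kspace J c' comult_closed[OF a]])
    also have "\<dots> = tsum ground (\<lambda>h1 b. \<chi>' g \<odot>\<^bsub>ground\<^esub> (\<chi>' h1 * char_mult H \<chi> \<sigma> b)) (comult H a)"
      by (rule tsum_cong[OF H_kspace H_kspace ground_kspace bilin_comp[OF J lin_map_id lin_map_id c']
            bilin_scale[OF ground_kspace bilin_fun[OF c' char_mult_lin[OF c s]]] _ comult_closed[OF a]])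
         (simp add: cJ)
    also have "\<dots> = \<chi>' g \<odot>\<^bsub>ground\<^esub> char_mult H \<chi>' (char_mult H \<chi> \<sigma>) a"
      unfolding char_mult_def'[of \<chi>']
      by (rule tsum_scale[OF H_kspace H_kspace ground_kspace bilin_fun[OF c' char_mult_lin[OF c s]]
            comult_closed[OF a]])
    finally show ?thesis using nz by simp
  qed
  \<comment> \<open>Convolving with \<open>\<chi>'\<close> on the right removes its inverse
    \<sigma>.\<close>
  have "char_mult H \<chi> \<chi>' h = char_mult H (char_mult H \<chi>' (char_mult H \<chi> \<sigma>)) \<chi>' h"
    by (rule char_mult_cong) (simp_all add: c c' s char_mult_lin h conj[symmetric])
  also have "\<dots> = char_mult H \<chi>' (char_mult H (char_mult H \<chi> \<sigma>) \<chi>') h"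
    by (rule char_mult_assoc[OF c' char_mult_lin[OF c s] c' h])
  also have "\<dots> = char_mult H \<chi>' \<chi> h"
  proof (rule char_mult_cong)
    fix a assume a: "a \<in> carrier H"
    have "char_mult H (char_mult H \<chi> \<sigma>) \<chi>' a = char_mult H \<chi> (char_mult H \<sigma> \<chi>') a"
      by (rule char_mult_assoc[OF c s c' a])
    also have "\<dots> = char_mult H \<chi> (counit H) a"
      by (rule char_mult_cong) (simp_all add: c c' s char_mult_lin counit_lin a inv)
    also have "\<dots> = \<chi> a" by (rule char_mult_counit[OF c a])
    finally show "char_mult H (char_mult H \<chi> \<sigma>) \<chi>' a = \<chi> a" .
  qed (simp_all add: c c' s char_mult_lin h)
  finally show ?thesis .
qed

end

text \<open>The character of degree (m1, m2), normalised with all factors \<open>\<chi> G1\<close>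
  on the left.\<close>

definition wt :: "('k::field, 'h, 'm) hopf_scheme \<Rightarrow> (gen \<Rightarrow> 'h \<Rightarrow> 'k) \<Rightarrow> nat \<Rightarrow> nat \<Rightarrow> 'h \<Rightarrow> 'k" where
  "wt H \<chi> m1 m2 = (char_mult H (\<chi> G1) ^^ m1) (char_pow H (\<chi> G2) m2)"

definition wt_space where
  "wt_space H \<chi> A act m1 m2 = {a \<in> carrier A. \<forall>h\<in>carrier H. act h a = wt H \<chi> m1 m2 h \<odot>\<^bsub>A\<^esub> a}"

context
  fixes H :: "('k::field, 'h, 'm) hopf_scheme" and g :: "gen \<Rightarrow> 'h" and \<chi> :: "gen \<Rightarrow> 'h \<Rightarrow> 'k"
  assumes H: "hopf_algebra H" and yd: "\<And>i. yd_pair H (g i) (\<chi> i)" and nz: "\<chi> G2 (g G1) \<noteq> 0"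
begin

lemmas H_sp = H_kspace[OF H]

lemma chi_lin: "lin_map H ground (\<chi> i)"
  by (rule yd_char_lin[OF H yd])

lemma char_pow_lin: "lin_map H ground (char_pow H (\<chi> i) n)"
  by (induction n) (simp_all add: counit_lin[OF H] char_mult_lin[OF H] chi_lin)

lemma wt_lin: "lin_map H ground (wt H \<chi> m1 m2)"
  unfolding wt_def by (induction m1) (simp_all add: char_pow_lin char_mult_lin[OF H] chi_lin)

lemma wt_0_0: "wt H \<chi> 0 0 = counit H"
  by (simp add: wt_def)

lemma wt_Suc1: "char_mult H (\<chi> G1) (wt H \<chi> m1 m2) = wt H \<chi> (Suc m1) m2"
  by (simp add: wt_def)

text \<open>Restores the normal form: the new factor \<open>\<chi> G2\<close> is moved past each
  \<open>\<chi> G1\<close> by commutation of the two characters.\<close>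

lemma wt_Suc2: "h \<in> carrier H \<Longrightarrow> char_mult H (\<chi> G2) (wt H \<chi> m1 m2) h = wt H \<chi> m1 (Suc m2) h"
proof (induction m1 arbitrary: h)
  case 0
  then show ?case by (simp add: wt_def)
next
  case (Suc m1)
  have "char_mult H (\<chi> G2) (wt H \<chi> (Suc m1) m2) h =
      char_mult H (char_mult H (\<chi> G2) (\<chi> G1)) (wt H \<chi> m1 m2) h"
    unfolding wt_Suc1[symmetric]
    by (rule char_mult_assoc[OF H chi_lin chi_lin wt_lin Suc.prems, symmetric])
  also have "\<dots> = char_mult H (char_mult H (\<chi> G1) (\<chi> G2)) (wt H \<chi> m1 m2) h"
    by (rule char_mult_cong[OF H])
       (simp_all add: char_mult_lin[OF H] chi_lin wt_lin Suc.prems yd_chars_commute[OF H yd yd nz])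
  also have "\<dots> = char_mult H (\<chi> G1) (char_mult H (\<chi> G2) (wt H \<chi> m1 m2)) h"
    by (rule char_mult_assoc[OF H chi_lin chi_lin wt_lin Suc.prems])
  also have "\<dots> = char_mult H (\<chi> G1) (wt H \<chi> m1 (Suc m2)) h"
    by (rule char_mult_cong[OF H])
       (simp_all add: char_mult_lin[OF H] chi_lin wt_lin Suc)
  finally show ?case by (simp add: wt_Suc1)
qed

text \<open>Stripping the factors \<open>\<chi> G2\<close> and then m1 factors
  \<open>\<chi> G1\<close> leaves the N-th power of \<open>\<chi> G1\<close>, which is the
  counit.\<close>

lemma wt_trivial:
  assumes "trivial_char H (char_pow H (\<chi> G1) N)" "h \<in> carrier H"
  shows "wt H \<chi> (m1 + N) m2 h = wt H \<chi> m1 m2 h"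
  using assms(2)
proof (induction m2 arbitrary: h)
  case 0
  have pow: "char_pow H (\<chi> G1) n = wt H \<chi> n 0" for n
    by (induction n) (simp_all add: wt_def)
  show ?case using 0
  proof (induction m1 arbitrary: h)
    case 0
    then show ?case using assms(1) by (simp add: trivial_char_def pow wt_0_0)
  next
    case (Suc m1)
    then show ?case unfolding add_Suc wt_Suc1[symmetric]
      by (intro char_mult_cong[OF H]) (simp_all add: chi_lin wt_lin)
  qed
next
  case (Suc m2)
  then show ?case unfolding wt_Suc2[OF Suc.prems, symmetric]
    by (intro char_mult_cong[OF H]) (simp_all add: chi_lin wt_lin)
qed

context
  fixes A :: "('k, 'a, 'n) module_scheme" and act and y :: "gen \<Rightarrow> 'a" and N q q12 l1 l2 l12
  assumes A: "pbw_alg A y N q q12 l1 l2 l12"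
    and ma: "module_algebra H A act"
    and act_gen: "\<And>h i. h \<in> carrier H \<Longrightarrow> act h (y i) = \<chi> i h \<odot>\<^bsub>A\<^esub> y i"
begin

interpretation A: pbw_alg A y N q q12 l1 l2 l12 by (rule A)

lemma act_lin: "h \<in> carrier H \<Longrightarrow> lin_map A A (act h)"
  using ma by (simp add: module_algebra_def)

lemma act_lin_left: "a \<in> carrier A \<Longrightarrow> lin_map H A (\<lambda>h. act h a)"
  using ma by (simp add: module_algebra_def)

lemma subsp_wt_space: "subsp A (wt_space H \<chi> A act m1 m2)"
  unfolding subsp_def wt_space_def
  using lin_map_zero[OF A.kspace_axioms A.kspace_axioms act_lin]
  by (auto simp: lin_map_add[OF act_lin] lin_map_smult[OF act_lin] A.smult_r_distr A.smult_smult mult.commute)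

lemma act_gen_mult:
  assumes a: "a \<in> wt_space H \<chi> A act m1 m2" and h: "h \<in> carrier H"
  shows "act h (y i \<otimes>\<^bsub>A\<^esub> a) = char_mult H (\<chi> i) (wt H \<chi> m1 m2) h \<odot>\<^bsub>A\<^esub> (y i \<otimes>\<^bsub>A\<^esub> a)"
proof -
  have ac: "a \<in> carrier A" and aw: "\<And>h. h \<in> carrier H \<Longrightarrow> act h a = wt H \<chi> m1 m2 h \<odot>\<^bsub>A\<^esub> a"
    using a by (auto simp: wt_space_def)
  have L: "lin_map ground A (\<lambda>s. s \<odot>\<^bsub>A\<^esub> (y i \<otimes>\<^bsub>A\<^esub> a))"
    using ac by (intro lin_mapI) (auto simp: A.smult_l_distr A.smult_smult)
  note bf = bilin_fun[OF H chi_lin wt_lin, of i m1 m2]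
  have "act h (y i \<otimes>\<^bsub>A\<^esub> a) = tsum A (\<lambda>h1 h2. act h1 (y i) \<otimes>\<^bsub>A\<^esub> act h2 a) (comult H h)"
    using ma h ac by (simp add: module_algebra_def)
  also have "\<dots> = tsum A (\<lambda>h1 h2. (\<chi> i h1 * wt H \<chi> m1 m2 h2) \<odot>\<^bsub>A\<^esub> (y i \<otimes>\<^bsub>A\<^esub> a)) (comult H h)"
  proof (rule tsum_cong[OF H_sp H_sp A.kspace_axioms _ _ _ comult_closed[OF H h]])
    show "bilin H H A (\<lambda>h1 h2. act h1 (y i) \<otimes>\<^bsub>A\<^esub> act h2 a)"
      by (rule bilin_comp[OF A.bilin_mult act_lin_left[OF A.gen_closed] act_lin_left[OF ac] lin_map_id])
    show "bilin H H A (\<lambda>h1 h2. (\<chi> i h1 * wt H \<chi> m1 m2 h2) \<odot>\<^bsub>A\<^esub> (y i \<otimes>\<^bsub>A\<^esub> a))"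
      by (rule bilin_comp[OF bf lin_map_id lin_map_id L])
  qed (use ac in \<open>simp add: act_gen aw A.smult_mult_left A.smult_mult_right A.smult_smult mult.commute\<close>)
  also have "\<dots> = char_mult H (\<chi> i) (wt H \<chi> m1 m2) h \<odot>\<^bsub>A\<^esub> (y i \<otimes>\<^bsub>A\<^esub> a)"
    unfolding char_mult_def'[OF H]
    by (rule tsum_comp[OF H_sp H_sp kspace_ground A.kspace_axioms bf L comult_closed[OF H h], symmetric])
  finally show ?thesis .
qed

lemma wt_y1: "a \<in> wt_space H \<chi> A act m1 m2 \<Longrightarrow> y G1 \<otimes>\<^bsub>A\<^esub> a \<in> wt_space H \<chi> A act (Suc m1) m2"
  using act_gen_mult[of a m1 m2 _ G1] unfolding wt_Suc1 by (simp add: wt_space_def)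

lemma wt_y2: "a \<in> wt_space H \<chi> A act m1 m2 \<Longrightarrow> y G2 \<otimes>\<^bsub>A\<^esub> a \<in> wt_space H \<chi> A act m1 (Suc m2)"
  using act_gen_mult[of a m1 m2 _ G2] by (simp add: wt_space_def wt_Suc2)

lemma wt_y12: "a \<in> wt_space H \<chi> A act m1 m2 \<Longrightarrow> A.y12 \<otimes>\<^bsub>A\<^esub> a \<in> wt_space H \<chi> A act (Suc m1) (Suc m2)"
  using subsp_carrier[OF subsp_wt_space, of a m1 m2]
  by (auto simp: A.y12_mult intro!: subsp_diff[OF A.kspace_axioms subsp_wt_space]
      subsp_smult[OF subsp_wt_space] wt_y1 wt_y2)

lemma wt_Y: "pbw A q12 y a b c \<in> wt_space H \<chi> A act (b + c) (a + b)"
proof -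
  have 1: "A.Y 0 0 c \<in> wt_space H \<chi> A act c 0"
  proof (induction c)
    case 0
    show ?case using ma by (simp add: wt_space_def wt_0_0 module_algebra_def A.Y_000)
  next
    case (Suc c)
    then show ?case unfolding A.y1_Y00[symmetric] by (rule wt_y1)
  qed
  have 2: "A.Y 0 b c \<in> wt_space H \<chi> A act (b + c) b"
  proof (induction b)
    case (Suc b)
    then show ?case unfolding A.y12_Y0[symmetric] using wt_y12 by simp
  qed (simp add: 1)
  show ?thesis
  proof (induction a)
    case (Suc a)
    then show ?case unfolding A.y2_Y[symmetric] using wt_y2 by simp
  qed (simp add: 2)
qed

text \<open>This is why correction monomials, whose degree in y1 is lower by \<open>N\<close>, keep
  the weight of the leading monomial.\<close>

lemma wt_space_trivial:
  "trivial_char H (char_pow H (\<chi> G1) N) \<Longrightarrow> wt_space H \<chi> A act (m1 + N) m2 = wt_space H \<chi> A act m1 m2"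
  by (auto simp: wt_space_def wt_trivial)

end

end

section \<open>Specialisation to the presented algebras, and linearity over the Hopf algebra\<close>

theorem corollary4p4:
  fixes H :: "('k::{alg_closed_field, field_char_0}, 'h) hopf"
    and N :: nat and q q12 q21 l1 l2 l12 :: 'k
    and g :: "gen \<Rightarrow> 'h" and \<chi> :: "gen \<Rightarrow> 'h \<Rightarrow> 'k"
    and B E :: "('k, 'k free_alg set) module"
    and x y :: "gen \<Rightarrow> 'k free_alg set"
    and actB actE :: "'h \<Rightarrow> 'k free_alg set \<Rightarrow> 'k free_alg set"
    and coactB :: "'k free_alg set \<Rightarrow> ('h \<times> 'k free_alg set \<Rightarrow>\<^sub>0 'k) set"
    and \<Delta> \<rho> :: "'k free_alg set \<Rightarrow> ('k free_alg set \<times> 'k free_alg set \<Rightarrow>\<^sub>0 'k) set"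
    and \<epsilon> \<epsilon>0 :: "'k free_alg set \<Rightarrow> 'k"
    and \<gamma> :: "'k free_alg set \<Rightarrow> 'k free_alg set"
  assumes "N \<ge> 3" and "primitive_root_of_unity N q" and "q12 * q21 = inverse q"
    and "hopf_algebra H" and "semisimple_ring H"
    and "\<And>i. yd_pair H (g i) (\<chi> i)"
    and "\<chi> G1 (g G1) = q" and "\<chi> G2 (g G1) = q12" and "\<chi> G1 (g G2) = q21" and "\<chi> G2 (g G2) = q"
    (* the Nichols algebra B, as an algebra in Yetter-Drinfeld modules and a braided bialgebra *)
    and "B = presented_alg (nichols_rels N q q12)"
    and "x = presented_gen (nichols_rels N q q12)"
    and "module_algebra H B actB"
    and "\<And>h i. h \<in> carrier H \<Longrightarrow> actB h (x i) = \<chi> i h \<odot>\<^bsub>B\<^esub> x i"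
    and "alg_map B (tensor_alg H B) coactB" and "\<And>i. coactB (x i) = tens H B (g i) (x i)"
    and "alg_map B (braided_tensor_alg actB coactB B B) \<Delta>"
    and "\<And>i. \<Delta> (x i) = tens B B (x i) \<one>\<^bsub>B\<^esub> \<oplus>\<^bsub>tensor B B\<^esub> tens B B \<one>\<^bsub>B\<^esub> (x i)"
    and "alg_map B ground \<epsilon>" and "\<And>i. \<epsilon> (x i) = 0"
    (* the cleft object E *)
    and "admissible H \<chi> N (l1, l2, l12, 0, 0)"
    and "E = presented_alg (cleft_rels N q q12 (l1, l2, l12, 0, 0))"
    and "y = presented_gen (cleft_rels N q q12 (l1, l2, l12, 0, 0))"
    and "module_algebra H E actE"
    and "\<And>h i. h \<in> carrier H \<Longrightarrow> actE h (y i) = \<chi> i h \<odot>\<^bsub>E\<^esub> y i"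
    and "alg_map E (braided_tensor_alg actE coactB E B) \<rho>"
    and "\<And>i. \<rho> (y i) = tens E B (y i) \<one>\<^bsub>B\<^esub> \<oplus>\<^bsub>tensor E B\<^esub> tens E B \<one>\<^bsub>E\<^esub> (x i)"
    and "lin_map E ground \<epsilon>0"
    and "\<And>n2 n12 n1. n2 < N \<Longrightarrow> n12 < N \<Longrightarrow> n1 < N \<Longrightarrow>
           \<epsilon>0 (pbw E q12 y n2 n12 n1) = (if n2 = 0 \<and> n12 = 0 \<and> n1 = 0 then 1 else 0)"
    (* the map gamma *)
    and "lin_map B E \<gamma>"
    and "\<And>n2 n12 n1. n2 < N \<Longrightarrow> n12 < N \<Longrightarrow> n1 < N \<Longrightarrow> n12 + n1 < N \<Longrightarrow>
           \<gamma> (pbw B q12 x n2 n12 n1) = pbw E q12 y n2 n12 n1"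
    and "\<And>n2 n12 n1. n2 < N \<Longrightarrow> n12 < N \<Longrightarrow> n1 < N \<Longrightarrow> n12 + n1 \<ge> N \<Longrightarrow>
           \<gamma> (pbw B q12 x n2 n12 n1) =
             pbw E q12 y n2 n12 n1 \<ominus>\<^bsub>E\<^esub> l1 \<odot>\<^bsub>E\<^esub>
               finsum E
                 (\<lambda>(k, m).
                    (gauss_binomial q n12 k * gauss_binomial q n1 m * (1 - inverse q) ^ k
                     * q21 ^ (n2 * (k + m) + m * n12 + k * (k - 1) div 2) * q ^ (m * (n12 - k)))
                    \<odot>\<^bsub>E\<^esub> pbw E q12 y (n2 + k) (n12 - k) (n1 - m))
                 {(k, m). k \<le> n12 \<and> m \<le> n1 \<and> k + m = N \<and> n2 + k < N}"
  shows "is_section H B actB \<Delta> \<epsilon> E actE \<rho> \<gamma> \<and> (\<forall>b\<in>carrier B. \<epsilon>0 (\<gamma> b) = \<epsilon> b)"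
proof -
  note N = assms(1) and root = assms(2) and q12q21 = assms(3) and H = assms(4) and yd = assms(6)
    and chi = assms(7-10) and B_def = assms(11) and x_def = assms(12) and maB = assms(13)
    and actB_x = assms(14) and coact = assms(15) and coact_x = assms(16) and Delta = assms(17)
    and Delta_x = assms(18) and eps = assms(19) and eps_x = assms(20) and adm = assms(21)
    and E_def = assms(22) and y_def = assms(23) and maE = assms(24) and actE_y = assms(25)
    and rho = assms(26) and rho_y = assms(27) and eps0 = assms(28) and eps0_Y = assms(29)
    and gamma = assms(30) and gamma_small = assms(31) and gamma_large = assms(32)
  have q_nz: "q \<noteq> 0"
    using root N by (auto simp: primitive_root_of_unity_def power_0_left)
  have q12_nz: "q12 \<noteq> 0" using q12q21 q_nz by auto
  have pE: "pbw_alg E y N q q12 l1 l2 l12"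
    unfolding E_def y_def by (rule pbw_alg_presented) (use N in simp)
  have pB: "pbw_alg B x N q q12 0 0 0"
    unfolding B_def x_def nichols_rels_eq by (rule pbw_alg_presented) (use N in simp)
  interpret E: pbw_alg E y N q q12 l1 l2 l12 by (rule pE)
  interpret B: pbw_alg B x N q q12 0 0 0 by (rule pB)
  note kE = E.kalg_axioms and kB = B.kalg_axioms
  have cE: "diag_comod E B y x (\<lambda>i j. \<chi> j (g i)) (\<lambda>i. actE (g i)) \<rho>"
    by (rule diag_comodI[OF H kE kB E.gen B.gen yd maE actE_y coact coact_x rho rho_y])
  have cB: "diag_comod B B x x (\<lambda>i j. \<chi> j (g i)) (\<lambda>i. actB (g i)) \<Delta>"
    by (rule diag_comodI[OF H kB kB B.gen B.gen yd maB actB_x coact coact_x Delta Delta_x])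
  interpret C: cleft_comod E B y x "\<lambda>i j. \<chi> j (g i)" "\<lambda>i. actE (g i)" \<rho> N q q12 l1 l2 l12 q21 \<epsilon>0
    by (intro cleft_comod.intro cleft_comod_axioms.intro cE pE pB q_nz q12q21 chi eps0 eps0_Y)
  have eps_lin: "lin_map B ground \<epsilon>" and eps_hom: "\<epsilon> \<in> ring_hom B ground"
    using eps by (simp_all add: alg_map_def)
  have eps_gen: "\<epsilon> (x i \<otimes>\<^bsub>B\<^esub> c) = 0" if "c \<in> carrier B" for c i
    using ring_hom_mult[OF eps_hom B.gen_closed that, of i] eps_x[of i] by simp
  interpret S: cleft_section E B y x "\<lambda>i j. \<chi> j (g i)" "\<lambda>i. actE (g i)" \<rho> N q q12 l1 l2 l12 q21 \<epsilon>0
    "\<lambda>i. actB (g i)" \<Delta> \<epsilon> \<gamma>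
    by (intro cleft_section.intro cleft_section_axioms.intro C.cleft_comod_axioms cB eps_lin eps_gen gamma
        gamma_small gamma_large[folded C.corr_coeff_def])
       (use ring_hom_one[OF eps_hom] in simp_all)
  \<comment> \<open>The scalar cancelled in the proof that the two characters commute.\<close>
  have nz: "\<chi> G2 (g G1) \<noteq> 0" using q12_nz chi by simp
  have linear: "\<gamma> (actB h c) = actE h (\<gamma> c)" if h: "h \<in> carrier H" and c: "c \<in> carrier B" for h c
  proof (rule B.PBW_lin_eqI[OF E.kspace_axioms _ _ _ c])
    have aB: "lin_map B B (actB h)" and aE: "lin_map E E (actE h)"
      using maB maE h by (simp_all add: module_algebra_def)
    show "lin_map B E (\<lambda>c. \<gamma> (actB h c))" by (rule lin_map_comp[OF aB gamma])
    show "lin_map B E (\<lambda>c. actE h (\<gamma> c))" by (rule lin_map_comp[OF gamma aE])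
    fix n2 n12 n1 assume n: "n2 < N" "n12 < N" "n1 < N"
    \<comment> \<open>The weight of the PBW monomial in \<open>B\<close>. Once its image lies in
      this space, \<open>h\<close> acts on both by the same scalar.\<close>
    let ?W = "wt_space H \<chi> E actE (n12 + n1) (n2 + n12)"
    note W = subsp_wt_space[OF H yd nz pE maE actE_y, of "n12 + n1" "n2 + n12"]
    note wt_YE = wt_Y[OF H yd nz pE maE actE_y]
    have "\<gamma> (B.Y n2 n12 n1) \<in> ?W"
    proof (cases "n12 + n1 < N")
      case True
      then show ?thesis using n wt_YE by (simp add: gamma_small)
    next
      case False
      let ?f = "\<lambda>(k, m). C.corr_coeff n2 n12 n1 k m \<odot>\<^bsub>E\<^esub> E.Y (n2 + k) (n12 - k) (n1 - m)"
      let ?S = "C.corr_set n2 n12 n1"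
      have "l1 \<odot>\<^bsub>E\<^esub> finsum E ?f ?S \<in> ?W"
      \<comment> \<open>Admissibility makes the character trivial only for nonzero
        \<open>l1\<close>; otherwise the whole correction is zero.\<close>
      proof (cases "l1 = 0")
        case True
        have "finsum E ?f ?S \<in> carrier E" by (rule E.finsum_closed) auto
        then show ?thesis using True subsp_zero[OF W] by simp
      next
        case l1: False
        then have tr: "trivial_char H (char_pow H (\<chi> G1) N)" using adm by simp
        have "E.Y (n2 + k) (n12 - k) (n1 - m) \<in> ?W" if "(k, m) \<in> ?S" for k m
        proof -
          \<comment> \<open>Since y12 counts in both degrees, trading k copies of it for y2
            preserves the degree in y2, and k + m = N is lost in y1.\<close>
          have eq: "n12 + n1 = (n12 - k + (n1 - m)) + N" "n2 + n12 = n2 + k + (n12 - k)"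
            using that by auto
          show ?thesis
            unfolding eq by (subst wt_space_trivial[OF H yd nz pE maE actE_y tr]) (simp_all add: wt_YE)
        qed
        then show ?thesis
          by (intro subsp_smult[OF W] subsp_finsum[OF E.kspace_axioms W]) (auto intro!: subsp_smult[OF W])
      qed
      then show ?thesis
        using n False wt_YE
        by (simp add: S.gamma_large subsp_diff[OF E.kspace_axioms W])
    qed
    then have "actE h (\<gamma> (B.Y n2 n12 n1)) = wt H \<chi> (n12 + n1) (n2 + n12) h \<odot>\<^bsub>E\<^esub> \<gamma> (B.Y n2 n12 n1)"
      using h by (simp add: wt_space_def)
    moreover have "actB h (B.Y n2 n12 n1) = wt H \<chi> (n12 + n1) (n2 + n12) h \<odot>\<^bsub>B\<^esub> B.Y n2 n12 n1"
      using wt_Y[OF H yd nz pB maB actB_x, of n2 n12 n1] h by (simp add: wt_space_def)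
    ultimately show "\<gamma> (actB h (B.Y n2 n12 n1)) = actE h (\<gamma> (B.Y n2 n12 n1))"
      by (simp add: lin_map_smult[OF gamma])
  qed
  show ?thesis
    unfolding is_section_def
    using gamma S.gamma_bij linear S.gamma_colinear S.gamma_convol_invertible S.gamma_one S.eps0_gamma
    by blast
qed

end
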